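(* Let $n\ge 3$ and $d\in\mathbb{N}$, and set $\alpha=\frac{n-3}{2}$. Then $$\boldsymbol{\lambda}\big(\mathcal{H}_d(\mathbb{S}^{n-1})\big)=\frac{2d+n-2}{2^{n-2}}\,\frac{\Gamma(d+n-2)}{\Gamma\big(\frac{n-1}{2}\big)\,\Gamma\big(d+\frac{n-1}{2}\big)}\int_{-1}^{1}\big|P_d^{(\alpha,\alpha)}(t)\big|\,(1-t^2)^{\alpha}\,dt.$$ Alternatively, in terms of Gegenbauer polynomials, $$\boldsymbol{\lambda}\big(\mathcal{H}_d(\mathbb{S}^{n-1})\big)=\frac{2d+n-2}{n-2}\int_{\mathbb{S}^{n-1}}\big|C_d^{(\frac{n-2}{2})}(\eta_1)\big|\,d\sigma_n(\eta).$$
   Context: $\mathbb{N}=\{1,2,\dots\}$. $\mathbb{S}^{n-1}$ is the Euclidean unit sphere of $\mathbb{R}^n$, $\sigma_n$ its normalized rotation-invariant surface measure, $\eta_1$ the first coordinate of $\eta$. $\mathcal{H}_d(\mathbb{S}^{n-1})$ is the space of restrictions to $\mathbb{S}^{n-1}$ of $d$-homogeneous harmonic polynomials on $\mathbb{R}^n$ with complex coefficients, a complex Banach space under the supremum norm on $\mathbb{S}^{n-1}$. For $\alpha,\beta>-1$, the Jacobi polynomial $P_d^{(\alpha,\beta)}$ is $$P_d^{(\alpha,\beta)}(t)=\frac{(-1)^d}{2^d d!}(1-t)^{-\alpha}(1+t)^{-\beta}\Big(\frac{d}{dt}\Big)^d\big[(1-t)^{\alpha+d}(1+t)^{\beta+d}\big],$$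 i.e. the degree-$d$ polynomial orthogonal on $[-1,1]$ for the weight $(1-t)^\alpha(1+t)^\beta$ to all polynomials of lower degree, normalized by $P_d^{(\alpha,\beta)}(1)=\binom{d+\alpha}{d}$. For $\lambda>0$, the Gegenbauer polynomial is $$C_d^{(\lambda)}(t)=\frac{\Gamma(2\lambda+d)\,\Gamma(\lambda+\frac12)}{\Gamma(2\lambda)\,\Gamma(\lambda+\frac12+d)}\,P_d^{(\lambda-\frac12,\lambda-\frac12)}(t).$$ For a subspace $X$ of a Banach space $Y$, $\boldsymbol{\lambda}(X,Y)=\inf\{\|P\|: P\in\mathcal{L}(Y,X),\ P|_X=\mathrm{id}_X\}$ (with $\inf\varnothing=\infty$). The (absolute) projection constant of $X$ is $\boldsymbol{\lambda}(X)=\sup\boldsymbol{\lambda}(I(X),Y)$, the supremum over all complex Banach spaces $Y$ and all linear isometric embeddings $I\colon X\to Y$. *)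

theory Defs
  imports "HOL-Probability.Probability_Measure" "HOL-Algebra.Module"
begin

section \<open>Complex Banach spaces\<close>

text \<open>
  The projection constant quantifies over all complex Banach spaces, so Banach spaces are
  carrier-based structures here rather than types: modules in the sense of HOL-Algebra over the
  complex field, together with a norm. The ring fields \<open>mult\<close> and \<open>one\<close> that a
  module record inherits carry no meaning, and neither do the values of operations and maps outside
  the carrier.
\<close>

definition complex_field :: "complex ring"
  where "complex_field = \<lparr>carrier = UNIV, monoid.mult = (*), one = 1, zero = 0, add = (+)\<rparr>"

lemma cring_complex_field: "cring complex_field"
proof (rule cringI)
  show "abelian_group complex_field"
  proof (rule abelian_groupI)
    fix x assume "x \<in> carrier complex_field"
    show "\<exists>y\<in>carrier complex_field. y \<oplus>\<^bsub>complex_field\<^esub> x = \<zero>\<^bsub>complex_field\<^esub>"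
      by (rule bexI[of _ "- x"]) (simp_all add: complex_field_def)
  qed (simp_all add: complex_field_def)
  show "comm_monoid complex_field"
    by (rule comm_monoidI) (simp_all add: complex_field_def)
qed (simp add: complex_field_def algebra_simps)

record 'b normed_structure = "(complex, 'b) module" +
  vnorm :: "'b \<Rightarrow> real"

locale complex_normed_space = Module.module complex_field Y
  for Y :: "'b normed_structure" (structure) +
  assumes vnorm_nonneg: "x \<in> carrier Y \<Longrightarrow> 0 \<le> vnorm Y x"
    and vnorm_eq_zero: "x \<in> carrier Y \<Longrightarrow> vnorm Y x = 0 \<longleftrightarrow> x = \<zero>\<^bsub>Y\<^esub>"
    and vnorm_smult: "x \<in> carrier Y \<Longrightarrow> vnorm Y (c \<odot>\<^bsub>Y\<^esub> x) = cmod c * vnorm Y x"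
    and vnorm_triangle:
      "x \<in> carrier Y \<Longrightarrow> y \<in> carrier Y \<Longrightarrow> vnorm Y (x \<oplus>\<^bsub>Y\<^esub> y) \<le> vnorm Y x + vnorm Y y"

locale complex_banach_space = complex_normed_space +
  assumes complete:
    "\<lbrakk>\<And>k. s k \<in> carrier Y;
      \<And>e. e > 0 \<Longrightarrow> \<exists>N. \<forall>j\<ge>N. \<forall>k\<ge>N. vnorm Y (s j \<ominus>\<^bsub>Y\<^esub> s k) < e\<rbrakk>
     \<Longrightarrow> \<exists>x\<in>carrier Y. (\<lambda>k. vnorm Y (s k \<ominus>\<^bsub>Y\<^esub> x)) \<longlonglongrightarrow> 0"

definition complex_linear_map ::
  "'a normed_structure \<Rightarrow> 'b normed_structure \<Rightarrow> ('a \<Rightarrow> 'b) \<Rightarrow> bool"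
  where "complex_linear_map X Y f \<longleftrightarrow>
    f \<in> carrier X \<rightarrow> carrier Y \<and>
    (\<forall>x\<in>carrier X. \<forall>y\<in>carrier X. f (x \<oplus>\<^bsub>X\<^esub> y) = f x \<oplus>\<^bsub>Y\<^esub> f y) \<and>
    (\<forall>c. \<forall>x\<in>carrier X. f (c \<odot>\<^bsub>X\<^esub> x) = c \<odot>\<^bsub>Y\<^esub> f x)"

definition bounded_operator ::
  "'a normed_structure \<Rightarrow> 'b normed_structure \<Rightarrow> ('a \<Rightarrow> 'b) \<Rightarrow> bool"
  where "bounded_operator X Y f \<longleftrightarrow>
    complex_linear_map X Y f \<and> (\<exists>K. \<forall>x\<in>carrier X. vnorm Y (f x) \<le> K * vnorm X x)"

definition operator_norm ::
  "'a normed_structure \<Rightarrow> 'b normed_structure \<Rightarrow> ('a \<Rightarrow> 'b) \<Rightarrow> real"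
  where "operator_norm X Y f = (SUP x\<in>{x \<in> carrier X. vnorm X x \<le> 1}. vnorm Y (f x))"

definition isometric_embedding ::
  "'a normed_structure \<Rightarrow> 'b normed_structure \<Rightarrow> ('a \<Rightarrow> 'b) \<Rightarrow> bool"
  where "isometric_embedding X Y I \<longleftrightarrow>
    complex_linear_map X Y I \<and> (\<forall>x\<in>carrier X. vnorm Y (I x) = vnorm X x)"

section \<open>Projection constants\<close>

definition bounded_projections :: "'b set \<Rightarrow> 'b normed_structure \<Rightarrow> ('b \<Rightarrow> 'b) set"
  where "bounded_projections V Y =
    {P. bounded_operator Y Y P \<and> P ` carrier Y \<subseteq> V \<and> (\<forall>v\<in>V. P v = v)}"

text \<open>The infimum of the empty set in \<^typ>\<open>ereal\<close> is \<open>\<infinity>\<close>.\<close>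

definition relative_projection_constant :: "'b set \<Rightarrow> 'b normed_structure \<Rightarrow> ereal"
  where "relative_projection_constant V Y =
    (INF P\<in>bounded_projections V Y. ereal (operator_norm Y Y P))"

text \<open>
  HOL has no type of all Banach spaces. The supremum ranges over all complex Banach spaces whose
  carrier is a subset of the type \<^typ>\<open>'b\<close>; as \<^typ>\<open>'b\<close> is arbitrary, a statement about this
  constant that is polymorphic in \<^typ>\<open>'b\<close> covers Banach spaces of every cardinality. If
  \<^typ>\<open>'b\<close> has fewer elements than the continuum, it carries no nonzero Banach space.
\<close>

definition projection_constant :: "'b itself \<Rightarrow> 'a normed_structure \<Rightarrow> ereal"
  where "projection_constant _ X =
    (SUP (Y, I) \<in> {(Y :: 'b normed_structure, I).
        complex_banach_space Y \<and> isometric_embedding X Y I}.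
      relative_projection_constant (I ` carrier X) Y)"

section \<open>Spherical harmonics\<close>

text \<open>Multi-indices are functions \<^typ>\<open>'n \<Rightarrow> nat\<close>.\<close>

definition homogeneous_polynomial :: "nat \<Rightarrow> (real ^ 'n \<Rightarrow> complex) \<Rightarrow> bool"
  where "homogeneous_polynomial d p \<longleftrightarrow>
    (\<exists>c :: ('n \<Rightarrow> nat) \<Rightarrow> complex. \<forall>x.
      p x = (\<Sum>m | (\<Sum>i\<in>UNIV. m i) = d. c m * (\<Prod>i\<in>UNIV. complex_of_real (x $ i) ^ m i)))"

lemma finite_multi_indices: "finite {m :: 'n::finite \<Rightarrow> nat. (\<Sum>i\<in>UNIV. m i) = d}"
proof (rule finite_subset)
  show "{m :: 'n \<Rightarrow> nat. (\<Sum>i\<in>UNIV. m i) = d} \<subseteq> Pi\<^sub>E UNIV (\<lambda>_. {..d})"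
    by (auto simp: PiE_def intro!: member_le_sum)
qed (auto intro: finite_PiE)

definition partial_derivative :: "'n \<Rightarrow> (real ^ 'n \<Rightarrow> complex) \<Rightarrow> real ^ 'n \<Rightarrow> complex"
  where "partial_derivative i f x = vector_derivative (\<lambda>t. f (x + t *\<^sub>R axis i 1)) (at 0)"

definition laplacian :: "(real ^ 'n \<Rightarrow> complex) \<Rightarrow> real ^ 'n \<Rightarrow> complex"
  where "laplacian f x = (\<Sum>i\<in>UNIV. partial_derivative i (partial_derivative i f) x)"

definition spherical_harmonics :: "nat \<Rightarrow> (real ^ 'n \<Rightarrow> complex) normed_structure"
  where "spherical_harmonics d =
    \<lparr>carrier = {restrict p (sphere 0 1) | p.
        homogeneous_polynomial d p \<and> (\<forall>x. laplacian p x = 0)},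
     monoid.mult = undefined, one = undefined,
     zero = (\<lambda>x\<in>sphere 0 1. 0), add = (\<lambda>f g. \<lambda>x\<in>sphere 0 1. f x + g x),
     smult = (\<lambda>c f. \<lambda>x\<in>sphere 0 1. c * f x),
     vnorm = (\<lambda>f. SUP x\<in>sphere 0 1. cmod (f x))\<rparr>"

section \<open>Surface measure on the unit sphere\<close>

text \<open>
  Polar coordinates: the normalized surface measure of \<open>A\<close> is the proportion of the unit ball
  filled by the cone over \<open>A\<close>. It is a Borel measure on the whole space, concentrated on the
  sphere; \<^term>\<open>sgn x\<close> is \<open>x / |x|\<close>.
\<close>

definition sphere_measure :: "(real ^ 'n) measure"
  where "sphere_measure = distr (uniform_measure lborel (ball 0 1)) borel sgn"

lemma sets_sphere_measure [simp]: "sets sphere_measure = sets borel"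
  by (simp add: sphere_measure_def)

lemma borel_measurable_sgn_vec [measurable]: "(sgn :: real ^ 'n \<Rightarrow> _) \<in> borel_measurable borel"
  unfolding sgn_div_norm by measurable

lemma prob_space_sphere_measure: "prob_space (sphere_measure :: (real ^ 'n) measure)"
  unfolding sphere_measure_def
proof (rule prob_space.prob_space_distr)
  have "emeasure lborel (ball 0 1 :: (real ^ 'n) set) \<noteq> 0"
    using content_ball_pos[of 1 "0 :: real ^ 'n"] by (auto simp: measure_def)
  moreover have "emeasure lborel (ball 0 1 :: (real ^ 'n) set) \<noteq> \<infinity>"
    using emeasure_lborel_ball_finite[of "0::real^'n" 1] by simp
  ultimately show "prob_space (uniform_measure lborel (ball 0 1 :: (real ^ 'n) set))"
    by (rule prob_space_uniform_measure)
qed simp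

lemma emeasure_sphere_measure_sphere: "emeasure sphere_measure (sphere 0 1 :: (real ^ 'n) set) = 1"
proof -
  interpret prob_space "sphere_measure :: (real ^ 'n) measure" by (rule prob_space_sphere_measure)
  have "emeasure sphere_measure (- sphere 0 1 :: (real ^ 'n) set) = emeasure (uniform_measure lborel (ball 0 1)) {0 :: real ^ 'n}"
    unfolding sphere_measure_def
    by (subst emeasure_distr) (auto simp: norm_sgn vimage_def intro!: arg_cong[where f = "emeasure _"])
  also have "\<dots> = 0" 
    using emeasure_mono[of "ball 0 1 \<inter> {0}" "{0::real^'n}" lborel] by (simp add: Int_commute)
  finally show ?thesis
    using emeasure_compl[of "- sphere 0 1" "sphere_measure :: (real ^ 'n) measure"] emeasure_space_1
    by (simp add: sphere_measure_def Compl_eq_Diff_UNIV Diff_Diff_Int)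
qed

lemma distr_sphere_measure_orthogonal:
  fixes f :: "real ^ 'n::{finite,wellorder} \<Rightarrow> real ^ 'n::{finite,wellorder}"
  assumes f: "orthogonal_transformation f"
  shows "distr sphere_measure borel f = sphere_measure"
proof -
  have lin: "linear f" and nf: "norm (f x) = norm x" for x
    using f by (auto simp: orthogonal_transformation)
  have [measurable]: "f \<in> borel_measurable borel"
    using lin by (simp add: linear_continuous_on linear_conv_bounded_linear borel_measurable_continuous_onI)
  define T where "T = inv_into UNIV f"
  have T: "orthogonal_transformation T" unfolding T_def using f by (rule orthogonal_transformation_inv)
  have bij: "bij f" using f by (rule orthogonal_transformation_bij)
  have leb: "distr lborel borel f = lborel"
  proof (rule lborel_eqI[symmetric])
    fix l u :: "real ^ 'n::{finite,wellorder}" assume lu: "\<And>b. b \<in> Basis \<Longrightarrow> l \<bullet> b \<le> u \<bullet> b"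
    have "f -` box l u = T ` box l u" unfolding T_def using bij by (simp add: bij_vimage_eq_inv_image)
    moreover have "T ` box l u \<in> lmeasurable"
      by (rule measurable_orthogonal_image[OF T]) simp
    then have "emeasure lebesgue (T ` box l u) = ennreal (measure lebesgue (T ` box l u))"
      by (rule emeasure_eq_measure2)
    moreover have "f -` box l u \<in> sets borel" using measurable_sets[of f borel borel "box l u"] by simp
    ultimately have "emeasure lborel (f -` box l u) = ennreal (measure lebesgue (T ` box l u))"
      by simp
    then show "emeasure (distr lborel borel f) (box l u) = ennreal (\<Prod>b\<in>Basis. (u - l) \<bullet> b)"
      using lu by (simp add: emeasure_distr measure_orthogonal_image[OF T])
  qed simp
  have "distr sphere_measure borel f = distr (uniform_measure lborel (ball 0 1)) borel (f \<circ> sgn)"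
    unfolding sphere_measure_def by (subst distr_distr) simp_all
  also have "f \<circ> sgn = sgn \<circ> f"
    using lin nf by (auto simp: fun_eq_iff sgn_div_norm linear_scale)
  also have "distr (uniform_measure lborel (ball 0 1)) borel (sgn \<circ> f)
    = distr (distr (uniform_measure lborel (ball 0 1)) borel f) borel sgn"
    by (subst distr_distr) simp_all
  also have "distr (uniform_measure lborel (ball 0 1)) borel f = uniform_measure lborel (ball 0 1)"
  proof (rule measure_eqI)
    fix A assume "A \<in> sets (distr (uniform_measure lborel (ball 0 1)) borel f)"
    then have A[measurable]: "A \<in> sets borel" by simp
    have m: "f -` A \<in> sets borel" using measurable_sets[of f borel borel A] by simp
    have "emeasure lborel (ball 0 1 \<inter> f -` A) = emeasure (distr lborel borel f) (ball 0 1 \<inter> A)"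
      using nf by (subst emeasure_distr) (auto intro!: arg_cong[where f = "emeasure _"])
    then show "emeasure (distr (uniform_measure lborel (ball 0 1)) borel f) A
        = emeasure (uniform_measure lborel (ball 0 1)) A"
      using m by (subst emeasure_distr) (auto simp: leb)
  qed simp
  finally show ?thesis unfolding sphere_measure_def .
qed

section \<open>Jacobi and Gegenbauer polynomials\<close>

definition rodrigues :: "real \<Rightarrow> real \<Rightarrow> nat \<Rightarrow> real \<Rightarrow> real"
  where "rodrigues \<alpha> \<beta> d t = (-1) ^ d / (2 ^ d * fact d) * (1 - t) powr (- \<alpha>) * (1 + t) powr (- \<beta>) *
    (deriv ^^ d) (\<lambda>u. (1 - u) powr (\<alpha> + real d) * (1 + u) powr (\<beta> + real d)) t"

text \<open>The Rodrigues expression is meaningful on the open interval only, where it determines the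
  polynomial.\<close>

definition jacobi_poly :: "real \<Rightarrow> real \<Rightarrow> nat \<Rightarrow> real poly"
  where "jacobi_poly \<alpha> \<beta> d = (THE p. \<forall>t\<in>{-1<..<1}. poly p t = rodrigues \<alpha> \<beta> d t)"

lemma rodrigues_aux:
  fixes a b :: real
  shows "\<exists>q::real poly. \<forall>t\<in>{-1<..<1}. (deriv ^^ k) (\<lambda>u. (1 - u) powr a * (1 + u) powr b) t
    = (1 - t) powr (a - real k) * (1 + t) powr (b - real k) * poly q t"
proof (induction k)
  case 0
  show ?case by (intro exI[of _ 1]) simp
next
  case (Suc k)
  then obtain q :: "real poly" where q: "\<And>t. t \<in> {-1<..<1} \<Longrightarrow>
      (deriv ^^ k) (\<lambda>u. (1 - u) powr a * (1 + u) powr b) t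
    = (1 - t) powr (a - real k) * (1 + t) powr (b - real k) * poly q t" by blast
  define r where "r = Polynomial.smult (- (a - real k)) ([:1, 1:] * q) + Polynomial.smult (b - real k) ([:1, -1:] * q)
    + [:1, 0, -1:] * pderiv q"
  show ?case
  proof (intro exI[of _ r] ballI)
    fix t :: real assume t: "t \<in> {-1<..<1}"
    have p1: "(1 - t) powr (a - real k) = (1 - t) powr (a - real (Suc k)) * (1 - t)"
      using t powr_add[of "1 - t" "a - real (Suc k)" 1] by simp
    have p2: "(1 + t) powr (b - real k) = (1 + t) powr (b - real (Suc k)) * (1 + t)"
      using t powr_add[of "1 + t" "b - real (Suc k)" 1] by simp
    define A B where "A = (1 - t) powr (a - real (Suc k))" and "B = (1 + t) powr (b - real (Suc k))"
    have dminus: "((\<lambda>t. 1 - t) has_field_derivative - 1) (at t)"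
      and dplus: "((\<lambda>t. 1 + t) has_field_derivative 1) (at t)"
      by (auto intro!: derivative_eq_intros)
    have A: "((\<lambda>t. (1 - t) powr (a - real k)) has_field_derivative - ((a - real k) * A)) (at t)"
      using DERIV_fun_powr[OF dminus, of "a - real k"] t
      by (simp add: A_def algebra_simps)
    have B: "((\<lambda>t. (1 + t) powr (b - real k)) has_field_derivative (b - real k) * B) (at t)"
      using DERIV_fun_powr[OF dplus, of "b - real k"] t
      by (simp add: B_def algebra_simps)
    have "((\<lambda>t. (1 - t) powr (a - real k) * (1 + t) powr (b - real k) * poly q t) has_field_derivative
        (- ((a - real k) * A) * (B * (1 + t)) + (b - real k) * B * (A * (1 - t))) * poly q t
        + poly (pderiv q) t * ((A * (1 - t)) * (B * (1 + t)))) (at t)"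
      using DERIV_mult[OF DERIV_mult[OF A B] poly_DERIV] unfolding p1 p2 A_def B_def .
    also have "(- ((a - real k) * A) * (B * (1 + t)) + (b - real k) * B * (A * (1 - t))) * poly q t
        + poly (pderiv q) t * ((A * (1 - t)) * (B * (1 + t))) = A * B * poly r t"
    proof -
      have "(- (x * A) * (B * (1 + t)) + y * B * (A * (1 - t))) * u + v * ((A * (1 - t)) * (B * (1 + t)))
          = A * B * (- x * ((1 + t) * u) + y * ((1 - t) * u) + (1 - t * t) * v)" for x y u v
        by (simp add: algebra_simps)
      moreover have "poly r t = - (a - real k) * ((1 + t) * poly q t) + (b - real k) * ((1 - t) * poly q t)
          + (1 - t * t) * poly (pderiv q) t"
        unfolding r_def by (simp add: distrib_right left_diff_distrib mult.assoc)
      ultimately show ?thesis by (simp only:)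
    qed
    finally have "((\<lambda>t. (1 - t) powr (a - real k) * (1 + t) powr (b - real k) * poly q t) has_field_derivative
        (1 - t) powr (a - real (Suc k)) * (1 + t) powr (b - real (Suc k)) * poly r t) (at t)"
      unfolding A_def B_def .
    then have "((deriv ^^ k) (\<lambda>u. (1 - u) powr a * (1 + u) powr b) has_field_derivative
        (1 - t) powr (a - real (Suc k)) * (1 + t) powr (b - real (Suc k)) * poly r t) (at t)"
      by (rule has_field_derivative_transform_within_open[where S="{-1<..<1}"]) (use t q in auto)
    then show "(deriv ^^ Suc k) (\<lambda>u. (1 - u) powr a * (1 + u) powr b) t
      = (1 - t) powr (a - real (Suc k)) * (1 + t) powr (b - real (Suc k)) * poly r t"
      by (simp add: DERIV_imp_deriv)
  qed
qed

lemma poly_jacobi_poly: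
  assumes "t \<in> {-1<..<1}"
  shows "poly (jacobi_poly \<alpha> \<beta> d) t = rodrigues \<alpha> \<beta> d t"
proof -
  obtain q :: "real poly" where q: "\<And>t. t \<in> {-1<..<1} \<Longrightarrow>
      (deriv ^^ d) (\<lambda>u. (1 - u) powr (\<alpha> + real d) * (1 + u) powr (\<beta> + real d)) t
    = (1 - t) powr \<alpha> * (1 + t) powr \<beta> * poly q t"
    using rodrigues_aux[of d "\<alpha> + real d" "\<beta> + real d"] by auto
  define p where "p = Polynomial.smult ((-1) ^ d / (2 ^ d * fact d)) q"
  have p: "\<forall>t\<in>{-1<..<1}. poly p t = rodrigues \<alpha> \<beta> d t"
  proof
    fix t :: real assume t: "t \<in> {-1<..<1}"
    then have "(1 - t) powr (- \<alpha>) * (1 - t) powr \<alpha> = 1" "(1 + t) powr (- \<beta>) * (1 + t) powr \<beta> = 1"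
      by (auto simp flip: powr_add)
    then have "(1 - t) powr (- \<alpha>) * (1 + t) powr (- \<beta>) * ((1 - t) powr \<alpha> * (1 + t) powr \<beta>) = 1"
      by (metis mult.assoc mult.commute mult.right_neutral)
    then show "poly p t = rodrigues \<alpha> \<beta> d t"
      using t by (simp add: p_def rodrigues_def q mult.assoc)
  qed
  have "p' = p" if p': "\<forall>t\<in>{-1<..<1}. poly p' t = rodrigues \<alpha> \<beta> d t" for p'
  proof -
    have "{-1<..<1} \<subseteq> {t. poly (p' - p) t = 0}" using p p' by auto
    moreover have "infinite {-1<..<1::real}" by (rule infinite_Ioo) simp
    ultimately have "infinite {t. poly (p' - p) t = 0}" by (rule infinite_super)
    then have "p' - p = 0" by (metis poly_roots_finite)
    then show "p' = p" by simp
  qed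
  with p have "\<exists>!p. \<forall>t\<in>{-1<..<1}. poly p t = rodrigues \<alpha> \<beta> d t" by blast
  from theI'[OF this] assms show ?thesis unfolding jacobi_poly_def by blast
qed

definition gegenbauer_poly :: "real \<Rightarrow> nat \<Rightarrow> real poly"
  where "gegenbauer_poly \<nu> d =
    Polynomial.smult (Gamma (2 * \<nu> + real d) * Gamma (\<nu> + 1/2) / (Gamma (2 * \<nu>) * Gamma (\<nu> + 1/2 + real d)))
      (jacobi_poly (\<nu> - 1/2) (\<nu> - 1/2) d)"

end

(* A projection onto the spherical harmonics H of degree d is compared with the reproducing kernel
   Z(x, y) of H, a multiple of a Gegenbauer polynomial of x . y, and c is the integral of |Z(x, .)|.

   Upper bound: for an isometric embedding I of H into Y, the functional that sends F : S -> I(H) to the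
   integral of (I^{-1} F(x))(x) is bounded by the integral of |F(x)|. Extend it by Hahn-Banach to
   functions with values in Y and evaluate it on Z(z, .) y; as a function of z this is an element of H,
   and y |-> I(...) is a projection of norm at most c.

   Lower bound: let Q be a projection of C(S) onto H and G a polynomial with |G| <= 1 on [-1, 1]. By the
   reproducing property and the Funk-Hecke formula, the average over y of (Q G(<., y>))(y) is the
   integral of G(<x, .>) Z(x, .), whatever Q is. Letting G approximate the sign of Z gives norm at least c.

   The Funk-Hecke formula follows from k (k + n - 2) int q = int Laplacian(q) for homogeneous q of degree
   k, which in turn follows from the rotation invariance of the surface measure. *)

theory Submission
  imports Defs
begin

section \<open>Polynomial functions\<close>

text \<open>The lower bound is a trace argument. If \<open>K z y\<close> is \<open>Q\<close> applied
  to G(x . y) as a function of x and evaluated at z, then the integral of \<open>K y y\<close> is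
  the trace of \<open>Q\<close> composed with convolution by G. This composition has its range in H,
  and convolution by G acts on H as a scalar, so the trace is that scalar times dim H = Z(w, w).

  Kernels are kept as finite sums of products a(x) b(y) of polynomials. A linear map acting in one
  variable then commutes with integrals and with the Laplacian in the other by linearity alone, so
  that neither vector-valued integrals nor Fubini's theorem enters.

  The normalisation of Z is captured by its leading coefficient, which is the reciprocal of the
  Funk-Hecke coefficient of the top power; all lower powers are orthogonal to H.

  The supremum in the projection constant ranges over Banach spaces carried by one type
  \<open>'b\<close>. The space C(S) that attains it has to be copied into \<open>'b\<close>, which
  is what the injection of the reals into \<open>'b\<close> is for.\<close>

inductive mpoly :: "(real ^ 'n \<Rightarrow> complex) \<Rightarrow> bool" where
  mpoly_const: "mpoly (\<lambda>x. c)"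
| mpoly_coord: "mpoly (\<lambda>x. of_real (x $ i))"
| mpoly_add: "mpoly p \<Longrightarrow> mpoly q \<Longrightarrow> mpoly (\<lambda>x. p x + q x)"
| mpoly_mult: "mpoly p \<Longrightarrow> mpoly q \<Longrightarrow> mpoly (\<lambda>x. p x * q x)"

lemma sum_axis_scaleR: "(\<Sum>j\<in>UNIV. axis i (1::real) $ j *\<^sub>R f j) = (f i :: 'a :: real_vector)"
  by (simp add: axis_def if_distrib[of "\<lambda>z. z *\<^sub>R _"] cong: if_cong)

text \<open>\<open>partial_derivative\<close> picks some vector derivative, so its value is known
  only where the function is differentiable; a total derivative pins it down.\<close>

lemma has_derivative_partial_derivative:
  assumes "(p has_derivative D) (at x)"
  shows "partial_derivative i p x = D (axis i 1)"
proof -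
  have "((\<lambda>t. x + t *\<^sub>R axis i (1::real)) has_derivative (\<lambda>t. t *\<^sub>R axis i 1)) (at 0)"
    by (auto intro!: derivative_eq_intros)
  moreover have "(p has_derivative D) (at (x + 0 *\<^sub>R axis i (1::real)))"
    using assms by simp
  ultimately have "((\<lambda>t. p (x + t *\<^sub>R axis i 1)) has_derivative (\<lambda>t. D (t *\<^sub>R axis i 1))) (at 0)"
    by (rule has_derivative_compose)
  moreover have "D (t *\<^sub>R axis i 1) = t *\<^sub>R D (axis i 1)" for t
    using assms by (simp add: has_derivative_linear linear_scale)
  ultimately have "((\<lambda>t. p (x + t *\<^sub>R axis i 1)) has_vector_derivative D (axis i 1)) (at 0)"
    by (simp add: has_vector_derivative_def)
  then show ?thesis unfolding partial_derivative_def by (rule vector_derivative_at)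
qed

text \<open>The gradient consists of unspecified polynomials \<open>q i\<close>: the induction runs
  on total derivatives, and only afterwards can \<open>q i\<close> be identified with
  \<open>partial_derivative i p\<close>.\<close>

lemma mpoly_gradient:
  fixes p :: "real ^ 'n \<Rightarrow> complex"
  assumes "mpoly p"
  shows "\<exists>q. (\<forall>i. mpoly (q i)) \<and> (\<forall>x. (p has_derivative (\<lambda>v. \<Sum>i\<in>UNIV. v $ i *\<^sub>R q i x)) (at x))"
  using assms
proof induction
  case (mpoly_const c)
  show ?case by (rule exI[of _ "\<lambda>_ _. 0"]) (auto intro: mpoly.intros)
next
  case (mpoly_coord j)
  have "((\<lambda>x::real^'n. complex_of_real (x $ j)) has_derivative (\<lambda>v. of_real (v $ j))) (at x)" for x
    by (intro has_derivative_of_real bounded_linear_imp_has_derivative bounded_linear_vec_nth)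
  moreover have "(\<Sum>i\<in>UNIV. v $ i *\<^sub>R (if i = j then 1 else 0)) = complex_of_real (v $ j)" for v :: "real ^ 'n"
    by (simp add: if_distrib[of "\<lambda>z. _ *\<^sub>R z"] cong: if_cong) (simp add: scaleR_conv_of_real)
  ultimately show ?case
    by (intro exI[of _ "\<lambda>i x. if i = j then 1 else 0"]) (auto intro: mpoly.intros)
next
  case (mpoly_add p q)
  then obtain p' q' where "\<And>i. mpoly (p' i)" "\<And>i. mpoly (q' i)" 
    "\<And>x. (p has_derivative (\<lambda>v. \<Sum>i\<in>UNIV. v $ i *\<^sub>R p' i x)) (at x)"
    "\<And>x. (q has_derivative (\<lambda>v. \<Sum>i\<in>UNIV. v $ i *\<^sub>R q' i x)) (at x)" by blast
  then show ?case
    by (intro exI[of _ "\<lambda>i x. p' i x + q' i x"])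
      (auto intro!: mpoly.intros derivative_eq_intros simp: scaleR_add_right sum.distrib)
next
  case (mpoly_mult p q)
  then obtain p' q' where *: "\<And>i. mpoly (p' i)" "\<And>i. mpoly (q' i)" 
    "\<And>x. (p has_derivative (\<lambda>v. \<Sum>i\<in>UNIV. v $ i *\<^sub>R p' i x)) (at x)"
    "\<And>x. (q has_derivative (\<lambda>v. \<Sum>i\<in>UNIV. v $ i *\<^sub>R q' i x)) (at x)" by blast
  have "((\<lambda>x. p x * q x) has_derivative (\<lambda>v. \<Sum>i\<in>UNIV. v $ i *\<^sub>R (p x * q' i x + p' i x * q x))) (at x)" for x
    by (rule has_derivative_eq_rhs[OF has_derivative_mult[OF *(3,4)]])
      (simp add: fun_eq_iff scaleR_add_right sum.distrib sum_distrib_left sum_distrib_right)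
  with * mpoly_mult.hyps show ?case
    by (intro exI[of _ "\<lambda>i x. p x * q' i x + p' i x * q x"]) (auto intro!: mpoly.intros)
qed

lemma mpoly_has_derivative:
  assumes "mpoly p"
  shows "(p has_derivative (\<lambda>v. \<Sum>i\<in>UNIV. v $ i *\<^sub>R partial_derivative i p x)) (at x)"
proof -
  obtain q where q: "\<And>x. (p has_derivative (\<lambda>v. \<Sum>i\<in>UNIV. v $ i *\<^sub>R q i x)) (at x)"
    using mpoly_gradient[OF assms] by blast
  have "partial_derivative i p x = q i x" for i
    unfolding has_derivative_partial_derivative[OF q]
    by (rule sum_axis_scaleR)
  with q show ?thesis by simp
qed

lemma mpoly_partial_derivative [intro!]:
  assumes "mpoly p"
  shows "mpoly (partial_derivative i p)"
proof -
  obtain q where q: "\<And>i. mpoly (q i)" "\<And>x. (p has_derivative (\<lambda>v. \<Sum>i\<in>UNIV. v $ i *\<^sub>R q i x)) (at x)"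
    using mpoly_gradient[OF assms] by blast
  have "partial_derivative i p x = q i x" for x
    unfolding has_derivative_partial_derivative[OF q(2)]
    by (rule sum_axis_scaleR)
  then have "partial_derivative i p = q i" by blast
  with q show ?thesis by simp
qed

declare mpoly.intros [intro!]

lemma mpoly_cmult [intro!]: "mpoly p \<Longrightarrow> mpoly (\<lambda>x. c * p x)"
  by auto

lemma mpoly_uminus [intro!]: "mpoly p \<Longrightarrow> mpoly (\<lambda>x. - p x)"
  using mpoly_mult[OF mpoly_const[of "-1"]] by simp

lemma mpoly_diff [intro!]: "mpoly p \<Longrightarrow> mpoly q \<Longrightarrow> mpoly (\<lambda>x. p x - q x)"
  using mpoly_add[OF _ mpoly_uminus] by simp

lemma mpoly_sum [intro!]: "(\<And>k. k \<in> A \<Longrightarrow> mpoly (p k)) \<Longrightarrow> mpoly (\<lambda>x. \<Sum>k\<in>A. p k x)"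
  by (induction A rule: infinite_finite_induct) auto

lemma mpoly_prod [intro!]: "(\<And>k. k \<in> A \<Longrightarrow> mpoly (p k)) \<Longrightarrow> mpoly (\<lambda>x. \<Prod>k\<in>A. p k x)"
  by (induction A rule: infinite_finite_induct) auto

lemma mpoly_power [intro!]: "mpoly p \<Longrightarrow> mpoly (\<lambda>x. p x ^ k)"
  by (induction k) auto

lemma mpoly_inner [intro!]: "mpoly (\<lambda>x. of_real (x \<bullet> y))"
  by (auto simp: inner_vec_def)

lemma mpoly_inner' [intro!]: "mpoly (\<lambda>y. of_real (x \<bullet> y))"
  by (auto simp: inner_vec_def)

lemma mpoly_inner_self [intro!]: "mpoly (\<lambda>x. of_real (x \<bullet> x))"
  by (auto simp: inner_vec_def)

lemma mpoly_continuous_on: "mpoly p \<Longrightarrow> continuous_on S p"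
  by (induction rule: mpoly.induct) (auto intro!: continuous_intros)

section \<open>Rules for partial derivatives and the Laplacian\<close>

lemma partial_derivative_const [simp]: "partial_derivative i (\<lambda>x. c) = (\<lambda>x. 0)"
  by (rule ext, subst has_derivative_partial_derivative) (rule has_derivative_const, simp)

lemma partial_derivative_coord [simp]:
  "partial_derivative i (\<lambda>x. of_real (x $ j)) = (\<lambda>x. if i = j then 1 else 0)"
proof
  fix x
  have "((\<lambda>x::real^'a. complex_of_real (x $ j)) has_derivative (\<lambda>v. of_real (v $ j))) (at x)" for x
    by (intro has_derivative_of_real bounded_linear_imp_has_derivative bounded_linear_vec_nth)
  from has_derivative_partial_derivative[OF this, of i x]
  show "partial_derivative i (\<lambda>x. of_real (x $ j)) x = (if i = j then 1 else 0)"
    by (simp add: axis_def)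
qed

lemma partial_derivative_add:
  "mpoly p \<Longrightarrow> mpoly q \<Longrightarrow>
    partial_derivative i (\<lambda>x. p x + q x) = (\<lambda>x. partial_derivative i p x + partial_derivative i q x)"
  by (simp add: fun_eq_iff sum_axis_scaleR
      has_derivative_partial_derivative[OF has_derivative_add[OF mpoly_has_derivative mpoly_has_derivative]])

lemma partial_derivative_mult:
  "mpoly p \<Longrightarrow> mpoly q \<Longrightarrow>
    partial_derivative i (\<lambda>x. p x * q x) = (\<lambda>x. partial_derivative i p x * q x + p x * partial_derivative i q x)"
  by (simp add: fun_eq_iff sum_axis_scaleR
      has_derivative_partial_derivative[OF has_derivative_mult[OF mpoly_has_derivative mpoly_has_derivative]])

lemma partial_derivative_cmult:
  "mpoly p \<Longrightarrow> partial_derivative i (\<lambda>x. c * p x) = (\<lambda>x. c * partial_derivative i p x)"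
  by (subst partial_derivative_mult) auto

lemma partial_derivative_sum:
  "finite A \<Longrightarrow> (\<And>k. k \<in> A \<Longrightarrow> mpoly (p k)) \<Longrightarrow>
    partial_derivative i (\<lambda>x. \<Sum>k\<in>A. p k x) = (\<lambda>x. \<Sum>k\<in>A. partial_derivative i (p k) x)"
  by (induction A rule: finite_induct) (auto simp: partial_derivative_add mpoly_sum)

lemma partial_derivative_inner:
  "partial_derivative i (\<lambda>y. of_real (x \<bullet> y)) = (\<lambda>y. of_real (x $ i))"
proof -
  have "mpoly (\<lambda>y. of_real (x $ k) * of_real (y $ k))" for k by auto
  then show ?thesis
    by (simp add: inner_vec_def partial_derivative_sum partial_derivative_cmult
      if_distrib[of "\<lambda>z. _ * z"] mpoly_coord cong: if_cong)
qed

text \<open>By induction on the polynomial: both orders agree on the generators, and the sum and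
  product rules preserve this.\<close>

lemma partial_derivative_commute:
  "mpoly p \<Longrightarrow> partial_derivative i (partial_derivative j p) = partial_derivative j (partial_derivative i p)"
proof (induction rule: mpoly.induct)
  case (mpoly_mult p q)
  then show ?case
    by (simp add: partial_derivative_mult partial_derivative_add mpoly_partial_derivative mpoly.intros fun_eq_iff)
qed (simp_all only: partial_derivative_const partial_derivative_coord partial_derivative_add mpoly_partial_derivative)

lemma laplacian_add:
  "mpoly p \<Longrightarrow> mpoly q \<Longrightarrow> laplacian (\<lambda>x. p x + q x) x = laplacian p x + laplacian q x"
  by (simp add: laplacian_def partial_derivative_add mpoly_partial_derivative sum.distrib)

lemma laplacian_cmult: "mpoly p \<Longrightarrow> laplacian (\<lambda>x. c * p x) x = c * laplacian p x"
  by (simp add: laplacian_def partial_derivative_cmult mpoly_partial_derivative sum_distrib_left)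

lemma laplacian_sum:
  "finite A \<Longrightarrow> (\<And>k. k \<in> A \<Longrightarrow> mpoly (p k)) \<Longrightarrow>
    laplacian (\<lambda>x. \<Sum>k\<in>A. p k x) x = (\<Sum>k\<in>A. laplacian (p k) x)"
proof (induction A rule: finite_induct)
  case empty
  then show ?case by (simp add: laplacian_def)
qed (auto simp: laplacian_add mpoly_sum)

lemma laplacian_mult:
  assumes "mpoly p" "mpoly q"
  shows "laplacian (\<lambda>x. p x * q x) x =
    laplacian p x * q x + p x * laplacian q x
    + 2 * (\<Sum>i\<in>UNIV. partial_derivative i p x * partial_derivative i q x)"
  using assms
  by (simp add: laplacian_def partial_derivative_mult partial_derivative_add mpoly_partial_derivative mpoly_mult
      sum.distrib sum_distrib_left sum_distrib_right algebra_simps)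

lemma mpoly_laplacian [intro!]: "mpoly p \<Longrightarrow> mpoly (laplacian p)"
  unfolding laplacian_def by auto

text \<open>Direction \<open>x\<close> and base point \<open>y\<close> are kept apart: for fixed
  \<open>x\<close> this is an operator with constant coefficients in \<open>y\<close>, and for
  \<open>x = y\<close> it is the Euler operator.\<close>

definition directional :: "real ^ 'n \<Rightarrow> (real ^ 'n \<Rightarrow> complex) \<Rightarrow> real ^ 'n \<Rightarrow> complex" where
  "directional x p y = (\<Sum>i\<in>UNIV. of_real (x $ i) * partial_derivative i p y)"

lemma mpoly_directional [intro!]: "mpoly p \<Longrightarrow> mpoly (directional x p)"
  unfolding directional_def by auto

text \<open>Operators with constant coefficients commute. Hence directional derivatives of harmonic
  polynomials are harmonic, which drives the induction for Funk-Hecke.\<close>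

lemma laplacian_directional:
  assumes "mpoly p"
  shows "laplacian (directional x p) = directional x (laplacian p)"
proof
  fix y
  have c: "partial_derivative i (directional x f) = directional x (partial_derivative i f)" if "mpoly f" for f :: "real ^ 'a \<Rightarrow> complex" and i
    using that unfolding directional_def
    by (simp add: partial_derivative_sum partial_derivative_cmult mpoly_partial_derivative mpoly.intros
        partial_derivative_commute[OF that, of i])
  have d: "directional x (\<lambda>y. \<Sum>k\<in>UNIV. f k y) y = (\<Sum>k\<in>(UNIV::'a set). directional x (f k) y)"
    if "\<And>k. mpoly (f k)" for f :: "'a \<Rightarrow> real ^ 'a \<Rightarrow> complex"
    using that unfolding directional_def
    by (simp add: partial_derivative_sum sum_distrib_left) (rule sum.swap)
  show "laplacian (directional x p) y = directional x (laplacian p) y"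
    using assms by (simp add: laplacian_def[abs_def] d c mpoly_partial_derivative)
qed

lemma partial_derivative_inner_power:
  "partial_derivative i (\<lambda>y. of_real (x \<bullet> y) ^ k) = (\<lambda>y. of_real (x $ i) * (of_nat k * of_real (x \<bullet> y) ^ (k - 1)))"
proof (induction k)
  case (Suc k)
  have "partial_derivative i (\<lambda>y. of_real (x \<bullet> y) * of_real (x \<bullet> y) ^ k)
      = (\<lambda>y. partial_derivative i (\<lambda>y. of_real (x \<bullet> y)) y * of_real (x \<bullet> y) ^ k
         + of_real (x \<bullet> y) * partial_derivative i (\<lambda>y. of_real (x \<bullet> y) ^ k) y)"
    by (rule partial_derivative_mult) auto
  also have "\<dots> = (\<lambda>y. of_real (x $ i) * (of_nat (Suc k) * of_real (x \<bullet> y) ^ (Suc k - 1)))"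
    unfolding Suc.IH partial_derivative_inner by (cases k) (simp_all add: fun_eq_iff algebra_simps)
  finally show ?case by simp
qed simp

lemma sum_of_real_square: "(\<Sum>i\<in>UNIV. complex_of_real (x $ i) * of_real (x $ i)) = of_real (x \<bullet> x)"
  by (simp add: inner_vec_def)

lemma laplacian_inner_power:
  "laplacian (\<lambda>y. of_real (x \<bullet> y) ^ k) y
    = of_nat (k * (k - 1)) * of_real (x \<bullet> x) * of_real (x \<bullet> y) ^ (k - 2)"
proof -
  have "laplacian (\<lambda>y. of_real (x \<bullet> y) ^ k) y =
     (\<Sum>i\<in>UNIV. (of_real (x $ i) * of_real (x $ i)) * (of_nat k * of_nat (k - 1) * of_real (x \<bullet> y) ^ (k - 2)))"
    unfolding laplacian_def partial_derivative_inner_power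
    by (intro sum.cong refl)
      (simp add: partial_derivative_cmult mpoly_cmult mpoly_inner' mpoly_power partial_derivative_inner_power
        numeral_2_eq_2)
  then show ?thesis
    unfolding sum_distrib_right[symmetric] sum_of_real_square by simp
qed

lemma laplacian_inner_power_mult:
  assumes "mpoly p"
  shows "laplacian (\<lambda>y. of_real (x \<bullet> y) ^ k * p y) y =
    of_nat (k * (k - 1)) * of_real (x \<bullet> x) * of_real (x \<bullet> y) ^ (k - 2) * p y
    + of_real (x \<bullet> y) ^ k * laplacian p y
    + 2 * of_nat k * of_real (x \<bullet> y) ^ (k - 1) * directional x p y"
  using assms
  by (simp add: laplacian_mult mpoly_inner' mpoly_power laplacian_inner_power
      partial_derivative_inner_power directional_def sum_distrib_left mult_ac)

text \<open>Only positive \<open>t\<close> are considered, so that a factor \<open>t\<close> can be cancelled when \<open>p\<close> is differentiated.\<close>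

definition scaling :: "nat \<Rightarrow> (real ^ 'n \<Rightarrow> complex) \<Rightarrow> bool" where
  "scaling d p \<longleftrightarrow> (\<forall>t>0. \<forall>x. p (t *\<^sub>R x) = of_real t ^ d * p x)"

text \<open>Both sides are the derivative of p(t x) at t = 1, once by the chain rule and once from
  the scaling law.\<close>

lemma euler_identity:
  assumes "mpoly p" "scaling d p"
  shows "directional x p x = of_nat d * p x"
proof -
  have "((\<lambda>t. p (t *\<^sub>R x)) has_vector_derivative directional x p x) (at 1)"
  proof -
    have "((\<lambda>t. t *\<^sub>R x) has_derivative (\<lambda>t. t *\<^sub>R x)) (at (1::real))"
      by (auto intro!: derivative_eq_intros)
    moreover have "(p has_derivative (\<lambda>v. \<Sum>i\<in>UNIV. v $ i *\<^sub>R partial_derivative i p x)) (at (1 *\<^sub>R x))"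
      using mpoly_has_derivative[OF assms(1)] by simp
    ultimately have "((\<lambda>t. p (t *\<^sub>R x)) has_derivative (\<lambda>t. \<Sum>i\<in>UNIV. (t *\<^sub>R x) $ i *\<^sub>R partial_derivative i p x)) (at 1)"
      by (rule has_derivative_compose)
    moreover have "(\<Sum>i\<in>UNIV. (t *\<^sub>R x) $ i *\<^sub>R partial_derivative i p x) = t *\<^sub>R directional x p x" for t
      by (simp add: directional_def sum_distrib_left scaleR_conv_of_real[where 'a = complex] mult.assoc)
    ultimately show ?thesis
      by (simp add: has_vector_derivative_def)
  qed
  moreover have "((\<lambda>t. p (t *\<^sub>R x)) has_vector_derivative of_nat d * p x) (at 1)"
  proof (rule has_vector_derivative_transform_within_open[where S = "{0<..}"])
    have "((\<lambda>t. t ^ d) has_real_derivative of_nat d) (at (1::real))"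
      by (auto intro!: derivative_eq_intros)
    from has_vector_derivative_scaleR[OF this has_vector_derivative_const[of "p x"]]
    have "((\<lambda>t. t ^ d *\<^sub>R p x) has_vector_derivative of_nat d * p x) (at (1::real))"
      by (simp add: scaleR_conv_of_real)
    then show "((\<lambda>t. of_real t ^ d * p x) has_vector_derivative of_nat d * p x) (at (1::real))"
      by (simp add: scaleR_conv_of_real)
  qed (use assms(2) in \<open>auto simp: scaling_def\<close>)
  ultimately show ?thesis by (rule vector_derivative_unique_at)
qed

lemma partial_derivative_scale:
  assumes "mpoly p"
  shows "partial_derivative i (\<lambda>x. p (t *\<^sub>R x)) x = of_real t * partial_derivative i p (t *\<^sub>R x)"
proof -
  have "((\<lambda>x. t *\<^sub>R x) has_derivative (\<lambda>x. t *\<^sub>R x)) (at x)"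
    by (auto intro!: derivative_eq_intros)
  then have "((\<lambda>x. p (t *\<^sub>R x)) has_derivative (\<lambda>v. \<Sum>i\<in>UNIV. (t *\<^sub>R v) $ i *\<^sub>R partial_derivative i p (t *\<^sub>R x))) (at x)"
    by (rule has_derivative_compose) (rule mpoly_has_derivative[OF assms])
  from has_derivative_partial_derivative[OF this, of i]
  have "partial_derivative i (\<lambda>x. p (t *\<^sub>R x)) x
      = (\<Sum>j\<in>UNIV. axis i 1 $ j *\<^sub>R (t *\<^sub>R partial_derivative j p (t *\<^sub>R x)))"
    by (simp add: mult.commute)
  then show ?thesis
    unfolding sum_axis_scaleR by (simp add: scaleR_conv_of_real)
qed

lemma scaling_partial_derivative:
  assumes "mpoly p" "scaling (Suc d) p"
  shows "scaling d (partial_derivative i p)"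
  unfolding scaling_def
proof (intro allI impI)
  fix t :: real and x :: "real ^ 'a" assume t: "t > 0"
  have eq: "(\<lambda>x. p (t *\<^sub>R x)) = (\<lambda>x. of_real t ^ Suc d * p x)"
    using assms t by (auto simp: scaling_def)
  have "of_real t * partial_derivative i p (t *\<^sub>R x) = of_real t ^ Suc d * partial_derivative i p x"
    using partial_derivative_scale[OF assms(1), of i t x] partial_derivative_cmult[OF assms(1), of i "of_real t ^ Suc d"]
    unfolding eq by (simp del: power_Suc)
  then show "partial_derivative i p (t *\<^sub>R x) = of_real t ^ d * partial_derivative i p x"
    using t by (simp add: mult.assoc)
qed

lemma scaling_directional:
  "mpoly p \<Longrightarrow> scaling (Suc d) p \<Longrightarrow> scaling d (directional x p)"
  using scaling_partial_derivative[of p d]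
  by (simp add: scaling_def directional_def sum_distrib_left mult_ac)

text \<open>Let t tend to 0 from the right in p(t x) = p(x) and use continuity at the
  origin.\<close>

lemma scaling_0_const:
  assumes "mpoly p" "scaling 0 p"
  shows "p x = p 0"
proof -
  have "isCont p 0"
    using mpoly_continuous_on[OF assms(1), of UNIV] by (simp add: continuous_on_eq_continuous_at)
  moreover have "((\<lambda>t::real. t *\<^sub>R x) \<longlongrightarrow> 0) (at_right 0)"
    by (auto intro!: tendsto_eq_intros)
  ultimately have "((\<lambda>t. p (t *\<^sub>R x)) \<longlongrightarrow> p 0) (at_right 0)"
    by (rule isCont_tendsto_compose)
  moreover have "\<forall>\<^sub>F t in at_right 0. p (t *\<^sub>R x) = p x"
    unfolding eventually_at_right_field using assms(2) by (auto simp: scaling_def intro!: exI[of _ "1::real"])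
  ultimately have "((\<lambda>t::real. p x) \<longlongrightarrow> p 0) (at_right 0)"
    by (rule Lim_transform_eventually)
  then show ?thesis by (simp add: tendsto_const_iff)
qed

lemma partial_derivative_scaling_0:
  assumes "mpoly p" "scaling 0 p"
  shows "partial_derivative i p x = 0"
proof -
  define c where "c = p 0"
  have "p = (\<lambda>x. c)" using scaling_0_const[OF assms] by (auto simp: c_def)
  then show ?thesis by simp
qed

lemma mpoly_homogeneous_polynomial: 
  fixes p :: "real ^ 'n \<Rightarrow> complex" assumes "homogeneous_polynomial d p" shows "mpoly p" "scaling d p"
proof -
  from assms obtain c where c: "\<And>x. p x = (\<Sum>m | (\<Sum>i\<in>UNIV. m i) = d. c m * (\<Prod>i\<in>UNIV. complex_of_real (x $ i) ^ m i))"
    unfolding homogeneous_polynomial_def by blast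
  then have "p = (\<lambda>x. \<Sum>m | (\<Sum>i\<in>UNIV. m i) = d. c m * (\<Prod>i\<in>UNIV. complex_of_real (x $ i) ^ m i))" by blast
  then show "mpoly p" by (auto intro!: mpoly_sum mpoly_mult mpoly_prod mpoly_power)
  have "(\<Prod>i\<in>UNIV. complex_of_real t ^ m i) = of_real t ^ (\<Sum>i\<in>UNIV. m i)" for t and m :: "'n \<Rightarrow> nat"
    by (simp add: power_sum)
  then show "scaling d p"
    by (simp add: scaling_def c power_mult_distrib prod.distrib sum_distrib_left mult.left_commute)
qed

section \<open>The Funk--Hecke formula\<close>

lemma AE_sphere_measure: "AE x in sphere_measure. x \<in> sphere 0 (1::real)"
proof -
  interpret prob_space "sphere_measure :: (real ^ 'a) measure" by (rule prob_space_sphere_measure)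
  have "prob (sphere 0 1) = 1"
    by (simp add: measure_def emeasure_sphere_measure_sphere)
  then show ?thesis by (rule AE_prob_1)
qed

lemma space_sphere_measure [simp]: "space sphere_measure = UNIV"
  by (simp add: sphere_measure_def)

lemma bounded_continuous_on_sphere:
  fixes f :: "real ^ 'n \<Rightarrow> 'b::real_normed_vector"
  assumes "continuous_on (sphere 0 1) f"
  obtains B where "\<And>x. x \<in> sphere 0 1 \<Longrightarrow> norm (f x) \<le> B"
proof -
  have "bounded (f ` sphere 0 1)"
    by (intro compact_imp_bounded compact_continuous_image assms compact_sphere)
  then show ?thesis using that unfolding bounded_iff by blast
qed

text \<open>The measure lives on the whole space, where a continuous function may be unbounded; it
  is bounded on the sphere, which has full measure.\<close>

lemma integrable_sphere_measure [intro]: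
  fixes f :: "real ^ 'n \<Rightarrow> 'b::{banach, second_countable_topology}"
  assumes "continuous_on UNIV f"
  shows "integrable sphere_measure f"
proof -
  interpret prob_space "sphere_measure :: (real ^ 'n) measure" by (rule prob_space_sphere_measure)
  obtain B where B: "\<And>x. x \<in> sphere 0 1 \<Longrightarrow> norm (f x) \<le> B"
    using bounded_continuous_on_sphere continuous_on_subset[OF assms] by (metis subset_UNIV)
  have "AE x in sphere_measure. norm (f x) \<le> B"
    using AE_sphere_measure by eventually_elim (rule B)
  moreover have "f \<in> borel_measurable sphere_measure"
    using borel_measurable_continuous_onI[OF assms] by (simp cong: measurable_cong_sets)
  ultimately show ?thesis by (rule integrable_const_bound)
qed

lemma integrable_sphere_mpoly [intro]: "mpoly p \<Longrightarrow> integrable sphere_measure p"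
  by (intro integrable_sphere_measure mpoly_continuous_on)

section \<open>Plane rotations and their generators\<close>

definition plane_rotation :: "'n \<Rightarrow> 'n \<Rightarrow> real \<Rightarrow> real ^ 'n \<Rightarrow> real ^ 'n" where
  "plane_rotation i j s x =
    x + ((cos s - 1) * x $ i - sin s * x $ j) *\<^sub>R axis i 1 + (sin s * x $ i + (cos s - 1) * x $ j) *\<^sub>R axis j 1"

lemma plane_rotation_0 [simp]: "plane_rotation i j 0 x = x"
  by (simp add: plane_rotation_def)

text \<open>The rotation is the identity plus a correction along two axes, so the change of the
  squared norm comes out as a multiple of sin^2 + cos^2 - 1.\<close>

lemma orthogonal_plane_rotation:
  assumes "i \<noteq> j"
  shows "orthogonal_transformation (plane_rotation i j s)"
  unfolding orthogonal_transformation
proof (intro conjI allI)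
  show "linear (plane_rotation i j s)"
    by (rule linearI) (simp_all add: plane_rotation_def algebra_simps scaleR_add_left)
next
  fix v :: "real ^ 'a"
  have "plane_rotation i j s v \<bullet> plane_rotation i j s v = v \<bullet> v"
  proof -
    define a b where "a = (cos s - 1) * v $ i - sin s * v $ j" and "b = sin s * v $ i + (cos s - 1) * v $ j"
    have "plane_rotation i j s v \<bullet> plane_rotation i j s v
        = v \<bullet> v + (2 * a * v $ i + 2 * b * v $ j + a\<^sup>2 + b\<^sup>2)"
      using assms unfolding plane_rotation_def a_def[symmetric] b_def[symmetric]
      by (simp add: inner_add_left inner_add_right inner_axis inner_axis' power2_eq_square algebra_simps)
        (simp add: axis_def algebra_simps)
    also have "2 * a * v $ i + 2 * b * v $ j + a\<^sup>2 + b\<^sup>2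
        = ((sin s)\<^sup>2 + (cos s)\<^sup>2 - 1) * ((v $ i)\<^sup>2 + (v $ j)\<^sup>2)"
    proof -
      have "2 * ((c - 1) * p - t * q) * p + 2 * (t * p + (c - 1) * q) * q + ((c - 1) * p - t * q)\<^sup>2
          + (t * p + (c - 1) * q)\<^sup>2 = (t\<^sup>2 + c\<^sup>2 - 1) * (p\<^sup>2 + q\<^sup>2)" for c t p q :: real
        by (simp add: power2_eq_square algebra_simps)
      then show ?thesis unfolding a_def b_def .
    qed
    finally show ?thesis using sin_cos_squared_add[of s] by simp
  qed
  then show "norm (plane_rotation i j s v) = norm v" by (simp add: norm_eq_sqrt_inner)
qed

text \<open>The infinitesimal generator of \<open>plane_rotation\<close>, known as an angular
  momentum operator.\<close>

definition rot_derivative :: "'n \<Rightarrow> 'n \<Rightarrow> (real ^ 'n \<Rightarrow> complex) \<Rightarrow> real ^ 'n \<Rightarrow> complex" where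
  "rot_derivative i j f x = of_real (x $ i) * partial_derivative j f x - of_real (x $ j) * partial_derivative i f x"

text \<open>Rotations form a one-parameter group, so the derivative along an orbit is the generator
  at the current point. Every \<open>s\<close> is covered, not only 0, because a mean value estimate
  will run along the orbit.\<close>

lemma plane_rotation_derivative:
  assumes "mpoly f" "i \<noteq> j"
  shows "((\<lambda>s. f (plane_rotation i j s x)) has_vector_derivative rot_derivative i j f (plane_rotation i j s x)) (at s)"
proof -
  let ?y = "plane_rotation i j s x"
  let ?v = "(?y $ i) *\<^sub>R axis j 1 - (?y $ j) *\<^sub>R axis i (1::real)"
  have "((\<lambda>s. plane_rotation i j s x) has_vector_derivative
      ((- sin s * x $ i - cos s * x $ j) *\<^sub>R axis i 1 + (cos s * x $ i - sin s * x $ j) *\<^sub>R axis j 1)) (at s)"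
    unfolding plane_rotation_def has_vector_derivative_def
    by (auto intro!: derivative_eq_intros simp: algebra_simps)
  also have "(- sin s * x $ i - cos s * x $ j) *\<^sub>R axis i 1 + (cos s * x $ i - sin s * x $ j) *\<^sub>R axis j 1 = ?v"
    using assms(2) by (simp add: plane_rotation_def axis_def[of _ 1] vec_eq_iff algebra_simps)
  finally have "((\<lambda>s. plane_rotation i j s x) has_derivative (\<lambda>t. t *\<^sub>R ?v)) (at s)"
    by (simp add: has_vector_derivative_def)
  from has_derivative_compose[OF this mpoly_has_derivative[OF assms(1)]]
  have "((\<lambda>s. f (plane_rotation i j s x)) has_derivative
      (\<lambda>t. \<Sum>k\<in>UNIV. (t *\<^sub>R ?v) $ k *\<^sub>R partial_derivative k f ?y)) (at s)" .
  moreover have "(\<Sum>k\<in>UNIV. (t *\<^sub>R ?v) $ k *\<^sub>R partial_derivative k f ?y) = t *\<^sub>R rot_derivative i j f ?y" for t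
  proof -
    have "(\<Sum>k\<in>UNIV. (t *\<^sub>R ?v) $ k *\<^sub>R partial_derivative k f ?y)
      = (\<Sum>k\<in>UNIV. axis j 1 $ k *\<^sub>R ((t * ?y $ i) *\<^sub>R partial_derivative k f ?y)
          - axis i 1 $ k *\<^sub>R ((t * ?y $ j) *\<^sub>R partial_derivative k f ?y))"
      by (intro sum.cong refl) (simp add: algebra_simps scaleR_left_diff_distrib)
    also have "\<dots> = (t * ?y $ i) *\<^sub>R partial_derivative j f ?y - (t * ?y $ j) *\<^sub>R partial_derivative i f ?y"
      by (simp only: sum_subtractf sum_axis_scaleR)
    finally show ?thesis
      by (simp add: rot_derivative_def scaleR_diff_right scaleR_conv_of_real[where 'a = complex] algebra_simps)
  qed
  ultimately show ?thesis by (simp add: has_vector_derivative_def)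
qed

lemma integral_sphere_orthogonal:
  fixes g :: "real ^ 'n::{finite,wellorder} \<Rightarrow> 'b::{banach, second_countable_topology}"
    and U :: "real ^ 'n::{finite,wellorder} \<Rightarrow> real ^ 'n::{finite,wellorder}"
  assumes "continuous_on UNIV g" "orthogonal_transformation U"
  shows "(LINT x|sphere_measure. g (U x)) = (LINT x|sphere_measure. g x)"
proof -
  have "U \<in> borel_measurable borel"
    using assms(2) by (simp add: orthogonal_transformation linear_continuous_on linear_conv_bounded_linear
        borel_measurable_continuous_onI)
  then have U: "U \<in> measurable sphere_measure borel"
    by (simp cong: measurable_cong_sets)
  have "(LINT x|sphere_measure. g x) = (LINT x|distr sphere_measure borel U. g x)"
    by (simp only: distr_sphere_measure_orthogonal[OF assms(2)])
  also have "\<dots> = (LINT x|sphere_measure. g (U x))"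
    by (rule integral_distr[OF U borel_measurable_continuous_onI[OF assms(1)]])
  finally show ?thesis by simp
qed

text \<open>By rotation invariance the difference quotients of \<open>f\<close> along the rotation
  have integral zero; dominated convergence carries this over to the generator.\<close>

lemma integral_rot_derivative:
  fixes f :: "real ^ 'n::{finite,wellorder} \<Rightarrow> complex"
  assumes f: "mpoly f" and ij: "i \<noteq> j"
  shows "(LINT x|sphere_measure. rot_derivative i j f x) = 0"
proof -
  have cont: "continuous_on UNIV f" and mL: "mpoly (rot_derivative i j f)"
    using f by (auto simp: mpoly_continuous_on rot_derivative_def[abs_def])
  have cL: "continuous_on UNIV (rot_derivative i j f)"
    using mL by (rule mpoly_continuous_on)
  define R where "R s = plane_rotation i j s" for s
  have orth: "orthogonal_transformation (R s)" for s
    unfolding R_def by (rule orthogonal_plane_rotation[OF ij])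
  have R_sphere: "R s x \<in> sphere 0 1" if "x \<in> sphere 0 1" for s x
    using orth[of s] that by (simp add: orthogonal_transformation)
  have contR: "continuous_on UNIV (R s)" for s
    using orth[of s] by (simp add: orthogonal_transformation linear_continuous_on linear_conv_bounded_linear)
  obtain B where B: "\<And>x. x \<in> sphere 0 1 \<Longrightarrow> norm (rot_derivative i j f x) \<le> B"
    using bounded_continuous_on_sphere continuous_on_subset[OF cL] by (metis subset_UNIV)
  define t where "t m = 1 / real (Suc m)" for m
  define g where "g m x = (f (R (t m) x) - f x) /\<^sub>R t m" for m x
  have contg: "continuous_on UNIV (g m)" for m
    unfolding g_def
    by (intro continuous_intros continuous_on_compose2[OF cont contR] cont) auto
  have "(LINT x|sphere_measure. g m x) = 0" for m
  proof -
    have "(LINT x|sphere_measure. g m x)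
        = ((LINT x|sphere_measure. f (R (t m) x)) - (LINT x|sphere_measure. f x)) /\<^sub>R t m"
      unfolding g_def
      by (subst integral_scaleR_right, subst Bochner_Integration.integral_diff)
        (auto intro!: integrable_sphere_measure continuous_on_compose2[OF cont contR] cont)
    also have "\<dots> = 0"
      using integral_sphere_orthogonal[OF cont orth] by simp
    finally show ?thesis .
  qed
  moreover have "(\<lambda>m. LINT x|sphere_measure. g m x) \<longlonglongrightarrow> (LINT x|sphere_measure. rot_derivative i j f x)"
  proof (rule integral_dominated_convergence[where w = "\<lambda>_. B"])
    show "rot_derivative i j f \<in> borel_measurable sphere_measure"
      using borel_measurable_continuous_onI[OF cL] by (simp cong: measurable_cong_sets)
    show "g m \<in> borel_measurable sphere_measure" for m
      using borel_measurable_continuous_onI[OF contg] by (simp cong: measurable_cong_sets)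
    show "integrable sphere_measure (\<lambda>_. B)" by (intro integrable_sphere_measure) auto
    show "AE x in sphere_measure. (\<lambda>m. g m x) \<longlonglongrightarrow> rot_derivative i j f x"
    proof (rule AE_I2)
      fix x
      have "((\<lambda>s. (f (R s x) - f (R 0 x)) /\<^sub>R (s - 0)) \<longlongrightarrow> rot_derivative i j f x) (at 0)"
      proof -
        have "((\<lambda>h. norm (f (R h x) - f x - h *\<^sub>R rot_derivative i j f x) / norm h) \<longlongrightarrow> 0) (at 0)"
          using plane_rotation_derivative[OF f ij, of x 0]
          unfolding has_vector_derivative_def has_derivative_at R_def by simp
        moreover have "\<forall>\<^sub>F h in at 0. norm (f (R h x) - f x - h *\<^sub>R rot_derivative i j f x) / norm h
            = norm ((f (R h x) - f x) /\<^sub>R h - rot_derivative i j f x)"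
        proof -
          have "norm (v - h *\<^sub>R w) / norm h = norm (v /\<^sub>R h - w)" if "h \<noteq> 0" for v w :: complex and h :: real
          proof -
            have "v /\<^sub>R h - w = (v - h *\<^sub>R w) /\<^sub>R h" using that by (simp add: scaleR_diff_right)
            then show ?thesis by (simp add: divide_inverse_commute)
          qed
          then show ?thesis by (auto simp: eventually_at_filter)
        qed
        ultimately have "((\<lambda>h. norm ((f (R h x) - f x) /\<^sub>R h - rot_derivative i j f x)) \<longlongrightarrow> 0) (at 0)"
          by (rule Lim_transform_eventually)
        then show ?thesis
          by (simp add: R_def LIM_zero_iff tendsto_norm_zero_iff)
      qed
      moreover have "filterlim t (at 0) sequentially"
        using LIMSEQ_inverse_real_of_nat by (auto simp: t_def[abs_def] filterlim_at inverse_eq_divide)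
      ultimately show "(\<lambda>m. g m x) \<longlonglongrightarrow> rot_derivative i j f x"
        unfolding g_def by (auto dest: filterlim_compose simp: R_def)
    qed
    show "AE x in sphere_measure. norm (g m x) \<le> B" for m
      using AE_sphere_measure
    proof eventually_elim
      case (elim x)
      have t: "0 < t m" by (simp add: t_def)
      \<comment> \<open>Mean value inequality along the orbit of \<open>x\<close>. The orbit stays
        on the sphere, so one bound \<open>B\<close> dominates the quotients for all
        \<open>m\<close>.\<close>
      have "norm (f (R (t m) x) - f (R 0 x)) \<le> B * t m - B * 0"
      proof (rule differentiable_bound_general[where f' = "\<lambda>s. rot_derivative i j f (R s x)" and \<phi>' = "\<lambda>_. B"])
        show "continuous_on {0..t m} (\<lambda>s. f (R s x))"
          unfolding R_def using plane_rotation_derivative[OF f ij, of x]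
          by (meson continuous_at_imp_continuous_on has_vector_derivative_continuous)
      qed (use t B[OF R_sphere[OF elim]] plane_rotation_derivative[OF f ij, of x] in
          \<open>auto intro!: continuous_intros derivative_eq_intros simp: R_def has_vector_derivative_def\<close>)
      then show ?case
        using t by (simp add: g_def R_def divide_simps mult.commute)
    qed
  qed
  ultimately show ?thesis by (simp add: LIMSEQ_const_iff)
qed

text \<open>This amounts to splitting the Laplacian into radial and spherical parts, arranged so
  that every summand on the left is a rotation derivative of a polynomial and therefore integrates
  to zero.\<close>

lemma sum_rot_derivative:
  fixes q :: "real ^ 'n \<Rightarrow> complex"
  assumes q: "mpoly q" and k: "scaling k q"
  shows "(\<Sum>i\<in>UNIV. \<Sum>j\<in>UNIV. rot_derivative i j (\<lambda>x. of_real (x $ i) * partial_derivative j q x) x)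
    = of_real (x \<bullet> x) * laplacian q x - of_nat k * (of_nat k + of_nat CARD('n) - 2) * q x"
proof -
  define D where "D j = partial_derivative j q" for j
  have D: "mpoly (D j)" for j unfolding D_def using q by (rule mpoly_partial_derivative)
  have e1: "(\<Sum>i\<in>UNIV. of_real (x $ i) * D i x) = of_nat k * q x"
    using euler_identity[OF q k, of x] by (simp add: directional_def D_def)
  \<comment> \<open>Euler's identity in degree \<open>k - 1\<close>. In degree 0 the partial
    derivatives vanish, so the formula also holds with the factor -1.\<close>
  have e2: "(\<Sum>i\<in>UNIV. of_real (x $ i) * partial_derivative i (D j) x) = (of_nat k - 1) * D j x" for j
  proof (cases k)
    case 0
    then have "D j x = 0" for x unfolding D_def using partial_derivative_scaling_0[OF q] k by simp
    then have "D j = (\<lambda>x. 0)" by auto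
    then show ?thesis by simp
  next
    case (Suc m)
    then have "scaling m (D j)" using scaling_partial_derivative[OF q] k by (simp add: D_def)
    from euler_identity[OF D this, of x] show ?thesis by (simp add: directional_def Suc)
  qed
  have "rot_derivative i j (\<lambda>x. of_real (x $ i) * partial_derivative j q x) x =
      (if i = j then of_real (x $ i) * D i x else 0)
      + of_real (x $ i) * of_real (x $ i) * partial_derivative j (D j) x
      - of_real (x $ j) * D j x - of_real (x $ j) * (of_real (x $ i) * partial_derivative i (D j) x)" for i j
    unfolding rot_derivative_def D_def[symmetric]
    using D by (simp add: partial_derivative_mult mpoly_coord algebra_simps)
  then have "(\<Sum>i\<in>UNIV. \<Sum>j\<in>UNIV. rot_derivative i j (\<lambda>x. of_real (x $ i) * partial_derivative j q x) x)
    = (\<Sum>i\<in>UNIV. of_real (x $ i) * D i x)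
      + (\<Sum>i\<in>UNIV. of_real (x $ i) * of_real (x $ i)) * laplacian q x
      - of_nat CARD('n) * (\<Sum>j\<in>UNIV. of_real (x $ j) * D j x)
      - (\<Sum>i\<in>UNIV. \<Sum>j\<in>UNIV. of_real (x $ j) * (of_real (x $ i) * partial_derivative i (D j) x))"
    by (simp add: sum_subtractf sum.distrib sum_product laplacian_def D_def)
  also have "(\<Sum>i\<in>UNIV. \<Sum>j\<in>UNIV. of_real (x $ j) * (of_real (x $ i) * partial_derivative i (D j) x))
     = (\<Sum>j\<in>UNIV. of_real (x $ j) * (\<Sum>i\<in>UNIV. of_real (x $ i) * partial_derivative i (D j) x))"
    unfolding sum_distrib_left by (rule sum.swap)
  also have "\<dots> = (of_nat k - 1) * (\<Sum>j\<in>UNIV. of_real (x $ j) * D j x)"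
    unfolding e2 by (simp add: sum_distrib_left algebra_simps)
  finally show ?thesis
    unfolding e1 sum_of_real_square by (simp add: algebra_simps)
qed

lemma integral_laplacian:
  fixes q :: "real ^ 'n::{finite,wellorder} \<Rightarrow> complex"
  assumes q: "mpoly q" and k: "scaling k q"
  shows "of_nat k * (of_nat k + of_nat CARD('n) - 2) * (LINT x|sphere_measure. q x)
    = (LINT x|sphere_measure. laplacian q x)"
proof -
  define S where "S x = (\<Sum>i\<in>UNIV. \<Sum>j\<in>UNIV. rot_derivative i j (\<lambda>x. of_real (x $ i) * partial_derivative j q x) x)" for x
  have mp: "mpoly (\<lambda>x. of_real (x $ i) * partial_derivative j q x)" for i j
    using q by auto
  have mr: "mpoly (rot_derivative i j (\<lambda>x. of_real (x $ i) * partial_derivative j q x))" for i j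
    unfolding rot_derivative_def[abs_def]
    by (intro mpoly_diff mpoly_mult[OF mpoly_coord] mpoly_partial_derivative mp)
  have z: "(LINT x|sphere_measure. rot_derivative i j (\<lambda>x. of_real (x $ i) * partial_derivative j q x) x) = 0" for i j
  proof (cases "i = j")
    case False
    show ?thesis by (rule integral_rot_derivative[OF mp False])
  qed (simp add: rot_derivative_def)
  have "(LINT x|sphere_measure. S x) = 0"
    unfolding S_def by (simp add: Bochner_Integration.integral_sum integrable_sphere_mpoly mpoly_sum mr z)
  moreover have "(LINT x|sphere_measure. S x)
      = (LINT x|sphere_measure. laplacian q x - of_nat k * (of_nat k + of_nat CARD('n) - 2) * q x)"
  proof (rule integral_cong_AE)
    show "S \<in> borel_measurable sphere_measure"
      unfolding S_def by (rule borel_measurable_integrable) (auto simp: mr)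
    show "(\<lambda>x. laplacian q x - of_nat k * (of_nat k + of_nat CARD('n) - 2) * q x) \<in> borel_measurable sphere_measure"
      by (rule borel_measurable_integrable) (use q in auto)
    show "AE x in sphere_measure. S x = laplacian q x - of_nat k * (of_nat k + of_nat CARD('n) - 2) * q x"
      using AE_sphere_measure
      by eventually_elim (simp add: S_def sum_rot_derivative[OF q k] norm_eq_sqrt_inner)
  qed
  moreover have "\<dots> = (LINT x|sphere_measure. laplacian q x)
      - of_nat k * (of_nat k + of_nat CARD('n) - 2) * (LINT x|sphere_measure. q x)"
    using q by (subst Bochner_Integration.integral_diff) (auto simp: integrable_sphere_mpoly mpoly_laplacian mpoly_cmult)
  ultimately show ?thesis by simp
qed

text \<open>The recursion that \<open>integral_laplacian\<close> yields for the integral of (x .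
  y)^j h(y), with \<open>h\<close> harmonic of degree \<open>k\<close> and |x| = 1. The guards make
  it terminate; where one fails, the factor in front of it is zero.\<close>

fun fh_coeff :: "nat \<Rightarrow> nat \<Rightarrow> nat \<Rightarrow> real" where
  "fh_coeff n j k = (if j + k = 0 then 1 else
    (real (j * (j - 1)) * (if 2 \<le> j then fh_coeff n (j - 2) k else 0)
      + 2 * real (j * k) * (if 1 \<le> j \<and> 1 \<le> k then fh_coeff n (j - 1) (k - 1) else 0))
    / (real (j + k) * (real (j + k) + real n - 2)))"

declare fh_coeff.simps [simp del]

lemma laplacian_zero_directional:
  assumes "mpoly h" "\<And>y. laplacian h y = 0"
  shows "laplacian (directional x h) y = 0"
proof -
  have "laplacian h = (\<lambda>y. 0)" using assms by auto
  then show ?thesis by (simp add: laplacian_directional[OF assms(1)] directional_def)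
qed

lemma scaling_mult: "scaling j p \<Longrightarrow> scaling k q \<Longrightarrow> scaling (j + k) (\<lambda>x. p x * q x)"
  by (simp add: scaling_def power_add mult_ac)

lemma scaling_inner_power: "scaling j (\<lambda>y. of_real (x \<bullet> y) ^ j)"
  by (simp add: scaling_def power_mult_distrib)

text \<open>Applying the Laplacian to \<open>(x \<bullet> y) ^ j * h y\<close> yields terms of the same shape with \<open>h\<close> replaced by
  itself or by its derivative in direction \<open>x\<close>, whose value at \<open>x\<close> Euler's identity gives.\<close>

theorem funk_hecke_power:
  fixes h :: "real ^ 'n::{finite,wellorder} \<Rightarrow> complex"
  assumes "CARD('n) \<ge> 2" "norm x = 1" "mpoly h" "scaling k h" "\<And>y. laplacian h y = 0"
  shows "(LINT y|sphere_measure. of_real (x \<bullet> y) ^ j * h y) = of_real (fh_coeff CARD('n) j k) * h x"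
  using assms(3-)
proof (induction "j + k" arbitrary: j k h rule: less_induct)
  case less
  let ?n = "CARD('n)"
  let ?I = "\<lambda>j h. (LINT y|sphere_measure. of_real (x \<bullet> y) ^ j * h y) :: complex"
  show ?case
  proof (cases "j + k = 0")
    case True
    define c where "c = h x"
    have "h y = c" for y
      unfolding c_def using True scaling_0_const[of h x] scaling_0_const[of h y] less.prems by simp
    then have "(\<lambda>y. of_real (x \<bullet> y) ^ j * h y) = (\<lambda>y. c)"
      using True by auto
    moreover have "measure sphere_measure (UNIV :: (real ^ 'n::{finite,wellorder}) set) = 1"
      using prob_space.prob_space[OF prob_space_sphere_measure] by simp
    ultimately show ?thesis using True by (simp add: fh_coeff.simps flip: c_def)
  next
    case False
    define N where "N = real (j + k) * (real (j + k) + real ?n - 2)"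
    \<comment> \<open>Positive total degree and dimension at least 2 make both factors
      positive.\<close>
    have N: "N \<noteq> 0" using False assms(1) by (auto simp: N_def)
    have m: "mpoly (\<lambda>y. of_real (x \<bullet> y) ^ j * h y)" using less.prems by auto
    have "of_real N * ?I j h = (LINT y|sphere_measure. laplacian (\<lambda>y. of_real (x \<bullet> y) ^ j * h y) y)"
      using integral_laplacian[OF m scaling_mult[OF scaling_inner_power less.prems(2)]] by (simp add: N_def)
    also have "\<dots> = (LINT y|sphere_measure. of_nat (j * (j - 1)) * (of_real (x \<bullet> y) ^ (j - 2) * h y)
        + 2 * of_nat j * (of_real (x \<bullet> y) ^ (j - 1) * directional x h y))"
      using less.prems assms(2) by (simp add: laplacian_inner_power_mult norm_eq_1 mult.assoc)
    also have "\<dots> = of_nat (j * (j - 1)) * ?I (j - 2) h + 2 * of_nat j * ?I (j - 1) (directional x h)"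
      using less.prems by (subst Bochner_Integration.integral_add)
        (auto simp: integrable_sphere_mpoly mpoly_mult mpoly_power mpoly_inner' mpoly_directional mpoly_const)
    \<comment> \<open>For \<open>j < 2\<close> the exponent \<open>j - 2\<close> is truncated, but
      then \<open>j * (j - 1)\<close> is zero.\<close>
    also have "of_nat (j * (j - 1)) * ?I (j - 2) h
        = of_real (real (j * (j - 1)) * (if 2 \<le> j then fh_coeff ?n (j - 2) k else 0)) * h x"
    proof (cases "2 \<le> j")
      case True
      then show ?thesis using less.hyps[of "j - 2" k h] less.prems by simp
    next
      case False
      then consider "j = 0" | "j = 1" by linarith
      then show ?thesis by cases simp_all
    qed
    also have "2 * of_nat j * ?I (j - 1) (directional x h)
        = of_real (2 * real (j * k) * (if 1 \<le> j \<and> 1 \<le> k then fh_coeff ?n (j - 1) (k - 1) else 0)) * h x"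
    proof (cases "j = 0")
      case False
      show ?thesis
      proof (cases k)
        case 0
        then have "directional x h y = 0" for y
          using partial_derivative_scaling_0[of h] less.prems by (simp add: directional_def)
        then show ?thesis using 0 by simp
      next
        case (Suc k')
        have "?I (j - 1) (directional x h) = of_real (fh_coeff ?n (j - 1) k') * directional x h x"
          using False Suc less.prems
          by (intro less.hyps laplacian_zero_directional scaling_directional) auto
        moreover have "directional x h x = of_nat k * h x"
          by (rule euler_identity) (use less.prems in auto)
        ultimately show ?thesis using False Suc by (simp add: algebra_simps)
      qed
    qed simp
    also have "of_real (real (j * (j - 1)) * (if 2 \<le> j then fh_coeff ?n (j - 2) k else 0)) * h x
        + of_real (2 * real (j * k) * (if 1 \<le> j \<and> 1 \<le> k then fh_coeff ?n (j - 1) (k - 1) else 0)) * h x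
        = of_real N * (of_real (fh_coeff ?n j k) * h x)"
    proof -
      have "N * fh_coeff ?n j k = real (j * (j - 1)) * (if 2 \<le> j then fh_coeff ?n (j - 2) k else 0)
          + 2 * real (j * k) * (if 1 \<le> j \<and> 1 \<le> k then fh_coeff ?n (j - 1) (k - 1) else 0)"
        using False N unfolding fh_coeff.simps[of _ j k] N_def by simp
      then show ?thesis
        by (simp only: flip: mult.assoc distrib_right of_real_add of_real_mult)
    qed
    finally show ?thesis using N by simp
  qed
qed

text \<open>Orthogonality of low powers to harmonics of higher degree: both branches of the
  recursion preserve \<open>j < k\<close>, and at \<open>j = 0\<close> both factors vanish.\<close>

lemma fh_coeff_eq_0: "j < k \<Longrightarrow> fh_coeff n j k = 0"
proof (induction n j k rule: fh_coeff.induct)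
  case (1 n j k)
  then show ?case by (subst fh_coeff.simps) auto
qed

text \<open>On the diagonal the branch with \<open>j - 2\<close> vanishes by
  \<open>fh_coeff_eq_0\<close>, which leaves a recursion with one term.\<close>

lemma fh_coeff_diag: "n \<ge> 1 \<Longrightarrow> fh_coeff n k k = (\<Prod>m=1..k. real m / (2 * real m + real n - 2))"
proof (induction k)
  case (Suc k)
  have "fh_coeff n (Suc k) (Suc k) = (2 * real (Suc k)) * (real (Suc k) * fh_coeff n k k)
     / ((2 * real (Suc k)) * (2 * real (Suc k) + real n - 2))"
    by (subst fh_coeff.simps) (simp add: fh_coeff_eq_0 algebra_simps)
  also have "\<dots> = real (Suc k) / (2 * real (Suc k) + real n - 2) * fh_coeff n k k"
    by (subst mult_divide_mult_cancel_left) auto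
  finally show ?case using Suc by simp
qed (simp add: fh_coeff.simps)

lemma fh_coeff_1_0: "fh_coeff n 1 0 = 0"
  by (subst fh_coeff.simps) simp

text \<open>For \<open>k = 0\<close> the coefficients are the moments of one coordinate on the
  sphere. The Jacobi weight satisfies the same two-step recursion, see
  \<open>jacobi_measure_moment\<close>.\<close>

lemma fh_coeff_Suc_Suc_0:
  "n \<ge> 1 \<Longrightarrow> fh_coeff n (Suc (Suc j)) 0 = (real j + 1) / (real j + real n) * fh_coeff n j 0"
proof -
  assume n: "n \<ge> 1"
  have "fh_coeff n (Suc (Suc j)) 0 = (real j + 2) * ((real j + 1) * fh_coeff n j 0) / ((real j + 2) * (real j + real n))"
    by (subst fh_coeff.simps) (simp add: algebra_simps)
  also have "\<dots> = (real j + 1) / (real j + real n) * fh_coeff n j 0"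
    using n by (subst mult_divide_mult_cancel_left) auto
  finally show ?thesis .
qed

section \<open>Zonal polynomials\<close>

text \<open>The polynomial factor that remains when (1 - t^2)^a is differentiated \<open>k\<close>
  times. The recursion is the product rule; degree, leading coefficient and differential equation
  are read off from it.\<close>

fun rodrigues_poly :: "real \<Rightarrow> nat \<Rightarrow> real poly" where
  "rodrigues_poly a 0 = 1"
| "rodrigues_poly a (Suc k) = Polynomial.smult (- 2 * (a - real k)) ([:0, 1:] * rodrigues_poly a k)
     + [:1, 0, -1:] * pderiv (rodrigues_poly a k)"

lemma higher_deriv_weight:
  assumes "t \<in> {-1<..<1}"
  shows "(deriv ^^ k) (\<lambda>u. (1 - u) powr a * (1 + u) powr a) t
    = (1 - t\<^sup>2) powr (a - real k) * poly (rodrigues_poly a k) t"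
  using assms
proof (induction k arbitrary: t)
  case 0
  have "(1 - t) * (1 + t) = 1 - t\<^sup>2" by (simp add: power2_eq_square algebra_simps)
  with 0 show ?case by (simp flip: powr_mult)
next
  case (Suc k)
  let ?c = "a - real k" and ?q = "rodrigues_poly a k"
  have t: "1 - t\<^sup>2 > 0" using Suc.prems by (simp add: abs_square_less_1 abs_less_iff)
  have p: "(1 - t\<^sup>2) powr ?c = (1 - t\<^sup>2) powr (?c - 1) * (1 - t\<^sup>2)"
    using t by (simp add: powr_diff)
  have "((\<lambda>t. (1 - t\<^sup>2) powr ?c * poly ?q t) has_field_derivative
      (?c * (1 - t\<^sup>2) powr (?c - 1) * (- 2 * t)) * poly ?q t + poly (pderiv ?q) t * (1 - t\<^sup>2) powr ?c) (at t)"
  proof -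
    have "((\<lambda>t. 1 - t\<^sup>2) has_field_derivative - 2 * t) (at t)"
      by (auto intro!: derivative_eq_intros)
    from DERIV_mult[OF DERIV_fun_powr[OF this t, of ?c] poly_DERIV] show ?thesis by simp
  qed
  also have "(?c * (1 - t\<^sup>2) powr (?c - 1) * (- 2 * t)) * poly ?q t + poly (pderiv ?q) t * (1 - t\<^sup>2) powr ?c
      = (1 - t\<^sup>2) powr (a - real (Suc k)) * poly (rodrigues_poly a (Suc k)) t"
    unfolding p by (simp add: algebra_simps power2_eq_square)
  finally have "((deriv ^^ k) (\<lambda>u. (1 - u) powr a * (1 + u) powr a) has_field_derivative
      (1 - t\<^sup>2) powr (a - real (Suc k)) * poly (rodrigues_poly a (Suc k)) t) (at t)"
    by (rule has_field_derivative_transform_within_open[where S="{-1<..<1}"]) (use Suc in auto)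
  then show ?case by (simp add: DERIV_imp_deriv)
qed

text \<open>The powers of 1 - t^2 cancel on the open interval, and agreement on an infinite set
  suffices for polynomials. The parameter is \<alpha> + d because that is the power which the
  Rodrigues formula differentiates.\<close>

lemma jacobi_poly_eq_rodrigues_poly:
  "jacobi_poly \<alpha> \<alpha> d = Polynomial.smult ((-1) ^ d / (2 ^ d * fact d)) (rodrigues_poly (\<alpha> + real d) d)"
    (is "?l = ?r")
proof -
  have "poly (?l - ?r) t = 0" if t: "t \<in> {-1<..<1}" for t
  proof -
    have "1 - t\<^sup>2 > 0" using t by (simp add: abs_square_less_1 abs_less_iff)
    moreover have "(1 - t) * (1 + t) = 1 - t\<^sup>2" by (simp add: power2_eq_square algebra_simps)
    then have "(1 - t) powr (- \<alpha>) * (1 + t) powr (- \<alpha>) = (1 - t\<^sup>2) powr (- \<alpha>)"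
      using t by (simp flip: powr_mult)
    ultimately have w: "(1 - t) powr (- \<alpha>) * (1 + t) powr (- \<alpha>) * (1 - t\<^sup>2) powr \<alpha> = 1"
      by (simp flip: powr_add)
    have "poly ?l t = (-1) ^ d / (2 ^ d * fact d) *
        ((1 - t) powr (- \<alpha>) * (1 + t) powr (- \<alpha>) * (1 - t\<^sup>2) powr \<alpha>) * poly (rodrigues_poly (\<alpha> + real d) d) t"
      using t by (simp add: poly_jacobi_poly rodrigues_def higher_deriv_weight mult.assoc)
    also have "\<dots> = poly ?r t" unfolding w by simp
    finally show ?thesis by simp
  qed
  then have "{-1<..<1} \<subseteq> {t. poly (?l - ?r) t = 0}" by auto
  moreover have "infinite {-1<..<1::real}" by (rule infinite_Ioo) simp
  ultimately have "infinite {t. poly (?l - ?r) t = 0}" by (rule infinite_super)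
  then have "?l - ?r = 0" by (metis poly_roots_finite)
  then show ?thesis by simp
qed

text \<open>The analogue of the rule that the derivative of a Jacobi polynomial is a Jacobi
  polynomial with shifted parameters: for fixed \<open>a\<close>, lowering \<open>k\<close> raises
  the exponent \<open>a - k\<close>.\<close>

lemma pderiv_rodrigues_poly:
  "pderiv (rodrigues_poly a k) = Polynomial.smult (- (real k * (2 * a - real k + 1))) (rodrigues_poly a (k - 1))"
proof (induction k)
  case (Suc k)
  let ?q = "rodrigues_poly a" and ?c = "\<lambda>k. real k * (2 * a - real k + 1)"
  have "poly (pderiv (?q (Suc k))) t = poly (Polynomial.smult (- ?c (Suc k)) (?q k)) t" for t
  proof -
    \<comment> \<open>By the induction hypothesis \<open>pderiv (?q k)\<close> is a multiple of the
      preceding polynomial, and the left side is this multiple of the recursion for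
      \<open>?q k\<close>.\<close>
    have *: "- 2 * (a - real k) * t * poly (pderiv (?q k)) t - 2 * t * poly (pderiv (?q k)) t
        + (1 - t\<^sup>2) * poly (pderiv (pderiv (?q k))) t = - ?c k * poly (?q k) t"
    proof (cases k)
      case (Suc m)
      have "pderiv (?q k) = Polynomial.smult (- ?c k) (?q m)" using Suc.IH \<open>k = Suc m\<close> by simp
      then show ?thesis using Suc by (simp add: pderiv_smult algebra_simps power2_eq_square)
    qed simp
    have "poly (pderiv (?q (Suc k))) t = - 2 * (a - real k) * poly (?q k) t + (- 2 * (a - real k) * t * poly (pderiv (?q k)) t - 2 * t * poly (pderiv (?q k)) t
        + (1 - t\<^sup>2) * poly (pderiv (pderiv (?q k))) t)"
      by (simp add: pderiv_add pderiv_mult pderiv_smult pderiv_minus pderiv_pCons algebra_simps power2_eq_square)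
    also have "\<dots> = poly (Polynomial.smult (- ?c (Suc k)) (?q k)) t"
      unfolding * by (simp add: algebra_simps)
    finally show ?thesis .
  qed
  then show ?case by (simp add: poly_eq_poly_eq_iff[symmetric] fun_eq_iff)
qed simp

lemma degree_rodrigues_poly: "degree (rodrigues_poly a k) \<le> k"
proof (induction k)
  case (Suc k)
  have "degree (Polynomial.smult (- 2 * (a - real k)) ([:0, 1:] * rodrigues_poly a k)) \<le> Suc k"
    using Suc by (intro order.trans[OF degree_smult_le] order.trans[OF degree_mult_le]) auto
  moreover have "degree ([:1, 0, -1:] * pderiv (rodrigues_poly a k)) \<le> Suc k"
  proof (cases k)
    case (Suc m)
    then show ?thesis using Suc.IH
      by (intro order.trans[OF degree_mult_le]) (auto simp: degree_pderiv)
  qed simp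
  ultimately show ?case unfolding rodrigues_poly.simps by (rule degree_add_le)
qed simp

text \<open>A step multiplies the top coefficient by -2(a - k) from the first summand and by -k from
  -t^2 times the derivative, together -(2a - k).\<close>

lemma coeff_rodrigues_poly: "coeff (rodrigues_poly a k) k = (-1) ^ k * (\<Prod>i<k. 2 * a - real i)"
proof (induction k)
  case (Suc k)
  have "[:1, 0, -1:] * p = p - monom 1 2 * p" for p :: "real poly"
    by (simp add: monom_altdef numeral_2_eq_2 algebra_simps)
  then have "coeff (rodrigues_poly a (Suc k)) (Suc k)
      = - 2 * (a - real k) * coeff (rodrigues_poly a k) k + (coeff (pderiv (rodrigues_poly a k)) (Suc k)
        - (if 1 \<le> k then coeff (pderiv (rodrigues_poly a k)) (k - 1) else 0))"
    by (cases k) (simp_all add: coeff_monom_mult)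
  also have "coeff (pderiv (rodrigues_poly a k)) (Suc k) = 0"
    using degree_rodrigues_poly[of a k] by (simp add: coeff_pderiv coeff_eq_0)
  also have "(if 1 \<le> k then coeff (pderiv (rodrigues_poly a k)) (k - 1) else 0) = real k * coeff (rodrigues_poly a k) k"
    by (cases k) (simp_all add: coeff_pderiv)
  finally show ?case unfolding Suc by (simp add: algebra_simps)
qed simp

text \<open>The Gegenbauer equation. By \<open>pderiv_rodrigues_poly\<close>, the preceding
  polynomial and its derivative in the recursion become the first two derivatives of the current
  one.\<close>

lemma rodrigues_poly_ode:
  "[:1, 0, -1:] * pderiv (pderiv (rodrigues_poly a k))
     - Polynomial.smult (2 * (a - real k + 1)) ([:0, 1:] * pderiv (rodrigues_poly a k))
     + Polynomial.smult (real k * (2 * a - real k + 1)) (rodrigues_poly a k) = 0"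
proof (cases k)
  case (Suc m)
  define c where "c = real k * (2 * a - real k + 1)"
  define q Q where "q = rodrigues_poly a k" and "Q = rodrigues_poly a m"
  have q: "poly q t = - 2 * (a - real m) * t * poly Q t + (1 - t\<^sup>2) * poly (pderiv Q) t" for t
    by (simp add: q_def Q_def Suc power2_eq_square algebra_simps)
  have q': "pderiv q = Polynomial.smult (- c) Q"
    using pderiv_rodrigues_poly[of a k] by (simp add: q_def Q_def c_def Suc del: rodrigues_poly.simps)
  have "poly ([:1, 0, -1:] * pderiv (pderiv q) - Polynomial.smult (2 * (a - real k + 1)) ([:0, 1:] * pderiv q)
     + Polynomial.smult c q) t = 0" for t
  proof -
    have "poly ([:1, 0, -1:] * pderiv (pderiv q) - Polynomial.smult (2 * (a - real k + 1)) ([:0, 1:] * pderiv q)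
       + Polynomial.smult c q) t
     = (1 - t\<^sup>2) * (- c * poly (pderiv Q) t) - 2 * (a - real m) * (t * (- c * poly Q t)) + c * poly q t"
      by (simp add: q' pderiv_smult pderiv_minus Suc power2_eq_square algebra_simps)
    also have "\<dots> = 0" unfolding q by (simp add: algebra_simps)
    finally show ?thesis .
  qed
  then show ?thesis
    unfolding q_def c_def by (simp add: poly_eq_poly_eq_iff[symmetric] fun_eq_iff)
qed simp

text \<open>The reproducing kernel of the spherical harmonics of degree \<open>d\<close> in \<open>n\<close> dimensions, as a
  polynomial in \<open>x \<bullet> y\<close>.\<close>

definition zonal_poly :: "nat \<Rightarrow> nat \<Rightarrow> real poly" where
  "zonal_poly n d = Polynomial.smult ((2 * real d + real n - 2) / (real n - 2)) (gegenbauer_poly ((real n - 2) / 2) d)"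

definition zonal_factor :: "nat \<Rightarrow> nat \<Rightarrow> real" where
  "zonal_factor n d = (2 * real d + real n - 2) / (real n - 2) *
     (Gamma (real n - 2 + real d) * Gamma ((real n - 1) / 2) / (Gamma (real n - 2) * Gamma ((real n - 1) / 2 + real d)))"

lemma zonal_poly_jacobi:
  "zonal_poly n d = Polynomial.smult (zonal_factor n d) (jacobi_poly ((real n - 3) / 2) ((real n - 3) / 2) d)"
proof -
  have e: "(real n - 2) / 2 + 1 / 2 = (real n - 1) / 2" "(real n - 2) / 2 - 1 / 2 = (real n - 3) / 2"
    "2 * ((real n - 2) / 2) = real n - 2"
    by (simp_all add: field_simps)
  show ?thesis unfolding zonal_poly_def gegenbauer_poly_def zonal_factor_def e by simp
qed

lemma degree_zonal_poly: "degree (zonal_poly n d) \<le> d"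
  unfolding zonal_poly_jacobi jacobi_poly_eq_rodrigues_poly
  by (intro order.trans[OF degree_smult_le] degree_rodrigues_poly)

lemma zonal_poly_ode:
  "[:1, 0, -1:] * pderiv (pderiv (zonal_poly n d)) - Polynomial.smult (real n - 1) ([:0, 1:] * pderiv (zonal_poly n d))
     + Polynomial.smult (real d * (real d + real n - 2)) (zonal_poly n d) = 0"
proof -
  define q where "q = rodrigues_poly ((real n - 3) / 2 + real d) d"
  define c where "c = zonal_factor n d * ((-1) ^ d / (2 ^ d * fact d))"
  have z: "zonal_poly n d = Polynomial.smult c q"
    by (simp add: zonal_poly_jacobi jacobi_poly_eq_rodrigues_poly c_def q_def)
  have e: "2 * ((real n - 3) / 2 + real d - real d + 1) = real n - 1"
    "real d * (2 * ((real n - 3) / 2 + real d) - real d + 1) = real d * (real d + real n - 2)"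
    by (simp_all add: field_simps)
  have "[:1, 0, -1:] * pderiv (pderiv q) - Polynomial.smult (real n - 1) ([:0, 1:] * pderiv q)
     + Polynomial.smult (real d * (real d + real n - 2)) q = 0"
    using rodrigues_poly_ode[of "(real n - 3) / 2 + real d" d] unfolding e q_def[symmetric] .
  then have "Polynomial.smult c ([:1, 0, -1:] * pderiv (pderiv q) - Polynomial.smult (real n - 1) ([:0, 1:] * pderiv q)
     + Polynomial.smult (real d * (real d + real n - 2)) q) = 0" by simp
  then show ?thesis
    unfolding z pderiv_smult by (simp add: smult_add_right smult_diff_right mult.commute del: mult_pCons_left mult_pCons_right)
qed

text \<open>The differential equation compared coefficient by coefficient. It serves twice, for the
  parity of the polynomial and for the harmonicity of \<open>zonal_kernel\<close>.\<close>

lemma coeff_zonal_poly_rec: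
  "(real k + 2) * (real k + 1) * coeff (zonal_poly n d) (k + 2)
     = (real k - real d) * (real k + real d + real n - 2) * coeff (zonal_poly n d) k"
proof -
  let ?z = "zonal_poly n d"
  have m: "[:1, 0, -1:] * p = p - monom 1 2 * p" "[:0, 1:] * p = monom 1 1 * p" for p :: "real poly"
    by (simp_all add: monom_altdef numeral_2_eq_2 algebra_simps)
  have c1: "coeff (monom 1 1 * pderiv ?z) k = real k * coeff ?z k"
    by (cases k) (simp_all add: coeff_monom_mult coeff_pderiv)
  have c2: "coeff (monom 1 2 * pderiv (pderiv ?z)) k = real k * (real k - 1) * coeff ?z k"
  proof (cases "k \<ge> 2")
    case True
    then obtain j where "k = Suc (Suc j)" by (metis add_2_eq_Suc le_Suc_ex)
    then show ?thesis by (simp add: coeff_monom_mult coeff_pderiv)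
  next
    case False
    then consider "k = 0" | "k = 1" by linarith
    then show ?thesis by cases (simp_all add: coeff_monom_mult)
  qed
  have "coeff ([:1, 0, -1:] * pderiv (pderiv ?z) - Polynomial.smult (real n - 1) ([:0, 1:] * pderiv ?z)
     + Polynomial.smult (real d * (real d + real n - 2)) ?z) k = 0"
    unfolding zonal_poly_ode by simp
  then have "(real k + 1) * (real k + 2) * coeff ?z (k + 2) - real k * (real k - 1) * coeff ?z k
     - (real n - 1) * (real k * coeff ?z k) + real d * (real d + real n - 2) * coeff ?z k = 0"
    unfolding m coeff_add coeff_diff coeff_smult c1 c2 by (simp add: coeff_pderiv algebra_simps)
  then show ?thesis by (simp add: algebra_simps)
qed

text \<open>Descend in steps of two from the vanishing coefficient of degree \<open>d + 1\<close>;
  the factor (k - d)(k + d + n - 2) is nonzero below \<open>d\<close>. Parity is what allows the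
  homogenisation in \<open>zonal_kernel\<close> to be a polynomial.\<close>

lemma coeff_zonal_poly_parity:
  assumes "n \<ge> 3" "odd (d + k)"
  shows "coeff (zonal_poly n d) k = 0"
proof (cases "k \<le> d")
  case True
  have "odd (d - k)" using assms(2) True by simp
  then obtain m where "d - k = 2 * m + 1" by (rule oddE)
  then have "k = d - 1 - 2 * m" "2 * m + 1 \<le> d" using True by linarith+
  moreover have "2 * m + 1 \<le> d \<Longrightarrow> coeff (zonal_poly n d) (d - 1 - 2 * m) = 0" for m
  proof (induction m)
    case 0
    have "coeff (zonal_poly n d) (d + 1) = 0" using degree_zonal_poly[of n d] by (intro coeff_eq_0) simp
    moreover have "(real (d - 1) - real d) * (real (d - 1) + real d + real n - 2) \<noteq> 0"
      using 0 assms(1) by auto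
    moreover have "d - 1 + 2 = d + 1" using 0 by simp
    ultimately show ?case using coeff_zonal_poly_rec[of "d - 1" n d] by simp
  next
    case (Suc m)
    define j where "j = d - 1 - 2 * Suc m"
    have j: "j < d" "d - 1 - 2 * m = j + 2" using Suc.prems by (auto simp: j_def)
    have "coeff (zonal_poly n d) (j + 2) = 0" using Suc j by simp
    moreover have "(real j - real d) * (real j + real d + real n - 2) \<noteq> 0" using j assms(1) by auto
    ultimately have "coeff (zonal_poly n d) j = 0" using coeff_zonal_poly_rec[of j n d] by simp
    then show ?case unfolding j_def .
  qed
  ultimately show ?thesis by simp
next
  case False
  then show ?thesis using degree_zonal_poly[of n d] by (intro coeff_eq_0) simp
qed

lemma prod_pochhammer_top: "(\<Prod>i<d. 2 * (\<alpha> + real d) - real i) = pochhammer (2 * \<alpha> + real d + 1) d"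
proof -
  have "(\<Prod>i<d. 2 * (\<alpha> + real d) - real i) = (\<Prod>i<d. 2 * (\<alpha> + real d) - real (d - Suc i))"
    by (rule prod.nat_diff_reindex[symmetric])
  also have "\<dots> = (\<Prod>i<d. 2 * \<alpha> + real d + 1 + real i)"
    by (intro prod.cong) (auto simp: of_nat_diff)
  finally show ?thesis by (simp add: pochhammer_prod atLeast0LessThan)
qed

text \<open>The product is the reciprocal of \<open>fh_coeff n d d\<close>, and this makes the
  kernel reproducing with constant 1.\<close>

lemma coeff_zonal_poly_top:
  assumes n: "n \<ge> 3"
  shows "coeff (zonal_poly n d) d = (\<Prod>m=1..d. (2 * real m + real n - 2) / real m)"
proof -
  let ?N = "real n - 2"
  have g: "Gamma (z + real d) = pochhammer z d * Gamma z" if "z > 0" for z :: real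
    using that by (subst pochhammer_Gamma) (auto simp: Gamma_eq_zero_iff elim!: nonpos_Ints_cases)
  have pos: "Gamma ?N > 0" "Gamma ((real n - 1) / 2) > 0" "pochhammer ((real n - 1) / 2) d > 0"
    using n by (auto intro!: Gamma_real_pos pochhammer_pos)
  have "zonal_factor n d = (2 * real d + ?N) / ?N * (pochhammer ?N d / pochhammer ((real n - 1) / 2) d)"
  proof -
    have cancel: "(x * g1) * g2 / (g1 * (y * g2)) = x / y" if "g1 > 0" "g2 > 0" for x y g1 g2 :: real
      using that by simp
    have G: "Gamma (?N + real d) = pochhammer ?N d * Gamma ?N"
      "Gamma ((real n - 1) / 2 + real d) = pochhammer ((real n - 1) / 2) d * Gamma ((real n - 1) / 2)"
      using n by (auto intro!: g)
    show ?thesis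
      unfolding zonal_factor_def G cancel[OF pos(1,2)] by (simp add: add_diff_eq)
  qed
  moreover have "coeff (jacobi_poly ((real n - 3) / 2) ((real n - 3) / 2) d) d
      = pochhammer (?N + real d) d / (2 ^ d * fact d)"
  proof -
    have e: "2 * ((real n - 3) / 2) + real d + 1 = ?N + real d" by (simp add: field_simps)
    show ?thesis
      unfolding jacobi_poly_eq_rodrigues_poly coeff_smult coeff_rodrigues_poly prod_pochhammer_top e
      by (simp flip: power_mult_distrib)
  qed
  \<comment> \<open>Duplication formula: the two symbols join to one of length \<open>2 * d\<close>,
    which splits into its even and odd factors. The odd ones cancel the denominator of
    \<open>zonal_factor\<close>.\<close>
  moreover have "pochhammer ?N d * pochhammer (?N + real d) d
      = 2 ^ (2 * d) * pochhammer (?N / 2) d * pochhammer ((real n - 1) / 2) d"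
  proof -
    have e: "?N / 2 + 1 / 2 = (real n - 1) / 2" "2 * (?N / 2) = ?N" by (simp_all add: field_simps)
    have "pochhammer ?N d * pochhammer (?N + real d) d = pochhammer ?N (2 * d)"
      unfolding mult_2 by (rule pochhammer_product'[symmetric])
    then show ?thesis using pochhammer_double[of "?N / 2" d] unfolding e by simp
  qed
  ultimately have "coeff (zonal_poly n d) d = (2 * real d + ?N) / ?N * (2 ^ d * pochhammer (?N / 2) d / fact d)"
  proof -
    assume *: "zonal_factor n d = (2 * real d + ?N) / ?N * (pochhammer ?N d / pochhammer ((real n - 1) / 2) d)"
      "coeff (jacobi_poly ((real n - 3) / 2) ((real n - 3) / 2) d) d = pochhammer (?N + real d) d / (2 ^ d * fact d)"
      "pochhammer ?N d * pochhammer (?N + real d) d = 2 ^ (2 * d) * pochhammer (?N / 2) d * pochhammer ((real n - 1) / 2) d"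
    have "coeff (zonal_poly n d) d = (2 * real d + ?N) / ?N *
        ((pochhammer ?N d * pochhammer (?N + real d) d) / (pochhammer ((real n - 1) / 2) d * (2 ^ d * fact d)))"
      by (simp add: zonal_poly_jacobi *(1,2))
    also have "(pochhammer ?N d * pochhammer (?N + real d) d) / (pochhammer ((real n - 1) / 2) d * (2 ^ d * fact d))
        = 2 ^ d * pochhammer (?N / 2) d / fact d"
    proof -
      have "a * a * x * y / (y * (a * f)) = a * x / f" if "a > 0" "y > 0" for a x y f :: real
        using that by simp
      from this[OF _ pos(3), of "2 ^ d"] show ?thesis
        unfolding *(3) mult_2 power_add by simp
    qed
    finally show ?thesis .
  qed
  \<comment> \<open>With N = n - 2, the term \<open>2 ^ d * pochhammer (?N / 2) d\<close> is N (N +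
    2) ... (N + 2d - 2). The fraction in front trades the factor N for N + 2d, which shifts the
    product by one place.\<close>
  also have "\<dots> = (\<Prod>m=1..d. (2 * real m + real n - 2) / real m)"
  proof (induction d)
    case 0
    show ?case using n by simp
  next
    case (Suc d)
    define P where "P = (\<Prod>m=1..d. (2 * real m + real n - 2) / real m)"
    define Q where "Q = 2 ^ d * pochhammer (?N / 2) d"
    have N: "?N > 0" using n by simp
    have eq: "a / N * (q / f) = p \<Longrightarrow> a * q = p * f * N" if "N > 0" "f > 0" for a N q f p :: real
      using that by (auto simp: field_simps)
    have P: "(2 * real d + ?N) * Q = P * fact d * ?N"
      by (rule eq[OF N]) (use Suc in \<open>simp_all add: P_def Q_def\<close>)
    have "2 ^ Suc d * pochhammer (?N / 2) (Suc d) = (2 * real d + ?N) * Q"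
      by (simp add: pochhammer_Suc Q_def field_simps)
    then have "(2 * real (Suc d) + ?N) / ?N * (2 ^ Suc d * pochhammer (?N / 2) (Suc d) / fact (Suc d))
        = (2 * real (Suc d) + ?N) / ?N * ((P * fact d * ?N) / (real (Suc d) * fact d))"
      unfolding P by simp
    also have "\<dots> = (2 * real (Suc d) + ?N) / real (Suc d) * P"
    proof -
      have "a / N * (p * f * N / (s * f)) = a / s * p" if "N > 0" "f > 0" "s > 0" for a N p f s :: real
        using that by simp
      from this[OF N, of "fact d" "real (Suc d)"] show ?thesis by simp
    qed
    finally show ?case by (simp add: P_def algebra_simps)
  qed
  finally show ?thesis .
qed

section \<open>The zonal kernel\<close>

lemma homogeneous_polynomial_const: "homogeneous_polynomial 0 (\<lambda>x :: real ^ 'n. c)"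
proof -
  have "{m :: 'n \<Rightarrow> nat. (\<Sum>i\<in>UNIV. m i) = 0} = {\<lambda>_. 0}" by auto
  then show ?thesis unfolding homogeneous_polynomial_def by (intro exI[of _ "\<lambda>_. c"]) simp
qed

lemma homogeneous_polynomial_add:
  assumes "homogeneous_polynomial d p" "homogeneous_polynomial d q"
  shows "homogeneous_polynomial d (\<lambda>x. p x + q x)"
proof -
  obtain b c where
    "\<And>x. p x = (\<Sum>m | (\<Sum>i\<in>UNIV. m i) = d. b m * (\<Prod>i\<in>UNIV. complex_of_real (x $ i) ^ m i))"
    "\<And>x. q x = (\<Sum>m | (\<Sum>i\<in>UNIV. m i) = d. c m * (\<Prod>i\<in>UNIV. complex_of_real (x $ i) ^ m i))"
    using assms unfolding homogeneous_polynomial_def by blast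
  then show ?thesis
    unfolding homogeneous_polynomial_def
    by (intro exI[of _ "\<lambda>m. b m + c m"]) (simp add: sum.distrib distrib_right)
qed

lemma homogeneous_polynomial_cmult:
  assumes "homogeneous_polynomial d p"
  shows "homogeneous_polynomial d (\<lambda>x. c * p x)"
proof -
  obtain b where
    "\<And>x. p x = (\<Sum>m | (\<Sum>i\<in>UNIV. m i) = d. b m * (\<Prod>i\<in>UNIV. complex_of_real (x $ i) ^ m i))"
    using assms unfolding homogeneous_polynomial_def by blast
  then show ?thesis
    unfolding homogeneous_polynomial_def
    by (intro exI[of _ "\<lambda>m. c * b m"]) (simp add: sum_distrib_left mult.assoc)
qed

lemma homogeneous_polynomial_0: "homogeneous_polynomial d (\<lambda>x. 0)"
  unfolding homogeneous_polynomial_def by (intro exI[of _ "\<lambda>_. 0"]) simp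

lemma homogeneous_polynomial_sum:
  "(\<And>k. k \<in> A \<Longrightarrow> homogeneous_polynomial d (p k)) \<Longrightarrow> homogeneous_polynomial d (\<lambda>x. \<Sum>k\<in>A. p k x)"
  by (induction A rule: infinite_finite_induct)
    (auto intro: homogeneous_polynomial_0 homogeneous_polynomial_add)

text \<open>Raising the i-th exponent is a bijection from the multi-indices of degree
  \<open>d\<close> to those of degree \<open>d + 1\<close> whose i-th entry is positive; the
  remaining ones receive the coefficient 0.\<close>

lemma homogeneous_polynomial_coord_mult:
  fixes p :: "real ^ 'n \<Rightarrow> complex"
  assumes "homogeneous_polynomial d p"
  shows "homogeneous_polynomial (Suc d) (\<lambda>x. of_real (x $ i) * p x)"
proof -
  obtain b where b:
    "\<And>x. p x = (\<Sum>m | (\<Sum>i\<in>UNIV. m i) = d. b m * (\<Prod>i\<in>UNIV. complex_of_real (x $ i) ^ m i))"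
    using assms unfolding homogeneous_polynomial_def by blast
  define up where "up m = m(i := Suc (m i))" for m :: "'n \<Rightarrow> nat"
  define c where "c m = (if m i = 0 then 0 else b (m(i := m i - 1)))" for m
  have sum_up: "(\<Sum>k\<in>UNIV. up m k) = Suc (\<Sum>k\<in>UNIV. m k)" for m
    by (simp add: up_def sum.remove[of UNIV i])
  have prod_up: "(\<Prod>k\<in>UNIV. complex_of_real (x $ k) ^ up m k)
      = of_real (x $ i) * (\<Prod>k\<in>UNIV. complex_of_real (x $ k) ^ m k)" for x :: "real ^ 'n" and m
    by (simp add: up_def prod.remove[of UNIV i] mult.assoc)
  have img: "up ` {m. (\<Sum>k\<in>UNIV. m k) = d} = {m. (\<Sum>k\<in>UNIV. m k) = Suc d \<and> m i \<noteq> 0}"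
  proof (intro equalityI subsetI)
    fix m assume m: "m \<in> {m. (\<Sum>k\<in>UNIV. m k) = Suc d \<and> m i \<noteq> 0}"
    then have "m = up (m(i := m i - 1))" by (auto simp: up_def)
    moreover from this m have "(\<Sum>k\<in>UNIV. (m(i := m i - 1)) k) = d"
      using sum_up[of "m(i := m i - 1)"] by simp
    ultimately show "m \<in> up ` {m. (\<Sum>k\<in>UNIV. m k) = d}" by blast
  qed (auto simp: sum_up, simp add: up_def)
  have inj: "inj_on up A" for A
    by (rule inj_on_inverseI[where g = "\<lambda>m. m(i := m i - 1)"]) (simp add: up_def)
  have "of_real (x $ i) * p x
      = (\<Sum>m | (\<Sum>k\<in>UNIV. m k) = Suc d. c m * (\<Prod>k\<in>UNIV. complex_of_real (x $ k) ^ m k))" for x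
  proof -
    have "(\<Sum>m | (\<Sum>k\<in>UNIV. m k) = Suc d. c m * (\<Prod>k\<in>UNIV. complex_of_real (x $ k) ^ m k))
      = (\<Sum>m | (\<Sum>k\<in>UNIV. m k) = Suc d \<and> m i \<noteq> 0. c m * (\<Prod>k\<in>UNIV. complex_of_real (x $ k) ^ m k))"
      by (rule sum.mono_neutral_right) (auto simp: finite_multi_indices c_def)
    also have "\<dots> = (\<Sum>m | (\<Sum>k\<in>UNIV. m k) = d. c (up m) * (\<Prod>k\<in>UNIV. complex_of_real (x $ k) ^ up m k))"
      unfolding img[symmetric] by (subst sum.reindex[OF inj]) simp
    also have "\<dots> = of_real (x $ i) * p x"
      unfolding b prod_up sum_distrib_left by (rule sum.cong) (simp_all add: c_def up_def)
    finally show ?thesis by simp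
  qed
  then show ?thesis unfolding homogeneous_polynomial_def by blast
qed

text \<open>The algebraic tensor product of a class \<open>A\<close> of functions of x with the
  polynomials in y. Statements about linear operations on such kernels reduce to a single product
  a(x) b(y). The class is a parameter because the left factors are sometimes homogeneous and
  sometimes arbitrary polynomials.\<close>

inductive separable :: "((real ^ 'n \<Rightarrow> complex) \<Rightarrow> bool) \<Rightarrow> (real ^ 'n \<Rightarrow> real ^ 'n \<Rightarrow> complex) \<Rightarrow> bool"
  for A :: "(real ^ 'n \<Rightarrow> complex) \<Rightarrow> bool" where
  separable_prod: "A a \<Longrightarrow> mpoly b \<Longrightarrow> separable A (\<lambda>x y. a x * b y)"
| separable_add: "separable A F \<Longrightarrow> separable A G \<Longrightarrow> separable A (\<lambda>x y. F x y + G x y)"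

lemma separable_sum:
  assumes "A (\<lambda>x. 0)" "\<And>k. k \<in> I \<Longrightarrow> separable A (F k)"
  shows "separable A (\<lambda>x y. \<Sum>k\<in>I. F k x y)"
  using assms(2)
proof (induction I rule: infinite_finite_induct)
  case (insert k I)
  then show ?case by (simp add: separable_add)
qed (use separable_prod[of A "\<lambda>_. 0" "\<lambda>_. 0", OF assms(1) mpoly_const] in simp_all)

lemma separable_mult_prod:
  assumes "separable A F" "\<And>a. A a \<Longrightarrow> B (\<lambda>x. p x * a x)" "mpoly q"
  shows "separable B (\<lambda>x y. p x * q y * F x y)"
  using assms(1)
proof induction
  case (separable_prod a b)
  then have "separable B (\<lambda>x y. (p x * a x) * (q y * b y))"
    using assms by (intro separable.separable_prod) auto
  then show ?case by (simp add: mult_ac)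
next
  case (separable_add F G)
  from separable.separable_add[OF this(3,4)] show ?case by (simp add: distrib_left)
qed

lemma separable_cmult:
  assumes "separable A F"
  shows "separable A (\<lambda>x y. c * F x y)"
  using assms
proof induction
  case (separable_prod a b)
  then show ?case using separable.separable_prod[of A a "\<lambda>y. c * b y"] by (simp add: mult_ac mpoly_cmult)
next
  case (separable_add F G)
  from separable.separable_add[OF this(3,4)] show ?case by (simp add: distrib_left)
qed

lemma separable_inner_mult:
  assumes "separable A F" "\<And>a i. A a \<Longrightarrow> B (\<lambda>x. of_real (x $ i) * a x)" "B (\<lambda>x. 0)"
  shows "separable B (\<lambda>x y. of_real (x \<bullet> y) * F x y)"
proof -
  have "separable B (\<lambda>x y. \<Sum>i\<in>UNIV. of_real (x $ i) * of_real (y $ i) * F x y)"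
    by (intro separable_sum assms separable_mult_prod[OF assms(1)] mpoly_coord)
  then show ?thesis by (simp add: inner_vec_def sum_distrib_right)
qed

lemma separable_mpoly_left:
  assumes "separable A F" "\<And>a. A a \<Longrightarrow> mpoly a" shows "mpoly (\<lambda>x. F x y)"
  using assms(1) by induction (auto simp: assms(2))

lemma separable_mpoly_right:
  assumes "separable A F" shows "mpoly (F x)"
  using assms by induction auto

text \<open>The homogenisation |x|^d |y|^d z(x . y / (|x| |y|)) of the zonal polynomial z, in which
  only the exponents of the parity of \<open>d\<close> occur. It extends the kernel from the sphere
  to a polynomial on the whole space, where the Laplacian can act.\<close>

definition zonal_kernel :: "nat \<Rightarrow> real ^ 'n \<Rightarrow> real ^ 'n \<Rightarrow> complex" where
  "zonal_kernel d x y = (\<Sum>j\<le>d div 2. of_real (coeff (zonal_poly CARD('n) d) (d - 2 * j)) *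
     ((of_real (x \<bullet> x) * of_real (y \<bullet> y)) ^ j * of_real (x \<bullet> y) ^ (d - 2 * j)))"

lemma zonal_kernel_sphere:
  fixes x y :: "real ^ 'n"
  assumes "CARD('n) \<ge> 3" "norm x = 1" "norm y = 1"
  shows "zonal_kernel d x y = of_real (poly (zonal_poly CARD('n) d) (x \<bullet> y))"
proof -
  let ?z = "zonal_poly CARD('n) d"
  have "poly ?z t = (\<Sum>k\<le>d. coeff ?z k * t ^ k)" for t
    unfolding poly_altdef using degree_zonal_poly[of "CARD('n)" d]
    by (intro sum.mono_neutral_left) (auto simp: coeff_eq_0)
  also have "(\<Sum>k\<le>d. coeff ?z k * t ^ k) = (\<Sum>k\<in>(\<lambda>j. d - 2 * j) ` {..d div 2}. coeff ?z k * t ^ k)" for t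
  proof (rule sum.mono_neutral_right)
    show "\<forall>k\<in>{..d} - (\<lambda>j. d - 2 * j) ` {..d div 2}. coeff ?z k * t ^ k = 0"
    proof
      fix k assume k: "k \<in> {..d} - (\<lambda>j. d - 2 * j) ` {..d div 2}"
      have "odd (d + k)"
      proof
        assume "even (d + k)"
        then have "even (d - k)" using k by simp
        then have "k = d - 2 * ((d - k) div 2)" using k by auto
        moreover have "(d - k) div 2 \<le> d div 2" by (intro div_le_mono) simp
        ultimately show False using k by auto
      qed
      then show "coeff ?z k * t ^ k = 0" using coeff_zonal_poly_parity[OF assms(1)] by simp
    qed
  qed auto
  also have "(\<Sum>k\<in>(\<lambda>j. d - 2 * j) ` {..d div 2}. coeff ?z k * t ^ k) = (\<Sum>j\<le>d div 2. coeff ?z (d - 2 * j) * t ^ (d - 2 * j))" for t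
    by (subst sum.reindex) (auto simp: inj_on_def)
  finally show ?thesis
    using assms(2,3) by (simp add: zonal_kernel_def norm_eq_1)
qed

lemma zonal_kernel_commute: "zonal_kernel d x y = zonal_kernel d y x"
  by (simp add: zonal_kernel_def inner_commute mult.commute)

lemma separable_zonal_kernel:
  "separable (homogeneous_polynomial d) (zonal_kernel d :: real ^ 'n \<Rightarrow> real ^ 'n \<Rightarrow> complex)"
proof -
  have s0: "separable (homogeneous_polynomial 0) (\<lambda>x y :: real ^ 'n. 1)"
    using separable_prod[of "homogeneous_polynomial 0" "\<lambda>_. 1" "\<lambda>_. 1"]
    by (simp add: homogeneous_polynomial_const mpoly_const)
  have s1: "separable (homogeneous_polynomial k) (\<lambda>x y :: real ^ 'n. of_real (x \<bullet> y) ^ k)" for k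
  proof (induction k)
    case (Suc k)
    from separable_inner_mult[OF this homogeneous_polynomial_coord_mult homogeneous_polynomial_0]
    show ?case by simp
  qed (use s0 in simp)
  have s2: "separable (homogeneous_polynomial (k + 2 * j))
      (\<lambda>x y :: real ^ 'n. (of_real (x \<bullet> x) * of_real (y \<bullet> y)) ^ j * of_real (x \<bullet> y) ^ k)" for j k
  proof (induction j)
    case (Suc j)
    have "separable (homogeneous_polynomial (k + 2 * Suc j))
       (\<lambda>x y :: real ^ 'n. of_real (x \<bullet> x) * of_real (y \<bullet> y) * ((of_real (x \<bullet> x) * of_real (y \<bullet> y)) ^ j * of_real (x \<bullet> y) ^ k))"
    proof (rule separable_mult_prod[OF Suc])
      fix a :: "real ^ 'n \<Rightarrow> complex" assume "homogeneous_polynomial (k + 2 * j) a"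
      then have "homogeneous_polynomial (Suc (Suc (k + 2 * j))) (\<lambda>x. \<Sum>i\<in>UNIV. of_real (x $ i) * (of_real (x $ i) * a x))"
        by (intro homogeneous_polynomial_sum homogeneous_polynomial_coord_mult)
      then show "homogeneous_polynomial (k + 2 * Suc j) (\<lambda>x. of_real (x \<bullet> x) * a x)"
        by (simp add: inner_vec_def sum_distrib_right mult.assoc)
    qed auto
    then show ?case by (simp add: mult_ac)
  qed (use s1 in simp)
  show ?thesis
    unfolding zonal_kernel_def[abs_def]
  proof (intro separable_sum separable_cmult)
    fix j assume "j \<in> {..d div 2}"
    then show "separable (homogeneous_polynomial d)
      (\<lambda>x y :: real ^ 'n. (of_real (x \<bullet> x) * of_real (y \<bullet> y)) ^ j * of_real (x \<bullet> y) ^ (d - 2 * j))"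
      using s2[of "d - 2 * j" j] by auto
  qed (rule homogeneous_polynomial_0)
qed

lemma homogeneous_polynomial_zonal_kernel:
  "homogeneous_polynomial d (\<lambda>x. zonal_kernel d x y)"
proof -
  have "homogeneous_polynomial d (\<lambda>x. F x y)" if "separable (homogeneous_polynomial d) F" for F
    using that
  proof induction
    case (separable_prod a b)
    then show ?case using homogeneous_polynomial_cmult[of d a "b y"] by (simp add: mult.commute)
  qed (rule homogeneous_polynomial_add)
  then show ?thesis using separable_zonal_kernel .
qed

section \<open>Harmonicity of the kernel\<close>

lemma partial_derivative_norm_power:
  "partial_derivative i (\<lambda>x. of_real (x \<bullet> x) ^ j) = (\<lambda>x. of_real (x $ i) * (2 * of_nat j * of_real (x \<bullet> x) ^ (j - 1)))"
proof (induction j)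
  case (Suc j)
  have 1: "partial_derivative i (\<lambda>x. of_real (x \<bullet> x)) = (\<lambda>x. 2 * of_real (x $ i))"
  proof -
    have eq: "(\<lambda>x. complex_of_real (x \<bullet> x)) = (\<lambda>x. \<Sum>k\<in>UNIV. of_real (x $ k) * of_real (x $ k))"
      by (simp add: inner_vec_def)
    show ?thesis
      unfolding eq
      by (simp add: partial_derivative_sum partial_derivative_mult mpoly_coord mpoly_mult sum.distrib
          if_distrib[of "\<lambda>z. z * _"] if_distrib[of "\<lambda>z. _ * z"] cong: if_cong)
  qed
  have "partial_derivative i (\<lambda>x. of_real (x \<bullet> x) * of_real (x \<bullet> x) ^ j)
      = (\<lambda>x. partial_derivative i (\<lambda>x. of_real (x \<bullet> x)) x * of_real (x \<bullet> x) ^ j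
         + of_real (x \<bullet> x) * partial_derivative i (\<lambda>x. of_real (x \<bullet> x) ^ j) x)"
    by (rule partial_derivative_mult) auto
  also have "\<dots> = (\<lambda>x. of_real (x $ i) * (2 * of_nat (Suc j) * of_real (x \<bullet> x) ^ (Suc j - 1)))"
    unfolding Suc.IH 1 by (cases j) (simp_all add: fun_eq_iff algebra_simps)
  finally show ?case by simp
qed simp

lemma laplacian_norm_power:
  "laplacian (\<lambda>x :: real ^ 'n. of_real (x \<bullet> x) ^ j) x
    = 2 * of_nat j * (2 * of_nat j - 2 + of_nat CARD('n)) * of_real (x \<bullet> x) ^ (j - 1)"
proof (cases j)
  case 0
  then show ?thesis by (simp add: laplacian_def)
next
  case (Suc m)
  have "partial_derivative i (\<lambda>x :: real ^ 'n. of_real (x $ i) * (2 * of_nat j * of_real (x \<bullet> x) ^ m)) x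
      = 2 * of_nat j * (of_real (x \<bullet> x) ^ m + of_real (x $ i) * of_real (x $ i) * (2 * of_nat m * of_real (x \<bullet> x) ^ (m - 1)))" for i
  proof -
    have m: "mpoly (\<lambda>x :: real ^ 'n. of_real (x \<bullet> x) ^ m)" by auto
    show ?thesis
      unfolding partial_derivative_mult[OF mpoly_coord mpoly_cmult[OF m]] partial_derivative_cmult[OF m]
        partial_derivative_norm_power partial_derivative_coord
      by (simp add: distrib_left)
  qed
  then have "laplacian (\<lambda>x :: real ^ 'n. of_real (x \<bullet> x) ^ j) x = (\<Sum>i\<in>(UNIV :: 'n set). 2 * of_nat j * (of_real (x \<bullet> x) ^ m + of_real (x $ i) * of_real (x $ i) * (2 * of_nat m * of_real (x \<bullet> x) ^ (m - 1))))"
    unfolding laplacian_def partial_derivative_norm_power using Suc by simp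
  also have "\<dots> = 2 * of_nat j * (of_nat CARD('n) * of_real (x \<bullet> x) ^ m + of_real (x \<bullet> x) * (2 * of_nat m * of_real (x \<bullet> x) ^ (m - 1)))"
    by (simp only: sum.distrib flip: sum_distrib_left sum_distrib_right sum_of_real_square) simp
  also have "\<dots> = 2 * of_nat j * (2 * of_nat j - 2 + of_nat CARD('n)) * of_real (x \<bullet> x) ^ (j - 1)"
    using Suc by (cases m) (simp_all add: algebra_simps)
  finally show ?thesis .
qed

text \<open>The mixed gradient term is a multiple of the Euler operator applied to \<open>p\<close>;
  this is where the degree \<open>k\<close> enters.\<close>

lemma laplacian_norm_power_mult:
  fixes p :: "real ^ 'n \<Rightarrow> complex"
  assumes p: "mpoly p" "scaling k p"
  shows "laplacian (\<lambda>x. of_real (x \<bullet> x) ^ j * p x) x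
    = 2 * of_nat j * (2 * of_nat j - 2 + of_nat CARD('n) + 2 * of_nat k) * of_real (x \<bullet> x) ^ (j - 1) * p x
      + of_real (x \<bullet> x) ^ j * laplacian p x"
proof -
  have m: "mpoly (\<lambda>x :: real ^ 'n. of_real (x \<bullet> x) ^ j)" by auto
  have "(\<Sum>i\<in>UNIV. partial_derivative i (\<lambda>x :: real ^ 'n. of_real (x \<bullet> x) ^ j) x * partial_derivative i p x)
      = (2 * of_nat j * of_real (x \<bullet> x) ^ (j - 1)) * directional x p x"
    unfolding partial_derivative_norm_power directional_def sum_distrib_left by (simp add: mult_ac)
  then show ?thesis
    unfolding laplacian_mult[OF m p(1)] laplacian_norm_power euler_identity[OF p] by (simp add: algebra_simps)
qed

text \<open>The sum telescopes. The j-th term contributes \<open>A j\<close> from the power of |x|^2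
  and \<open>B j\<close> from the power of x . y, and \<open>B j\<close> cancels
  \<open>A (Suc j)\<close> by the coefficient recursion. \<open>A 0\<close> is zero, and the last
  \<open>B\<close> vanishes because its exponent of x . y is 0 or 1.\<close>

lemma laplacian_zonal_kernel:
  fixes x y :: "real ^ 'n"
  assumes n: "CARD('n) \<ge> 3"
  shows "laplacian (\<lambda>x. zonal_kernel d x y) x = 0"
proof -
  define n where "n = CARD('n)"
  define u v s :: complex where "u = of_real (x \<bullet> x)" and "v = of_real (y \<bullet> y)" and "s = of_real (x \<bullet> y)"
  define c where "c j = coeff (zonal_poly n d) (d - 2 * j)" for j
  define A where "A j = of_real (c j) * v ^ j * (2 * of_nat j * (2 * of_nat j - 2 + of_nat n + 2 * of_nat (d - 2 * j)) * u ^ (j - 1) * s ^ (d - 2 * j))" for j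
  define B where "B j = of_real (c j) * v ^ j * (u ^ j * (of_nat ((d - 2 * j) * (d - 2 * j - 1)) * v * s ^ (d - 2 * j - 2)))" for j
  have m: "mpoly (\<lambda>x :: real ^ 'n. of_real (x \<bullet> x) ^ j * of_real (x \<bullet> y) ^ k)" for j k
    by (intro mpoly_mult mpoly_power mpoly_inner mpoly_inner_self)
  have "laplacian (\<lambda>x. of_real (c j) * v ^ j * (of_real (x \<bullet> x) ^ j * of_real (x \<bullet> y) ^ (d - 2 * j))) x = A j + B j" for j
  proof -
    have sc: "scaling (d - 2 * j) (\<lambda>x :: real ^ 'n. complex_of_real (x \<bullet> y) ^ (d - 2 * j))"
      using scaling_inner_power[of "d - 2 * j" y] by (simp add: inner_commute)
    have l: "laplacian (\<lambda>x :: real ^ 'n. complex_of_real (x \<bullet> y) ^ k) x = of_nat (k * (k - 1)) * v * s ^ (k - 2)" for k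
      using laplacian_inner_power[of y k x] by (simp add: inner_commute u_def v_def s_def)
    show ?thesis
      unfolding laplacian_cmult[OF m] laplacian_norm_power_mult[OF mpoly_power[OF mpoly_inner] sc] l
      by (simp add: A_def B_def u_def s_def n_def distrib_left)
  qed
  moreover have "(\<lambda>x. zonal_kernel d x y) = (\<lambda>x. \<Sum>j\<le>d div 2. of_real (c j) * v ^ j * (of_real (x \<bullet> x) ^ j * of_real (x \<bullet> y) ^ (d - 2 * j)))"
    by (simp add: zonal_kernel_def c_def v_def n_def power_mult_distrib mult_ac)
  ultimately have "laplacian (\<lambda>x. zonal_kernel d x y) x = (\<Sum>j\<le>d div 2. A j + B j)"
    by (simp add: laplacian_sum mpoly_cmult[OF m])
  also have "\<dots> = 0"
  proof -
    have step: "B j = - A (Suc j)" if "Suc j \<le> d div 2" for j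
    proof -
      define k where "k = d - 2 * Suc j"
      have k: "d - 2 * j = k + 2" "d = k + 2 * j + 2" using that by (auto simp: k_def)
      have "real ((k + 2) * (k + 1)) * c j = - (real (2 * Suc j) * (2 * real (Suc j) - 2 + real n + 2 * real k)) * c (Suc j)"
        using coeff_zonal_poly_rec[of k n d] unfolding c_def k(1) k_def[symmetric]
        by (simp add: k(2) algebra_simps)
      then have "complex_of_real (real ((k + 2) * (k + 1)) * c j)
          = complex_of_real (- (real (2 * Suc j) * (2 * real (Suc j) - 2 + real n + 2 * real k)) * c (Suc j))"
        by (rule arg_cong)
      then have e: "of_nat ((k + 2) * (k + 1)) * of_real (c j) = - (of_nat (2 * Suc j) * (2 * of_nat (Suc j) - 2 + of_nat n + 2 * of_nat k)) * (of_real (c (Suc j)) :: complex)"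
        by (simp only: of_real_mult of_real_minus of_real_add of_real_diff of_real_of_nat_eq of_real_numeral)
      have "B j = v ^ Suc j * u ^ j * s ^ k * (of_nat ((k + 2) * (k + 1)) * of_real (c j))"
        by (simp add: B_def k(1))
      also have "\<dots> = - A (Suc j)"
        unfolding e A_def k_def[symmetric] by simp
      finally show ?thesis .
    qed
    have last: "B (d div 2) = 0"
    proof -
      have "d - 2 * (d div 2) \<in> {0, 1}" by auto
      then show ?thesis by (auto simp: B_def)
    qed
    have "(\<Sum>j\<le>m. A j + B j) = B m" if "m \<le> d div 2" for m
      using that
    proof (induction m)
      case (Suc m)
      then show ?case using step[of m] by simp
    qed (simp add: A_def)
    then show ?thesis using last by simp
  qed
  finally show ?thesis .
qed

section \<open>Integrals of zonal functions\<close>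

text \<open>The eigenvalue of convolution with \<open>G\<close> on the harmonics of degree
  \<open>k\<close>.\<close>

definition fh_sum :: "nat \<Rightarrow> real poly \<Rightarrow> nat \<Rightarrow> real" where
  "fh_sum n G k = (\<Sum>j\<le>degree G. coeff G j * fh_coeff n j k)"

lemma mpoly_poly_inner [intro!]: "mpoly (\<lambda>y. of_real (poly G (x \<bullet> y)))"
  by (auto simp: poly_altdef)

theorem funk_hecke_poly:
  fixes h :: "real ^ 'n::{finite,wellorder} \<Rightarrow> complex"
  assumes "CARD('n) \<ge> 2" "norm x = 1" "mpoly h" "scaling k h" "\<And>y. laplacian h y = 0"
  shows "(LINT y|sphere_measure. of_real (poly G (x \<bullet> y)) * h y) = of_real (fh_sum CARD('n) G k) * h x"
proof -
  have i: "integrable sphere_measure (\<lambda>y. of_real (coeff G j) * (of_real (x \<bullet> y) ^ j * h y))" for j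
    using assms(3) by (intro integrable_sphere_mpoly) auto
  have "(LINT y|sphere_measure. of_real (poly G (x \<bullet> y)) * h y)
      = (LINT y|sphere_measure. (\<Sum>j\<le>degree G. of_real (coeff G j) * (of_real (x \<bullet> y) ^ j * h y)))"
    by (simp add: poly_altdef sum_distrib_right mult.assoc)
  also have "\<dots> = (\<Sum>j\<le>degree G. of_real (coeff G j) * (LINT y|sphere_measure. of_real (x \<bullet> y) ^ j * h y))"
    by (simp add: Bochner_Integration.integral_sum[OF i])
  also have "\<dots> = of_real (fh_sum CARD('n) G k) * h x"
    by (simp add: funk_hecke_power[OF assms] fh_sum_def sum_distrib_right mult.assoc)
  finally show ?thesis .
qed

text \<open>Powers below \<open>d\<close> are orthogonal to harmonics of degree \<open>d\<close>, so
  only the leading coefficient counts, and it was normalised against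
  \<open>fh_coeff n d d\<close>.\<close>

lemma fh_sum_zonal_poly:
  assumes n: "n \<ge> 3"
  shows "fh_sum n (zonal_poly n d) d = 1"
proof -
  let ?z = "zonal_poly n d"
  have pos: "(2 * real m + real n - 2) / real m \<noteq> 0" if "m \<in> {1..d}" for m
    using that n by auto
  then have "coeff ?z d \<noteq> 0" unfolding coeff_zonal_poly_top[OF n] by simp
  then have deg: "degree ?z = d" using degree_zonal_poly[of n d] le_degree[of ?z d] by simp
  have "fh_sum n ?z d = (\<Sum>j\<in>{d}. coeff ?z j * fh_coeff n j d)"
    unfolding fh_sum_def deg by (rule sum.mono_neutral_right) (auto simp: fh_coeff_eq_0)
  also have "\<dots> = coeff ?z d * fh_coeff n d d" by simp
  also have "\<dots> = (\<Prod>m=1..d. (2 * real m + real n - 2) / real m * (real m / (2 * real m + real n - 2)))"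
    unfolding coeff_zonal_poly_top[OF n] prod.distrib using n by (subst fh_coeff_diag) auto
  also have "\<dots> = 1" using n by (intro prod.neutral) auto
  finally show ?thesis .
qed

theorem zonal_kernel_reproducing:
  fixes h :: "real ^ 'n::{finite,wellorder} \<Rightarrow> complex"
  assumes n: "CARD('n) \<ge> 3" and x: "norm x = 1" and h: "homogeneous_polynomial d h" "\<And>y. laplacian h y = 0"
  shows "(LINT y|sphere_measure. zonal_kernel d x y * h y) = h x"
proof -
  note m = mpoly_homogeneous_polynomial[OF h(1)]
  have mk: "mpoly (zonal_kernel d x)"
    using separable_mpoly_right[OF separable_zonal_kernel] .
  have "(LINT y|sphere_measure. zonal_kernel d x y * h y)
      = (LINT y|sphere_measure. of_real (poly (zonal_poly CARD('n) d) (x \<bullet> y)) * h y)"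
  proof (rule integral_cong_AE)
    show "(\<lambda>y. zonal_kernel d x y * h y) \<in> borel_measurable sphere_measure"
      by (rule borel_measurable_integrable) (use m mk in auto)
    show "(\<lambda>y. of_real (poly (zonal_poly CARD('n) d) (x \<bullet> y)) * h y) \<in> borel_measurable sphere_measure"
      by (rule borel_measurable_integrable) (use m in auto)
    show "AE y in sphere_measure. zonal_kernel d x y * h y = of_real (poly (zonal_poly CARD('n) d) (x \<bullet> y)) * h y"
      using AE_sphere_measure by eventually_elim (simp add: zonal_kernel_sphere[OF n x])
  qed
  also have "\<dots> = h x"
    using n by (subst funk_hecke_poly[OF _ x m h(2)]) (simp_all add: fh_sum_zonal_poly)
  finally show ?thesis .
qed

text \<open>For \<alpha> = (n - 3) / 2 this is, up to its total mass, the distribution of x . y when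
  x is a fixed unit vector and y is uniform on the sphere of dimension n - 1.\<close>

definition jacobi_measure :: "real \<Rightarrow> real measure" where
  "jacobi_measure \<alpha> = density lborel (\<lambda>t. ennreal (indicator {-1..1} t * (1 - t\<^sup>2) powr \<alpha>))"

lemma sets_jacobi_measure [simp, measurable_cong]: "sets (jacobi_measure \<alpha>) = sets borel"
  by (simp add: jacobi_measure_def)

lemma space_jacobi_measure [simp]: "space (jacobi_measure \<alpha>) = UNIV"
  by (simp add: jacobi_measure_def)

lemma abs_le_1_square: "t \<in> {-1..1} \<Longrightarrow> 0 \<le> 1 - t\<^sup>2 \<and> 1 - t\<^sup>2 \<le> (1 :: real)"
  by (auto simp: abs_square_le_1 abs_le_iff)

lemma finite_measure_jacobi_measure:
  assumes "\<alpha> \<ge> 0"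
  shows "finite_measure (jacobi_measure \<alpha>)"
proof
  have "emeasure (jacobi_measure \<alpha>) (space (jacobi_measure \<alpha>))
      = (\<integral>\<^sup>+t. ennreal (indicator {-1..1} t * (1 - t\<^sup>2) powr \<alpha>) \<partial>lborel)"
    unfolding jacobi_measure_def by (subst emeasure_density) auto
  also have "\<dots> \<le> (\<integral>\<^sup>+t. indicator {-1..1::real} t \<partial>lborel)"
  proof (rule nn_integral_mono)
    fix t :: real
    show "ennreal (indicator {-1..1} t * (1 - t\<^sup>2) powr \<alpha>) \<le> indicator {-1..1} t"
    proof (cases "t \<in> {-1..1}")
      case True
      then have "(1 - t\<^sup>2) powr \<alpha> \<le> 1"
        using abs_le_1_square[OF True] assms by (intro powr_le1) auto
      then show ?thesis using True by simp
    qed simp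
  qed
  also have "\<dots> < \<infinity>" by simp
  finally show "emeasure (jacobi_measure \<alpha>) (space (jacobi_measure \<alpha>)) \<noteq> \<infinity>" by simp
qed

lemma AE_jacobi_measure: "AE t in jacobi_measure \<alpha>. t \<in> {-1..1}"
  unfolding jacobi_measure_def by (subst AE_density) (auto split: split_indicator)

lemma integrable_jacobi_measure [intro]:
  fixes f :: "real \<Rightarrow> real"
  assumes "\<alpha> \<ge> 0" "continuous_on UNIV f"
  shows "integrable (jacobi_measure \<alpha>) f"
proof -
  interpret finite_measure "jacobi_measure \<alpha>" using assms(1) by (rule finite_measure_jacobi_measure)
  have "bounded (f ` {-1..1})"
    by (intro compact_imp_bounded compact_continuous_image continuous_on_subset[OF assms(2)]) auto
  then obtain B where B: "\<And>t. t \<in> {-1..1} \<Longrightarrow> norm (f t) \<le> B" unfolding bounded_iff by blast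
  have "AE t in jacobi_measure \<alpha>. norm (f t) \<le> B"
    using AE_jacobi_measure by eventually_elim (rule B)
  moreover have "f \<in> borel_measurable (jacobi_measure \<alpha>)"
    using borel_measurable_continuous_onI[OF assms(2)] by (simp cong: measurable_cong_sets)
  ultimately show ?thesis by (rule integrable_const_bound)
qed

lemma integral_jacobi_measure:
  fixes f :: "real \<Rightarrow> real"
  assumes "continuous_on UNIV f"
  shows "(LINT t|jacobi_measure \<alpha>. f t) = (LBINT t:{-1..1}. f t * (1 - t\<^sup>2) powr \<alpha>)"
  unfolding jacobi_measure_def set_lebesgue_integral_def
  using borel_measurable_continuous_onI[OF assms]
  by (subst integral_density) (auto simp: mult_ac)

text \<open>Passes from the gauge integral, in which the fundamental theorem and the Beta integral
  are available, to the Lebesgue integral.\<close>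

lemma jacobi_measure_eqI:
  fixes f :: "real \<Rightarrow> real"
  assumes "\<alpha> \<ge> 0" "continuous_on UNIV f" "((\<lambda>t. f t * (1 - t\<^sup>2) powr \<alpha>) has_integral I) {-1..1}"
  shows "(LINT t|jacobi_measure \<alpha>. f t) = I"
proof -
  have "integrable lborel (\<lambda>t. indicator {-1..1} t * (1 - t\<^sup>2) powr \<alpha> * f t)"
    using integrable_jacobi_measure[OF assms(1,2)] borel_measurable_continuous_onI[OF assms(2)]
    unfolding jacobi_measure_def by (subst (asm) integrable_density) auto
  then have "set_integrable lborel {-1..1} (\<lambda>t. f t * (1 - t\<^sup>2) powr \<alpha>)"
    by (simp add: set_integrable_def mult_ac)
  from set_borel_integral_eq_integral(2)[OF this] show ?thesis
    using assms(3) integral_jacobi_measure[OF assms(2)] by (simp add: integral_unique)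
qed

lemma continuous_on_weight: "\<alpha> > 0 \<Longrightarrow> continuous_on {-1..1} (\<lambda>t::real. (1 - t\<^sup>2) powr \<alpha>)"
  using abs_le_1_square by (intro continuous_on_powr') (auto intro!: continuous_intros)

text \<open>The boundary terms vanish because the exponent \<alpha> + 1 is positive.
  Differentiability is asked for in the interior only, since the weight may fail to be
  differentiable at the endpoints.\<close>

lemma jacobi_measure_ftc:
  assumes "\<alpha> \<ge> 0"
    and "\<And>t. t \<in> {-1<..<1} \<Longrightarrow> ((\<lambda>t. F t * (1 - t\<^sup>2) powr (\<alpha> + 1)) has_real_derivative f t * (1 - t\<^sup>2) powr \<alpha>) (at t)"
    and "continuous_on UNIV F" "continuous_on UNIV f"
  shows "(LINT t|jacobi_measure \<alpha>. f t) = 0"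
proof (rule jacobi_measure_eqI[OF assms(1,4)])
  have "((\<lambda>t. f t * (1 - t\<^sup>2) powr \<alpha>) has_integral
      F 1 * (1 - 1\<^sup>2) powr (\<alpha> + 1) - F (-1) * (1 - (-1)\<^sup>2) powr (\<alpha> + 1)) {-1..1}"
    using assms
    by (intro fundamental_theorem_of_calculus_interior continuous_on_mult continuous_on_weight)
      (auto simp: has_real_derivative_iff_has_vector_derivative intro: continuous_on_subset)
  then show "((\<lambda>t. f t * (1 - t\<^sup>2) powr \<alpha>) has_integral 0) {-1..1}" by simp
qed

lemma weight_derivative:
  assumes "t \<in> {-1<..<1::real}"
  shows "((\<lambda>t. (1 - t\<^sup>2) powr (\<alpha> + 1)) has_real_derivative (\<alpha> + 1) * (1 - t\<^sup>2) powr \<alpha> * (- 2 * t)) (at t)"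
proof -
  have "1 - t\<^sup>2 > 0" using assms by (simp add: abs_square_less_1 abs_less_iff)
  moreover have "((\<lambda>t. 1 - t\<^sup>2) has_field_derivative - 2 * t) (at t)"
    by (auto intro!: derivative_eq_intros)
  ultimately show ?thesis using DERIV_fun_powr[of "\<lambda>t. 1 - t\<^sup>2" "- 2 * t" t "\<alpha> + 1"] by simp
qed

text \<open>Integrating the derivative of t^(j+1) (1 - t^2)^(\<alpha>+1) gives (j + 1) m_j = (j + n)
  m_(j+2), by j + 1 + 2 (\<alpha> + 1) = j + n. This is the recursion of
  \<open>fh_coeff n j 0\<close>; the first moment comes from the derivative of the weight
  itself.\<close>

lemma jacobi_measure_moment:
  assumes n: "n \<ge> 3" and \<alpha>: "\<alpha> = (real n - 3) / 2"
  shows "(LINT t|jacobi_measure \<alpha>. t ^ j) = fh_coeff n j 0 * measure (jacobi_measure \<alpha>) UNIV"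
proof (induction j rule: induct_nat_012)
  case 0
  interpret finite_measure "jacobi_measure \<alpha>" by (rule finite_measure_jacobi_measure) (use n \<alpha> in simp)
  show ?case by (simp add: fh_coeff.simps)
next
  have a: "\<alpha> \<ge> 0" using n \<alpha> by simp
  case 1
  have "(LINT t|jacobi_measure \<alpha>. (\<alpha> + 1) * (- 2 * t)) = 0"
  proof (rule jacobi_measure_ftc[where F = "\<lambda>_. 1", OF a])
    fix t :: real assume "t \<in> {-1<..<1}"
    from weight_derivative[OF this, of \<alpha>]
    show "((\<lambda>t. 1 * (1 - t\<^sup>2) powr (\<alpha> + 1)) has_real_derivative (\<alpha> + 1) * (- 2 * t) * (1 - t\<^sup>2) powr \<alpha>) (at t)"
      unfolding mult_1_left by (rule DERIV_cong) (simp only: mult_ac)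
  qed (auto intro!: continuous_intros)
  then show ?case using a fh_coeff_1_0 by simp
next
  have a: "\<alpha> \<ge> 0" using n \<alpha> by simp
  case (ge2 j)
  have "(LINT t|jacobi_measure \<alpha>. (real j + 1) * t ^ j - (real j + real n) * t ^ Suc (Suc j)) = 0"
  proof (rule jacobi_measure_ftc[where F = "\<lambda>t. t ^ Suc j", OF a])
    fix t :: real assume t: "t \<in> {-1<..<1}"
    then have t1: "1 - t\<^sup>2 > 0" by (simp add: abs_square_less_1 abs_less_iff)
    have p: "(1 - t\<^sup>2) powr (\<alpha> + 1) = (1 - t\<^sup>2) powr \<alpha> * (1 - t\<^sup>2)" using t1 by (simp add: powr_add)
    have "((\<lambda>t. t ^ Suc j) has_real_derivative (real j + 1) * t ^ j) (at t)"
      using DERIV_pow[of "Suc j" t] by (simp add: add.commute)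
    from DERIV_mult[OF this weight_derivative[OF t, of \<alpha>]]
    have "((\<lambda>t. t ^ Suc j * (1 - t\<^sup>2) powr (\<alpha> + 1)) has_real_derivative
       (real j + 1) * t ^ j * (1 - t\<^sup>2) powr (\<alpha> + 1) + (\<alpha> + 1) * (1 - t\<^sup>2) powr \<alpha> * (- 2 * t) * t ^ Suc j) (at t)" .
    also have "(real j + 1) * t ^ j * (1 - t\<^sup>2) powr (\<alpha> + 1) + (\<alpha> + 1) * (1 - t\<^sup>2) powr \<alpha> * (- 2 * t) * t ^ Suc j
       = ((real j + 1) * t ^ j - (real j + 1 + 2 * (\<alpha> + 1)) * t ^ Suc (Suc j)) * (1 - t\<^sup>2) powr \<alpha>"
      unfolding p by (simp add: algebra_simps power2_eq_square)
    also have "real j + 1 + 2 * (\<alpha> + 1) = real j + real n" by (simp add: \<alpha> field_simps)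
    finally show "((\<lambda>t. t ^ Suc j * (1 - t\<^sup>2) powr (\<alpha> + 1)) has_real_derivative
       ((real j + 1) * t ^ j - (real j + real n) * t ^ Suc (Suc j)) * (1 - t\<^sup>2) powr \<alpha>) (at t)" .
  qed (auto intro!: continuous_intros)
  moreover have "(LINT t|jacobi_measure \<alpha>. (real j + 1) * t ^ j - (real j + real n) * t ^ Suc (Suc j))
     = (real j + 1) * (LINT t|jacobi_measure \<alpha>. t ^ j) - (real j + real n) * (LINT t|jacobi_measure \<alpha>. t ^ Suc (Suc j))"
    by (subst Bochner_Integration.integral_diff) (auto intro!: integrable_jacobi_measure a continuous_intros)
  ultimately have "(real j + real n) * (LINT t|jacobi_measure \<alpha>. t ^ Suc (Suc j))
      = (real j + 1) * (fh_coeff n j 0 * measure (jacobi_measure \<alpha>) UNIV)"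
    using ge2 by simp
  then have "(LINT t|jacobi_measure \<alpha>. t ^ Suc (Suc j))
      = (real j + 1) * (fh_coeff n j 0 * measure (jacobi_measure \<alpha>) UNIV) / (real j + real n)"
    using n by (simp add: eq_divide_eq mult.commute)
  then show ?case using n by (simp add: fh_coeff_Suc_Suc_0)
qed

lemma jacobi_measure_poly:
  assumes n: "n \<ge> 3" and \<alpha>: "\<alpha> = (real n - 3) / 2"
  shows "(LINT t|jacobi_measure \<alpha>. poly G t) = fh_sum n G 0 * measure (jacobi_measure \<alpha>) UNIV"
proof -
  have "integrable (jacobi_measure \<alpha>) (\<lambda>t. coeff G j * t ^ j)" for j
    using n \<alpha> by (intro integrable_jacobi_measure continuous_intros) auto
  then have "(LINT t|jacobi_measure \<alpha>. poly G t) = (\<Sum>j\<le>degree G. coeff G j * (LINT t|jacobi_measure \<alpha>. t ^ j))"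
    unfolding poly_altdef by (simp add: Bochner_Integration.integral_sum)
  then show ?thesis
    unfolding jacobi_measure_moment[OF assms] fh_sum_def by (simp add: sum_distrib_right mult.assoc)
qed

section \<open>Zonal integrals in one variable\<close>

lemma weierstrass_poly:
  fixes f :: "real \<Rightarrow> real"
  assumes "continuous_on {-1..1} f" "e > 0"
  obtains G where "\<And>t. t \<in> {-1..1} \<Longrightarrow> \<bar>f t - poly G t\<bar> < e"
proof -
  obtain g where g: "real_polynomial_function g" "\<And>t. t \<in> {-1..1} \<Longrightarrow> \<bar>f t - g t\<bar> < e"
    using Stone_Weierstrass_real_polynomial_function[OF _ assms] by auto
  obtain a m where "g = (\<lambda>t. \<Sum>i\<le>m. a i * t ^ i)"
    using g(1) unfolding real_polynomial_function_iff_sum by blast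
  then have "g t = poly (\<Sum>i\<le>m. Polynomial.monom (a i) i) t" for t
    by (simp add: poly_sum poly_monom)
  then show thesis using that g(2) by metis
qed

text \<open>The Funk-Hecke formula with the constant harmonic 1 of degree 0.\<close>

lemma sphere_integral_poly:
  fixes x :: "real ^ 'n::{finite,wellorder}"
  assumes n: "CARD('n) \<ge> 2" and x: "norm x = 1"
  shows "(LINT y|sphere_measure. poly G (x \<bullet> y)) = fh_sum CARD('n) G 0"
proof -
  have "(LINT y|sphere_measure. complex_of_real (poly G (x \<bullet> y)) * 1) = of_real (fh_sum CARD('n) G 0) * 1"
    by (rule funk_hecke_poly[OF n x]) (auto simp: scaling_def laplacian_def)
  then have "(LINT y|sphere_measure. complex_of_real (poly G (x \<bullet> y))) = of_real (fh_sum CARD('n) G 0)" by simp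
  then show ?thesis by (simp only: integral_complex_of_real of_real_eq_iff)
qed

text \<open>Both sides have the same moments, so they agree on polynomials; Weierstrass
  approximation on [-1, 1] extends this to continuous functions. No coordinates on the sphere are
  introduced.\<close>

theorem sphere_integral_zonal:
  fixes x :: "real ^ 'n::{finite,wellorder}"
  assumes n: "CARD('n) \<ge> 3" and \<alpha>: "\<alpha> = (real CARD('n) - 3) / 2" and x: "norm x = 1"
    and f: "continuous_on UNIV f"
  shows "measure (jacobi_measure \<alpha>) UNIV * (LINT y|sphere_measure. f (x \<bullet> y)) = (LINT t|jacobi_measure \<alpha>. f t)"
proof -
  interpret S: prob_space "sphere_measure :: (real ^ 'n::{finite,wellorder}) measure" by (rule prob_space_sphere_measure)
  have a: "\<alpha> \<ge> 0" using n \<alpha> by simp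
  interpret J: finite_measure "jacobi_measure \<alpha>" by (rule finite_measure_jacobi_measure[OF a])
  define m where "m = measure (jacobi_measure \<alpha>) UNIV"
  have m: "m \<ge> 0" by (simp add: m_def)
  have inner: "x \<bullet> y \<in> {-1..1}" if "y \<in> sphere 0 1" for y
    using Cauchy_Schwarz_ineq2[of x y] x that by (auto simp: abs_le_iff)
  have cont: "continuous_on UNIV (\<lambda>y. g (x \<bullet> y))" if "continuous_on UNIV g" for g :: "real \<Rightarrow> real"
    by (rule continuous_on_compose2[OF that]) (auto intro!: continuous_intros)
  have "\<bar>m * (LINT y|sphere_measure. f (x \<bullet> y)) - (LINT t|jacobi_measure \<alpha>. f t)\<bar> \<le> e * (2 * m)" if e: "e > 0" for e
  proof -
    obtain G where G: "\<And>t. t \<in> {-1..1} \<Longrightarrow> \<bar>f t - poly G t\<bar> < e"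
      using weierstrass_poly[OF continuous_on_subset[OF f] e] by auto
    have cG: "continuous_on UNIV (poly G)" by (intro continuous_intros)
    have "\<bar>(LINT y|sphere_measure. f (x \<bullet> y)) - (LINT y|sphere_measure. poly G (x \<bullet> y))\<bar>
       = \<bar>LINT y|sphere_measure. f (x \<bullet> y) - poly G (x \<bullet> y)\<bar>"
      by (subst Bochner_Integration.integral_diff) (auto intro!: integrable_sphere_measure cont f cG)
    also have "\<dots> \<le> (LINT y|sphere_measure. \<bar>f (x \<bullet> y) - poly G (x \<bullet> y)\<bar>)"
      by (rule integral_abs_bound)
    also have "\<dots> \<le> (LINT y|(sphere_measure :: (real ^ 'n::{finite,wellorder}) measure). e)"
    proof (rule integral_mono_AE)
      show "AE y in sphere_measure. \<bar>f (x \<bullet> y) - poly G (x \<bullet> y)\<bar> \<le> e"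
        using AE_sphere_measure by eventually_elim (use G inner in \<open>auto intro: less_imp_le\<close>)
    qed (auto intro!: integrable_sphere_measure continuous_intros cont f cG)
    also have "\<dots> = e" using S.prob_space by simp
    finally have 1: "\<bar>(LINT y|sphere_measure. f (x \<bullet> y)) - fh_sum CARD('n) G 0\<bar> \<le> e"
      using sphere_integral_poly[of x G] n x by simp
    have "\<bar>(LINT t|jacobi_measure \<alpha>. f t) - (LINT t|jacobi_measure \<alpha>. poly G t)\<bar>
       = \<bar>LINT t|jacobi_measure \<alpha>. f t - poly G t\<bar>"
      by (subst Bochner_Integration.integral_diff) (auto intro!: integrable_jacobi_measure a f cG)
    also have "\<dots> \<le> (LINT t|jacobi_measure \<alpha>. \<bar>f t - poly G t\<bar>)"
      by (rule integral_abs_bound)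
    also have "\<dots> \<le> (LINT t|jacobi_measure \<alpha>. e)"
    proof (rule integral_mono_AE)
      show "AE t in jacobi_measure \<alpha>. \<bar>f t - poly G t\<bar> \<le> e"
        using AE_jacobi_measure by eventually_elim (use G in \<open>auto intro: less_imp_le\<close>)
    qed (auto intro!: integrable_jacobi_measure a continuous_intros f cG)
    also have "\<dots> = e * m" by (simp add: m_def)
    finally have 2: "\<bar>(LINT t|jacobi_measure \<alpha>. f t) - m * fh_sum CARD('n) G 0\<bar> \<le> e * m"
      using jacobi_measure_poly[OF n \<alpha>, of G] by (simp add: m_def mult.commute)
    have "\<bar>m * (LINT y|sphere_measure. f (x \<bullet> y)) - m * fh_sum CARD('n) G 0\<bar> \<le> m * e"
      using mult_left_mono[OF 1 m] m by (simp add: abs_mult flip: right_diff_distrib)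
    with 2 show ?thesis by (simp add: algebra_simps)
  qed
  note bound = this
  have "\<bar>m * (LINT y|sphere_measure. f (x \<bullet> y)) - (LINT t|jacobi_measure \<alpha>. f t)\<bar> \<le> 0"
  \<comment> \<open>The error bound is \<open>e * (2 * m)\<close>; to make it arbitrary one divides
    by \<open>m\<close>.\<close>
  proof (cases "m = 0")
    case False
    show ?thesis
    proof (rule field_le_epsilon)
      fix e :: real assume "e > 0"
      then show "\<bar>m * (LINT y|sphere_measure. f (x \<bullet> y)) - (LINT t|jacobi_measure \<alpha>. f t)\<bar> \<le> 0 + e"
        using bound[of "e / (2 * m)"] False m by simp
    qed
  next
    case True
    then show ?thesis using bound[of 1] by simp
  qed
  then show ?thesis by (simp add: m_def)
qed

text \<open>Substituting s = (t + 1) / 2 turns 1 - t^2 into 4 s (1 - s) and the mass into a Beta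
  integral.\<close>

lemma measure_jacobi_measure:
  assumes "\<alpha> \<ge> 0"
  shows "measure (jacobi_measure \<alpha>) UNIV = 2 powr (2 * \<alpha> + 1) * Beta (\<alpha> + 1) (\<alpha> + 1)"
proof -
  interpret finite_measure "jacobi_measure \<alpha>" by (rule finite_measure_jacobi_measure[OF assms])
  have "((\<lambda>t. t powr \<alpha> * (1 - t) powr \<alpha>) has_integral Beta (\<alpha> + 1) (\<alpha> + 1)) (cbox 0 1)"
    using has_integral_Beta_real[of "\<alpha> + 1" "\<alpha> + 1"] assms by simp
  from has_integral_affinity'[OF this, of "1/2" "1/2"]
  have "((\<lambda>t. (t / 2 + 1 / 2) powr \<alpha> * (1 - (t / 2 + 1 / 2)) powr \<alpha>) has_integral 2 * Beta (\<alpha> + 1) (\<alpha> + 1)) {-1..1}"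
    by (simp add: mult.commute)
  from has_integral_mult_right[OF this, of "4 powr \<alpha>"]
  have "((\<lambda>t. 4 powr \<alpha> * ((t / 2 + 1 / 2) powr \<alpha> * (1 - (t / 2 + 1 / 2)) powr \<alpha>)) has_integral
      4 powr \<alpha> * (2 * Beta (\<alpha> + 1) (\<alpha> + 1))) {-1..1}" .
  moreover have "4 powr \<alpha> * ((t / 2 + 1 / 2) powr \<alpha> * (1 - (t / 2 + 1 / 2)) powr \<alpha>) = 1 * (1 - t\<^sup>2) powr \<alpha>"
    if "t \<in> {-1..1}" for t :: real
  proof -
    have "1 - t\<^sup>2 = 4 * ((t / 2 + 1 / 2) * (1 - (t / 2 + 1 / 2)))" by (simp add: field_simps power2_eq_square)
    then show ?thesis using that by (simp add: powr_mult)
  qed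
  ultimately have "((\<lambda>t. 1 * (1 - t\<^sup>2) powr \<alpha>) has_integral 4 powr \<alpha> * (2 * Beta (\<alpha> + 1) (\<alpha> + 1))) {-1..1}"
    by (rule has_integral_eq[rotated])
  from jacobi_measure_eqI[OF assms _ this]
  have "measure (jacobi_measure \<alpha>) UNIV = 4 powr \<alpha> * (2 * Beta (\<alpha> + 1) (\<alpha> + 1))" by simp
  moreover have "(2::real) powr (2 * \<alpha> + 1) = 4 powr \<alpha> * 2"
    by (simp add: powr_add powr_powr[symmetric] flip: powr_numeral)
  ultimately show ?thesis by simp
qed

section \<open>The Hahn--Banach theorem\<close>

text \<open>The functionals below are all defined as infima; this lemma and the next reduce their
  sublinearity to a comparison of elements.\<close>

lemma cInf_add_le:
  fixes A B C :: "real set"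
  assumes "A \<noteq> {}" "B \<noteq> {}" "bdd_below C" "\<And>a b. a \<in> A \<Longrightarrow> b \<in> B \<Longrightarrow> \<exists>c\<in>C. c \<le> a + b"
  shows "Inf C \<le> Inf A + Inf B"
proof -
  have 1: "Inf C \<le> a + b" if "a \<in> A" "b \<in> B" for a b
    using assms(4)[OF that] cInf_lower[OF _ assms(3)] by force
  have "Inf C - b \<le> Inf A" if "b \<in> B" for b
    by (rule cInf_greatest[OF assms(1)]) (use 1 that in \<open>force simp: diff_le_eq\<close>)
  then have "Inf C - Inf A \<le> Inf B"
    by (intro cInf_greatest[OF assms(2)]) (force simp: diff_le_eq add.commute)
  then show ?thesis by simp
qed

lemma cInf_scale_le:
  fixes A C :: "real set"
  assumes "A \<noteq> {}" "bdd_below C" "t > 0" "\<And>a. a \<in> A \<Longrightarrow> \<exists>c\<in>C. c \<le> t * a"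
  shows "Inf C \<le> t * Inf A"
proof -
  have "Inf C / t \<le> Inf A"
  proof (rule cInf_greatest[OF assms(1)])
    fix a assume "a \<in> A"
    then obtain c where "c \<in> C" "c \<le> t * a" using assms(4) by blast
    then have "Inf C \<le> t * a" using cInf_lower[OF _ assms(2)] by force
    then show "Inf C / t \<le> a" using assms(3) by (simp add: field_simps)
  qed
  then show ?thesis using assms(3) by (simp add: field_simps)
qed

section \<open>Complex modules and sublinear functionals\<close>

lemma complex_field_simps [simp]:
  "carrier complex_field = UNIV" "a \<oplus>\<^bsub>complex_field\<^esub> b = a + b" "a \<otimes>\<^bsub>complex_field\<^esub> b = a * b"
  "\<one>\<^bsub>complex_field\<^esub> = 1" "\<zero>\<^bsub>complex_field\<^esub> = 0"
  by (simp_all add: complex_field_def)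

text \<open>Stated for \<open>module_scheme\<close> because it is instantiated both with normed
  spaces and with a module of vector-valued functions that has no norm field.\<close>

locale complex_module = Module.module complex_field V for V :: "(complex, 'v, 'z) module_scheme" (structure)
begin

lemma scale_closed [simp]: "x \<in> carrier V \<Longrightarrow> c \<odot> x \<in> carrier V"
  using smult_closed[of c x] by simp

lemma scale_add_left: "x \<in> carrier V \<Longrightarrow> (a + b) \<odot> x = a \<odot> x \<oplus> b \<odot> x"
  using smult_l_distr[of a b x] by simp

lemma scale_add_right: "x \<in> carrier V \<Longrightarrow> y \<in> carrier V \<Longrightarrow> a \<odot> (x \<oplus> y) = a \<odot> x \<oplus> a \<odot> y"
  using smult_r_distr[of a x y] by simp

lemma scale_scale: "x \<in> carrier V \<Longrightarrow> a \<odot> (b \<odot> x) = (a * b) \<odot> x"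
  using smult_assoc1[of a b x] by simp

lemma scale_one [simp]: "x \<in> carrier V \<Longrightarrow> 1 \<odot> x = x"
  using smult_one[of x] by simp

lemma scale_zero [simp]: "x \<in> carrier V \<Longrightarrow> 0 \<odot> x = \<zero>"
  using smult_l_null[of x] by simp

lemma scale_minus_one: "x \<in> carrier V \<Longrightarrow> (- 1) \<odot> x = \<ominus> x"
  using scale_add_left[of x "- 1" 1] M.minus_equality[of "(- 1) \<odot> x" x] by simp

text \<open>Homogeneity is required only as an inequality for positive \<open>t\<close>, which is
  easy to check for infima; \<open>sublinear_scale\<close> recovers the equality by also scaling
  with 1 / t.\<close>

definition sublinear :: "('v \<Rightarrow> real) \<Rightarrow> bool" where
  "sublinear p \<longleftrightarrow> (\<forall>x\<in>carrier V. \<forall>y\<in>carrier V. p (x \<oplus> y) \<le> p x + p y) \<and>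
     (\<forall>t>0. \<forall>x\<in>carrier V. p (of_real t \<odot> x) \<le> t * p x)"

lemma sublinear_add: "sublinear p \<Longrightarrow> x \<in> carrier V \<Longrightarrow> y \<in> carrier V \<Longrightarrow> p (x \<oplus> y) \<le> p x + p y"
  by (simp add: sublinear_def)

lemma sublinear_zero:
  assumes "sublinear p" shows "p \<zero> = 0"
proof -
  have "p (of_real (1/2) \<odot> \<zero>) \<le> 1/2 * p \<zero>" using assms M.zero_closed unfolding sublinear_def by (metis half_gt_zero_iff zero_less_one)
  then have "p \<zero> \<le> 0" using smult_r_null by simp
  moreover have "p \<zero> \<le> p \<zero> + p \<zero>" using sublinear_add[OF assms, of \<zero> \<zero>] by simp
  ultimately show ?thesis by simp
qed

lemma sublinear_scale:
  assumes p: "sublinear p" and t: "t \<ge> 0" and x: "x \<in> carrier V"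
  shows "p (of_real t \<odot> x) = t * p x"
proof (cases "t = 0")
  case True
  then show ?thesis using x sublinear_zero[OF p] by simp
next
  case False
  have le: "p (of_real s \<odot> y) \<le> s * p y" if "s > 0" "y \<in> carrier V" for s y
    using p that by (simp add: sublinear_def)
  have "p x = p (of_real (1 / t) \<odot> (of_real t \<odot> x))"
    using False x by (simp add: scale_scale)
  also have "\<dots> \<le> 1 / t * p (of_real t \<odot> x)"
    using False t x by (intro le) auto
  finally have "t * p x \<le> p (of_real t \<odot> x)" using False t by (simp add: field_simps)
  with le[of t x] False t x show ?thesis by simp
qed

lemma sublinear_minus:
  assumes "sublinear p" "x \<in> carrier V" shows "- p (\<ominus> x) \<le> p x"
  using sublinear_add[OF assms, of "\<ominus> x"] assms sublinear_zero[OF assms(1)] by (simp add: M.r_neg)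

text \<open>Zorn's lemma below \<open>p\<close>. Minimal functionals will turn out to be additive,
  which replaces the usual extension of a functional by one dimension at a time.\<close>

lemma minimal_sublinear:
  assumes p: "sublinear p"
  obtains m where "sublinear m" "\<And>x. x \<in> carrier V \<Longrightarrow> m x \<le> p x"
    "\<And>q x. sublinear q \<Longrightarrow> (\<And>x. x \<in> carrier V \<Longrightarrow> q x \<le> m x) \<Longrightarrow> x \<in> carrier V \<Longrightarrow> q x = m x"
proof -
  \<comment> \<open>The value 0 outside the carrier makes the pointwise order antisymmetric and lets
    minimality be stated as equality of functions.\<close>
  define A where "A = {q. sublinear q \<and> (\<forall>x\<in>carrier V. q x \<le> p x) \<and> (\<forall>x. x \<notin> carrier V \<longrightarrow> q x = 0)}"
  \<comment> \<open>The order is reversed, because the form of Zorn's lemma used here produces a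
    maximal element.\<close>
  define le where "le q r \<longleftrightarrow> (\<forall>x. r x \<le> q x)" for q r :: "'v \<Rightarrow> real"
  have "\<exists>m\<in>A. \<forall>a\<in>A. le m a \<longrightarrow> a = m"
  proof (rule predicate_Zorn)
    show "partial_order_on A (relation_of le A)"
      by (rule partial_order_on_relation_ofI) (auto simp: le_def fun_eq_iff intro: order.trans order.antisym)
  next
    fix C assume C: "C \<in> Chains (relation_of le A)"
    then have CA: "C \<subseteq> A" and tot: "\<And>q r. q \<in> C \<Longrightarrow> r \<in> C \<Longrightarrow> le q r \<or> le r q"
      by (auto simp: Chains_def relation_of_def)
    show "\<exists>u\<in>A. \<forall>a\<in>C. le a u"
    proof (cases "C = {}")
      case True
      have "(\<lambda>x. if x \<in> carrier V then p x else 0) \<in> A"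
        using p unfolding A_def sublinear_def by auto
      with True show ?thesis by auto
    next
      case False
      define u where "u x = (INF q\<in>C. q x)" for x
      have bdd: "bdd_below ((\<lambda>q. q x) ` C)" for x
      proof (cases "x \<in> carrier V")
        case True
        \<comment> \<open>A lower bound that is the same for all members of the chain, so the
          infimum over the chain is a genuine one.\<close>
        have "- p (\<ominus> x) \<le> q x" if "q \<in> C" for q
        proof -
          have q: "sublinear q" "q (\<ominus> x) \<le> p (\<ominus> x)"
            using CA that True by (auto simp: A_def)
          show ?thesis using sublinear_minus[OF q(1) True] q(2) by simp
        qed
        then show ?thesis by (rule bdd_belowI2)
      next
        case False
        then show ?thesis using CA by (intro bdd_belowI2[where m = 0]) (auto simp: A_def)
      qed
      have u_le: "u x \<le> q x" if "q \<in> C" for q x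
        unfolding u_def by (rule cINF_lower[OF bdd that])
      have "sublinear u"
        unfolding sublinear_def
      proof (intro conjI ballI allI impI)
        fix x y assume xy: "x \<in> carrier V" "y \<in> carrier V"
        show "u (x \<oplus> y) \<le> u x + u y"
          unfolding u_def
        proof (rule cInf_add_le[OF _ _ bdd])
          fix a b assume "a \<in> (\<lambda>q. q x) ` C" "b \<in> (\<lambda>q. q y) ` C"
          then obtain q r where qr: "q \<in> C" "a = q x" "r \<in> C" "b = r y" by auto
          \<comment> \<open>In a chain the smaller of the two functionals serves for both
            arguments.\<close>
          define s where "s = (if le q r then r else q)"
          have s: "s \<in> C" "s x \<le> q x" "s y \<le> r y"
            using qr tot[of q r] by (auto simp: s_def le_def)
          have "s (x \<oplus> y) \<le> s x + s y" using s CA xy by (auto simp: A_def sublinear_def)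
          then have "s (x \<oplus> y) \<le> a + b" using s qr by simp
          then show "\<exists>c\<in>(\<lambda>q. q (x \<oplus> y)) ` C. c \<le> a + b" using s(1) by blast
        qed (use False in auto)
      next
        fix t :: real and x assume t: "t > 0" and x: "x \<in> carrier V"
        show "u (of_real t \<odot> x) \<le> t * u x"
          unfolding u_def
        proof (rule cInf_scale_le[OF _ bdd t])
          fix a assume "a \<in> (\<lambda>q. q x) ` C"
          then obtain q where q: "q \<in> C" "a = q x" by blast
          then have "q (of_real t \<odot> x) \<le> t * a" using CA t x by (auto simp: A_def sublinear_def)
          then show "\<exists>c\<in>(\<lambda>q. q (of_real t \<odot> x)) ` C. c \<le> t * a" using q(1) by blast
        qed (use False in auto)
      qed
      moreover have "u x \<le> p x" if "x \<in> carrier V" for x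
      proof -
        obtain q where "q \<in> C" using False by blast
        then have "u x \<le> q x" "q x \<le> p x" using u_le CA that by (auto simp: A_def)
        then show ?thesis by simp
      qed
      moreover have "u x = 0" if "x \<notin> carrier V" for x
      proof -
        have "(\<lambda>q. q x) ` C = (\<lambda>q. 0) ` C"
          by (rule image_cong) (use CA that in \<open>auto simp: A_def\<close>)
        then show ?thesis using False by (simp add: u_def image_constant_conv)
      qed
      ultimately have "u \<in> A" by (simp add: A_def)
      then show ?thesis using u_le by (auto simp: le_def)
    qed
  qed
  then obtain m where m: "m \<in> A" "\<And>q. q \<in> A \<Longrightarrow> le m q \<Longrightarrow> q = m" by blast
  show thesis
  proof (rule that[of m])
    show "m x \<le> p x" if "x \<in> carrier V" for x using m(1) that by (auto simp: A_def)
    fix q x assume q: "sublinear q" "\<And>x. x \<in> carrier V \<Longrightarrow> q x \<le> m x" and x: "x \<in> carrier V"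
    define q' where "q' x = (if x \<in> carrier V then q x else 0)" for x
    have "sublinear q'" using q(1) by (simp add: sublinear_def q'_def)
    moreover have "q' x \<le> p x" if "x \<in> carrier V" for x
      using q(2)[OF that] m(1) that by (auto simp: A_def q'_def intro: order.trans)
    ultimately have "q' \<in> A" by (simp add: A_def q'_def)
    moreover have "le m q'" using q(2) m(1) by (auto simp: A_def q'_def le_def)
    ultimately have "q' = m" by (rule m(2))
    then have "q' x = m x" by (rule fun_cong)
    then show "q x = m x" using x by (simp add: q'_def)
  qed (use m(1) in \<open>simp add: A_def\<close>)
qed

text \<open>A minimal sublinear functional \<open>m\<close> is additive: it cannot be lowered to
  \<open>x \<mapsto> Inf\<^sub>t (m (x + t v) - t m v)\<close>, whence \<open>m x \<le> m (x + v) - m v\<close>.\<close>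

lemma minimal_sublinear_additive:
  assumes m: "sublinear m"
    and min: "\<And>q x. sublinear q \<Longrightarrow> (\<And>x. x \<in> carrier V \<Longrightarrow> q x \<le> m x) \<Longrightarrow> x \<in> carrier V \<Longrightarrow> q x = m x"
    and x: "x \<in> carrier V" and v: "v \<in> carrier V"
  shows "m (x \<oplus> v) = m x + m v"
proof -
  define Q where "Q x = (\<lambda>t. m (x \<oplus> of_real t \<odot> v) - t * m v) ` {0..}" for x
  define q where "q x = Inf (Q x)" for x
  have bdd: "bdd_below (Q x)" if x: "x \<in> carrier V" for x
    unfolding Q_def
  proof (rule bdd_belowI2)
    fix t :: real assume t: "t \<in> {0..}"
    \<comment> \<open>Subadditivity along this decomposition bounds the set \<open>Q x\<close> below
      by \<open>- m (\<ominus> x)\<close>, independently of \<open>t\<close>.\<close>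
    have "of_real t \<odot> v = (x \<oplus> of_real t \<odot> v) \<oplus> \<ominus> x"
      using x v by (simp add: M.a_comm M.a_assoc M.r_neg2 M.a_lcomm)
    then have "m (of_real t \<odot> v) \<le> m (x \<oplus> of_real t \<odot> v) + m (\<ominus> x)"
      using sublinear_add[OF m, of "x \<oplus> of_real t \<odot> v" "\<ominus> x"] x v by simp
    then show "- m (\<ominus> x) \<le> m (x \<oplus> of_real t \<odot> v) - t * m v"
      using sublinear_scale[OF m _ v, of t] t by simp
  qed
  have ne: "Q x \<noteq> {}" for x by (simp add: Q_def)
  have "sublinear q"
    unfolding sublinear_def q_def
  proof (intro conjI ballI allI impI)
    fix x y assume xy: "x \<in> carrier V" "y \<in> carrier V"
    show "Inf (Q (x \<oplus> y)) \<le> Inf (Q x) + Inf (Q y)"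
    proof (rule cInf_add_le[OF ne ne])
      show "bdd_below (Q (x \<oplus> y))" using xy by (intro bdd) auto
      fix a b assume "a \<in> Q x" "b \<in> Q y"
      then obtain s t where st: "s \<ge> 0" "t \<ge> 0" "a = m (x \<oplus> of_real s \<odot> v) - s * m v"
        "b = m (y \<oplus> of_real t \<odot> v) - t * m v" by (auto simp: Q_def)
      have "(x \<oplus> y) \<oplus> of_real (s + t) \<odot> v = (x \<oplus> of_real s \<odot> v) \<oplus> (y \<oplus> of_real t \<odot> v)"
        using xy v by (simp add: scale_add_left M.a_assoc M.a_lcomm)
      then have "m ((x \<oplus> y) \<oplus> of_real (s + t) \<odot> v) - (s + t) * m v \<le> a + b"
        using sublinear_add[OF m, of "x \<oplus> of_real s \<odot> v" "y \<oplus> of_real t \<odot> v"] xy v st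
        by (simp add: distrib_right)
      moreover have "m ((x \<oplus> y) \<oplus> of_real (s + t) \<odot> v) - (s + t) * m v \<in> Q (x \<oplus> y)"
        unfolding Q_def using st by (intro imageI) simp
      ultimately show "\<exists>c\<in>Q (x \<oplus> y). c \<le> a + b" by blast
    qed
  next
    fix r :: real and x assume r: "r > 0" and x: "x \<in> carrier V"
    show "Inf (Q (of_real r \<odot> x)) \<le> r * Inf (Q x)"
    proof (rule cInf_scale_le[OF ne _ r])
      show "bdd_below (Q (of_real r \<odot> x))" using x by (intro bdd) auto
      fix a assume "a \<in> Q x"
      then obtain t where t: "t \<ge> 0" "a = m (x \<oplus> of_real t \<odot> v) - t * m v" by (auto simp: Q_def)
      have "of_real r \<odot> x \<oplus> of_real (r * t) \<odot> v = of_real r \<odot> (x \<oplus> of_real t \<odot> v)"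
        using x v by (simp add: scale_add_right scale_scale)
      then have "m (of_real r \<odot> x \<oplus> of_real (r * t) \<odot> v) - (r * t) * m v = r * a"
        using sublinear_scale[OF m, of r "x \<oplus> of_real t \<odot> v"] r x v by (simp add: t(2) right_diff_distrib)
      moreover have "m (of_real r \<odot> x \<oplus> of_real (r * t) \<odot> v) - (r * t) * m v \<in> Q (of_real r \<odot> x)"
        unfolding Q_def using r t by (intro imageI) simp
      ultimately show "\<exists>c\<in>Q (of_real r \<odot> x). c \<le> r * a" by (metis order.refl)
    qed
  qed
  moreover have "q x \<le> m x" if "x \<in> carrier V" for x
  proof -
    have "m (x \<oplus> of_real 0 \<odot> v) - 0 * m v \<in> Q x" unfolding Q_def by (intro imageI) simp
    then have "q x \<le> m (x \<oplus> of_real 0 \<odot> v) - 0 * m v"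
      unfolding q_def using bdd[OF that] by (rule cInf_lower)
    then show ?thesis using that v by simp
  qed
  ultimately have "q x = m x" using x by (rule min)
  moreover have "q x \<le> m (x \<oplus> v) - m v"
  proof -
    have "m (x \<oplus> of_real 1 \<odot> v) - 1 * m v \<in> Q x" unfolding Q_def by (intro imageI) simp
    then have "q x \<le> m (x \<oplus> of_real 1 \<odot> v) - 1 * m v"
      unfolding q_def using bdd[OF x] by (rule cInf_lower)
    then show ?thesis using x v by simp
  qed
  ultimately show ?thesis using sublinear_add[OF m x v] by simp
qed

text \<open>There is no subspace here: values that are to be extended have to be built into
  \<open>p\<close>. The real functional \<open>m\<close> becomes complex linear as m(x) - i m(i
  x).\<close>

theorem hahn_banach:
  assumes p: "sublinear p"
  obtains f where "\<And>x y. x \<in> carrier V \<Longrightarrow> y \<in> carrier V \<Longrightarrow> f (x \<oplus> y) = f x + f y"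
    "\<And>c x. x \<in> carrier V \<Longrightarrow> f (c \<odot> x) = c * f x"
    "\<And>x. x \<in> carrier V \<Longrightarrow> Re (f x) \<le> p x"
proof -
  obtain m where m: "sublinear m" "\<And>x. x \<in> carrier V \<Longrightarrow> m x \<le> p x"
    and min: "\<And>q x. sublinear q \<Longrightarrow> (\<And>x. x \<in> carrier V \<Longrightarrow> q x \<le> m x) \<Longrightarrow> x \<in> carrier V \<Longrightarrow> q x = m x"
    using minimal_sublinear[OF p] by blast
  have add: "m (x \<oplus> v) = m x + m v" if "x \<in> carrier V" "v \<in> carrier V" for x v
    by (rule minimal_sublinear_additive[OF m(1) _ that]) (rule min)
  have neg: "m (\<ominus> x) = - m x" if "x \<in> carrier V" for x
    using add[of x "\<ominus> x"] that sublinear_zero[OF m(1)] by (simp add: M.r_neg)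
  have scale: "m (of_real t \<odot> x) = t * m x" if x: "x \<in> carrier V" for t x
  proof (cases "t \<ge> 0")
    case False
    have "of_real t \<odot> x = \<ominus> (of_real (- t) \<odot> x)"
      using x by (simp add: scale_scale flip: scale_minus_one)
    then show ?thesis using False x sublinear_scale[OF m(1), of "- t" x] by (simp add: neg)
  qed (rule sublinear_scale[OF m(1) _ x])
  define f where "f x = Complex (m x) (- m (\<i> \<odot> x))" for x
  have scale': "m (c \<odot> x) = Re c * m x + Im c * m (\<i> \<odot> x)" if x: "x \<in> carrier V" for c x
  proof -
    have "c \<odot> x = of_real (Re c) \<odot> x \<oplus> of_real (Im c) \<odot> (\<i> \<odot> x)"
      using x by (simp add: scale_scale mult.commute flip: scale_add_left complex_eq)
    then show ?thesis using x by (simp add: add scale)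
  qed
  show thesis
  proof (rule that[of f])
    show "f (x \<oplus> y) = f x + f y" if "x \<in> carrier V" "y \<in> carrier V" for x y
      using that by (simp add: f_def complex_eq_iff add scale_add_right)
    show "f (c \<odot> x) = c * f x" if "x \<in> carrier V" for c x
      using that scale'[OF that, of c] scale'[OF that, of "\<i> * c"]
      by (simp add: f_def complex_eq_iff scale_scale)
    show "Re (f x) \<le> p x" if "x \<in> carrier V" for x
      using m(2)[OF that] by (simp add: f_def)
  qed
qed

end

section \<open>The upper bound\<close>

lemma carrier_spherical_harmonics:
  "f \<in> carrier (spherical_harmonics d) \<longleftrightarrow>
    (\<exists>p. homogeneous_polynomial d p \<and> (\<forall>x. laplacian p x = 0) \<and> f = restrict p (sphere 0 1))"
  by (auto simp: spherical_harmonics_def)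

lemma spherical_harmonics_simps [simp]:
  "add (spherical_harmonics d) f g = (\<lambda>x\<in>sphere 0 1. f x + g x)"
  "smult (spherical_harmonics d) c f = (\<lambda>x\<in>sphere 0 1. c * f x)"
  "vnorm (spherical_harmonics d) f = (SUP x\<in>sphere 0 1. cmod (f x))"
  by (simp_all add: spherical_harmonics_def)

lemma spherical_harmonics_add_closed:
  assumes "f \<in> carrier (spherical_harmonics d)" "g \<in> carrier (spherical_harmonics d)"
  shows "(\<lambda>x\<in>sphere 0 1. f x + g x) \<in> carrier (spherical_harmonics d)"
proof -
  obtain p q where pq: "homogeneous_polynomial d p" "\<forall>x. laplacian p x = 0" "f = restrict p (sphere 0 1)"
    "homogeneous_polynomial d q" "\<forall>x. laplacian q x = 0" "g = restrict q (sphere 0 1)"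
    using assms unfolding carrier_spherical_harmonics by blast
  show ?thesis
    unfolding carrier_spherical_harmonics
    by (intro exI[of _ "\<lambda>x. p x + q x"])
      (use pq in \<open>auto simp: laplacian_add mpoly_homogeneous_polynomial intro: homogeneous_polynomial_add\<close>)
qed

lemma spherical_harmonics_smult_closed:
  assumes "f \<in> carrier (spherical_harmonics d)"
  shows "(\<lambda>x\<in>sphere 0 1. c * f x) \<in> carrier (spherical_harmonics d)"
proof -
  obtain p where p: "homogeneous_polynomial d p" "\<forall>x. laplacian p x = 0" "f = restrict p (sphere 0 1)"
    using assms unfolding carrier_spherical_harmonics by blast
  show ?thesis
    unfolding carrier_spherical_harmonics
    by (intro exI[of _ "\<lambda>x. c * p x"])
      (use p in \<open>auto simp: laplacian_cmult mpoly_homogeneous_polynomial intro: homogeneous_polynomial_cmult\<close>)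
qed

lemma spherical_harmonics_0_closed: "(\<lambda>x\<in>sphere 0 1. 0) \<in> carrier (spherical_harmonics d)"
  unfolding carrier_spherical_harmonics
  by (intro exI[of _ "\<lambda>x. 0"]) (auto simp: homogeneous_polynomial_0 laplacian_def)

lemma continuous_on_spherical_harmonics:
  assumes "f \<in> carrier (spherical_harmonics d)" shows "continuous_on (sphere 0 1) f"
proof -
  obtain p where p: "homogeneous_polynomial d p" "f = restrict p (sphere 0 1)"
    using assms unfolding carrier_spherical_harmonics by blast
  show ?thesis
    using mpoly_continuous_on[OF mpoly_homogeneous_polynomial(1)[OF p(1)], of "sphere 0 1"]
    by (rule continuous_on_eq) (simp add: p(2))
qed

lemma cmod_le_sup_sphere:
  fixes f :: "real ^ 'n \<Rightarrow> complex"
  assumes "continuous_on (sphere 0 1) f" "x \<in> sphere 0 1"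
  shows "cmod (f x) \<le> (SUP x\<in>sphere 0 1. cmod (f x))"
proof -
  obtain B where "\<And>x. x \<in> sphere 0 1 \<Longrightarrow> norm (f x) \<le> B"
    by (rule bounded_continuous_on_sphere[OF assms(1)]) blast
  then show ?thesis by (intro cSUP_upper assms(2) bdd_aboveI2)
qed

lemma sphere_nonempty [simp]: "sphere (0 :: real ^ 'n) 1 \<noteq> {}"
  using norm_axis_1 by (metis empty_iff mem_sphere_0)

text \<open>Hahn-Banach gives one-sided real estimates; applied to the multiples by 1, -1, i and -i
  they become an equality.\<close>

lemma complex_le_imp_eq:
  assumes "\<And>c :: complex. Re (c * z) \<le> Re (c * w)" shows "z = w"
  using assms[of 1] assms[of "-1"] assms[of "\<i>"] assms[of "-\<i>"] by (simp add: complex_eq_iff)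

lemma unimodular_multiple: obtains u :: complex where "cmod u = 1" "u * z = of_real (cmod z)"
proof (cases "z = 0")
  case False
  have "cnj z * z = of_real (cmod z) * of_real (cmod z)"
    using complex_norm_square[of z] by (simp add: mult.commute power2_eq_square)
  then show thesis
    using False by (intro that[of "cnj z / of_real (cmod z)"]) (simp_all add: norm_divide)
qed (use that[of 1] in simp)

section \<open>The functional and the projection\<close>

context complex_normed_space
begin

sublocale Y: complex_module Y ..

lemma uminus_zero: "\<ominus> \<zero> = \<zero>"
  using M.minus_equality[of \<zero> \<zero>] by simp

lemma vnorm_zero [simp]: "vnorm Y \<zero> = 0"
  using vnorm_eq_zero[of \<zero>] by simp

lemma vnorm_minus: "x \<in> carrier Y \<Longrightarrow> vnorm Y (\<ominus> x) = vnorm Y x"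
  using vnorm_smult[of x "-1"] by (simp add: Y.scale_minus_one)

text \<open>The functional \<open>\<Phi>\<close> extends \<open>F \<mapsto> \<integral> (I\<inverse> (F x)) (x) d\<sigma>(x)\<close> from functions with values in the range of
  \<open>I\<close> to all bounded \<open>F\<close> with values in \<open>Y\<close>, with \<open>|\<Phi> F| \<le> \<integral> \<parallel>F x\<parallel> d\<sigma>(x)\<close>; here \<open>\<Psi> b y = \<Phi> (\<lambda>x. b x y)\<close>.
  Taking an infimum over continuous majorants \<open>g\<close> avoids measurability questions, and the term
  \<open>Re (h x)\<close> builds the prescribed values on the range of \<open>I\<close> into the sublinear functional.\<close>

lemma sphere_functional:
  fixes I :: "(real ^ 'n \<Rightarrow> complex) \<Rightarrow> 'b"
  assumes I: "isometric_embedding (spherical_harmonics d) Y I"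
  obtains \<Psi> :: "(real ^ 'n \<Rightarrow> complex) \<Rightarrow> 'b \<Rightarrow> complex"
  where "\<And>b b' y. mpoly b \<Longrightarrow> mpoly b' \<Longrightarrow> y \<in> carrier Y \<Longrightarrow> \<Psi> (\<lambda>x. b x + b' x) y = \<Psi> b y + \<Psi> b' y"
    "\<And>c b y. mpoly b \<Longrightarrow> y \<in> carrier Y \<Longrightarrow> \<Psi> (\<lambda>x. c * b x) y = c * \<Psi> b y"
    "\<And>b y y'. mpoly b \<Longrightarrow> y \<in> carrier Y \<Longrightarrow> y' \<in> carrier Y \<Longrightarrow> \<Psi> b (y \<oplus> y') = \<Psi> b y + \<Psi> b y'"
    "\<And>c b y. mpoly b \<Longrightarrow> y \<in> carrier Y \<Longrightarrow> \<Psi> b (c \<odot> y) = c * \<Psi> b y"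
    "\<And>b y. mpoly b \<Longrightarrow> y \<in> carrier Y \<Longrightarrow> cmod (\<Psi> b y) \<le> (LINT x|sphere_measure. cmod (b x)) * vnorm Y y"
    "\<And>b h. mpoly b \<Longrightarrow> homogeneous_polynomial d h \<Longrightarrow> (\<And>x. laplacian h x = 0) \<Longrightarrow>
      \<Psi> b (I (restrict h (sphere 0 1))) = (LINT x|sphere_measure. b x * h x)"
proof -
  define S where "S = sphere (0 :: real ^ 'n) 1"
  define X where "X = carrier (spherical_harmonics d :: (real ^ 'n \<Rightarrow> complex) normed_structure)"
  have I_closed: "I h \<in> carrier Y" if "h \<in> X" for h
    using I that by (auto simp: isometric_embedding_def complex_linear_map_def X_def)
  have I_add: "I (\<lambda>x\<in>S. h x + h' x) = I h \<oplus> I h'" if "h \<in> X" "h' \<in> X" for h h'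
    using I that by (auto simp: isometric_embedding_def complex_linear_map_def X_def S_def)
  have I_smult: "I (\<lambda>x\<in>S. c * h x) = c \<odot> I h" if "h \<in> X" for c h
    using I that by (auto simp: isometric_embedding_def complex_linear_map_def X_def S_def)
  have I_norm: "cmod (h x) \<le> vnorm Y (I h)" if "h \<in> X" "x \<in> S" for h x
    using I that cmod_le_sup_sphere[OF continuous_on_spherical_harmonics]
    by (auto simp: isometric_embedding_def X_def S_def)
  have I0: "I (\<lambda>x\<in>S. 0) = \<zero>"
  proof -
    have "(\<lambda>x\<in>S. 0) \<in> X" unfolding X_def S_def by (rule spherical_harmonics_0_closed)
    from I_smult[OF this, of 0] I_closed[OF this] show ?thesis by (simp cong: restrict_cong)
  qed
  have X0: "(\<lambda>x\<in>S. 0) \<in> X" unfolding X_def S_def by (rule spherical_harmonics_0_closed)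
  have X_add: "(\<lambda>x\<in>S. h x + h' x) \<in> X" if "h \<in> X" "h' \<in> X" for h h'
    using spherical_harmonics_add_closed that unfolding X_def S_def .
  have X_smult: "(\<lambda>x\<in>S. c * h x) \<in> X" if "h \<in> X" for h c
    using spherical_harmonics_smult_closed that unfolding X_def S_def .
  \<comment> \<open>The functions live on the whole space, as polynomials do, but are required to be
    bounded on the sphere only.\<close>
  define V :: "(complex, real ^ 'n \<Rightarrow> 'b) module" where
    "V = \<lparr>carrier = {F. (\<forall>x. F x \<in> carrier Y) \<and> (\<exists>B. \<forall>x\<in>S. vnorm Y (F x) \<le> B)},
      monoid.mult = undefined, one = undefined, zero = (\<lambda>_. \<zero>), add = (\<lambda>F G x. F x \<oplus> G x),
      smult = (\<lambda>c F x. c \<odot> F x)\<rparr>"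
  have V_simps: "F \<in> carrier V \<longleftrightarrow> (\<forall>x. F x \<in> carrier Y) \<and> (\<exists>B. \<forall>x\<in>S. vnorm Y (F x) \<le> B)"
    "F \<oplus>\<^bsub>V\<^esub> G = (\<lambda>x. F x \<oplus> G x)" "\<zero>\<^bsub>V\<^esub> = (\<lambda>_. \<zero>)" "c \<odot>\<^bsub>V\<^esub> F = (\<lambda>x. c \<odot> F x)" for F G c
    by (simp_all add: V_def)
  have V_add: "(\<lambda>x. F x \<oplus> G x) \<in> carrier V" if FG: "F \<in> carrier V" "G \<in> carrier V" for F G
  proof -
    obtain B C where "\<forall>x\<in>S. vnorm Y (F x) \<le> B" "\<forall>x\<in>S. vnorm Y (G x) \<le> C"
      using FG unfolding V_simps by blast
    then have "\<forall>x\<in>S. vnorm Y (F x \<oplus> G x) \<le> B + C"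
      using FG vnorm_triangle unfolding V_simps by (meson add_mono order.trans)
    then show ?thesis using FG unfolding V_simps by auto
  qed
  have V_smult: "(\<lambda>x. c \<odot> F x) \<in> carrier V" if F: "F \<in> carrier V" for c F
  proof -
    obtain B where "\<forall>x\<in>S. vnorm Y (F x) \<le> B" using F unfolding V_simps by blast
    then have "\<forall>x\<in>S. vnorm Y (c \<odot> F x) \<le> cmod c * B"
      using F unfolding V_simps by (simp add: vnorm_smult mult_left_mono)
    then show ?thesis using F unfolding V_simps by auto
  qed
  interpret V: complex_module V
    unfolding complex_module_def
  proof (rule moduleI)
    show "abelian_group V"
    proof (rule abelian_groupI)
      fix F assume F: "F \<in> carrier V"
      have "(\<lambda>x. (-1) \<odot> F x) \<in> carrier V" by (rule V_smult[OF F])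
      moreover have "(\<lambda>x. (-1) \<odot> F x \<oplus> F x) = (\<lambda>_. \<zero>)"
        using F unfolding V_simps by (simp add: Y.scale_minus_one M.l_neg)
      ultimately show "\<exists>G\<in>carrier V. G \<oplus>\<^bsub>V\<^esub> F = \<zero>\<^bsub>V\<^esub>"
        by (intro bexI[of _ "\<lambda>x. (-1) \<odot> F x"]) (simp_all add: V_simps(2,3))
    next
      show "\<zero>\<^bsub>V\<^esub> \<in> carrier V" unfolding V_simps by auto
    qed (use V_add in \<open>auto simp: V_simps M.a_ac\<close>)
  qed (use V_smult cring_complex_field in
      \<open>auto simp: V_simps Y.scale_add_left Y.scale_add_right Y.scale_scale\<close>)
  \<comment> \<open>Here \<open>h\<close> may depend on the point \<open>x\<close>. At each point
    this is the infimal convolution of the norm with evaluation at \<open>x\<close> on the range of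
    \<open>I\<close>: \<open>h = 0\<close> gives the bound by the norm, and an \<open>h\<close> with
    \<open>I h = F x\<close> gives the prescribed value.\<close>
  define M where "M F g \<longleftrightarrow> continuous_on UNIV g \<and>
      (\<forall>x\<in>S. \<exists>h\<in>X. vnorm Y (F x \<oplus> \<ominus> I h) + Re (h x) \<le> g x)" for F and g :: "real ^ 'n \<Rightarrow> real"
  define p where "p F = Inf ((\<lambda>g. LINT x|sphere_measure. g x) ` {g. M F g})" for F
  have M_bound: "M F g" if F: "F \<in> carrier V" and g: "continuous_on UNIV g" "\<And>x. x \<in> S \<Longrightarrow> vnorm Y (F x) \<le> g x" for F g
    unfolding M_def using F g X0
    by (intro conjI ballI bexI[of _ "\<lambda>x\<in>S. 0"]) (auto simp: I0 V_simps uminus_zero)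
  have p_ne: "(\<lambda>g. LINT x|sphere_measure. g x) ` {g. M F g} \<noteq> {}" if F: "F \<in> carrier V" for F
  proof -
    obtain B where "\<forall>x\<in>S. vnorm Y (F x) \<le> B" using F unfolding V_simps by blast
    then have "M F (\<lambda>_. B)" by (intro M_bound[OF F]) auto
    then show ?thesis by blast
  qed
  have p_bdd: "bdd_below ((\<lambda>g. LINT x|sphere_measure. g x) ` {g. M F g})" if F: "F \<in> carrier V" for F
  proof -
    obtain B where B: "\<And>x. x \<in> S \<Longrightarrow> vnorm Y (F x) \<le> B" using F unfolding V_simps by blast
    have "- B \<le> (LINT x|sphere_measure. g x)" if M: "M F g" for g
    proof -
      interpret prob_space "sphere_measure :: (real ^ 'n) measure" by (rule prob_space_sphere_measure)
      \<comment> \<open>The isometry enters here: |h(x)| is at most the norm of \<open>I h\<close>,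
        so a very negative \<open>Re (h x)\<close> is paid for by the distance from
        \<open>F x\<close> to \<open>I h\<close>.\<close>
      have ge: "- B \<le> g x" if x: "x \<in> S" for x
      proof -
        obtain h where h: "h \<in> X" "vnorm Y (F x \<oplus> \<ominus> I h) + Re (h x) \<le> g x" using M x by (auto simp: M_def)
        have cl: "F x \<in> carrier Y" "I h \<in> carrier Y" using F I_closed[OF h(1)] by (auto simp: V_simps)
        have "I h = F x \<oplus> \<ominus> (F x \<oplus> \<ominus> I h)"
          using cl by (simp add: M.minus_add M.r_neg2 M.a_assoc[symmetric] M.r_neg)
        then have "vnorm Y (I h) \<le> vnorm Y (F x) + vnorm Y (F x \<oplus> \<ominus> I h)"
          using vnorm_triangle[of "F x" "\<ominus> (F x \<oplus> \<ominus> I h)"] cl by (simp add: vnorm_minus)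
        moreover have "- Re (h x) \<le> vnorm Y (I h)"
          using I_norm[OF h(1) x] abs_Re_le_cmod[of "h x"] by linarith
        ultimately show ?thesis using B[OF x] h(2) by linarith
      qed
      have "AE x in sphere_measure. - B \<le> g x"
        using AE_sphere_measure by eventually_elim (simp add: ge S_def)
      moreover have "integrable sphere_measure g" using M by (auto simp: M_def)
      ultimately have "(LINT x|(sphere_measure :: (real ^ 'n) measure). - B) \<le> (LINT x|sphere_measure. g x)"
        by (intro integral_mono_AE) auto
      then show ?thesis using prob_space by simp
    qed
    then show ?thesis by (intro bdd_belowI2) auto
  qed
  have "V.sublinear p"
    unfolding V.sublinear_def
  proof (intro conjI ballI allI impI)
    fix F G assume FG: "F \<in> carrier V" "G \<in> carrier V"
    show "p (F \<oplus>\<^bsub>V\<^esub> G) \<le> p F + p G"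
      unfolding p_def
    proof (rule cInf_add_le[OF p_ne p_ne p_bdd])
      fix a b assume "a \<in> (\<lambda>g. LINT x|sphere_measure. g x) ` {g. M F g}" "b \<in> (\<lambda>g. LINT x|sphere_measure. g x) ` {g. M G g}"
      then obtain f g where fg: "M F f" "a = (LINT x|sphere_measure. f x)" "M G g" "b = (LINT x|sphere_measure. g x)" by auto
      have "M (F \<oplus>\<^bsub>V\<^esub> G) (\<lambda>x. f x + g x)"
        unfolding M_def
      proof (intro conjI ballI)
        show "continuous_on UNIV (\<lambda>x. f x + g x)" using fg by (auto simp: M_def intro: continuous_intros)
        fix x assume x: "x \<in> S"
        obtain h k where hk: "h \<in> X" "vnorm Y (F x \<oplus> \<ominus> I h) + Re (h x) \<le> f x"
          "k \<in> X" "vnorm Y (G x \<oplus> \<ominus> I k) + Re (k x) \<le> g x"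
          using fg x unfolding M_def by meson
        have cl: "F x \<in> carrier Y" "I h \<in> carrier Y" "G x \<in> carrier Y" "I k \<in> carrier Y"
          using FG I_closed hk by (auto simp: V_simps)
        have "(F x \<oplus> G x) \<oplus> \<ominus> (I h \<oplus> I k) = (F x \<oplus> \<ominus> I h) \<oplus> (G x \<oplus> \<ominus> I k)"
          using cl by (simp add: M.minus_add M.a_ac)
        then have "vnorm Y ((F x \<oplus> G x) \<oplus> \<ominus> I (\<lambda>x\<in>S. h x + k x)) \<le> vnorm Y (F x \<oplus> \<ominus> I h) + vnorm Y (G x \<oplus> \<ominus> I k)"
          using vnorm_triangle[of "F x \<oplus> \<ominus> I h" "G x \<oplus> \<ominus> I k"] cl hk by (simp add: I_add)
        then show "\<exists>h\<in>X. vnorm Y ((F \<oplus>\<^bsub>V\<^esub> G) x \<oplus> \<ominus> I h) + Re (h x) \<le> f x + g x"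
          using hk x by (intro bexI[OF _ X_add[OF hk(1,3)]]) (simp add: V_simps)
      qed
      moreover have "(LINT x|sphere_measure. f x + g x) = a + b"
        using fg by (subst Bochner_Integration.integral_add) (auto simp: M_def)
      ultimately show "\<exists>c\<in>(\<lambda>g. LINT x|sphere_measure. g x) ` {g. M (F \<oplus>\<^bsub>V\<^esub> G) g}. c \<le> a + b"
        by (intro bexI[of _ "a + b"] image_eqI[of _ _ "\<lambda>x. f x + g x"]) auto
    qed (use FG in auto)
  next
    fix t :: real and F assume t: "t > 0" and F: "F \<in> carrier V"
    show "p (of_real t \<odot>\<^bsub>V\<^esub> F) \<le> t * p F"
      unfolding p_def
    proof (rule cInf_scale_le[OF p_ne p_bdd t])
      fix a assume "a \<in> (\<lambda>g. LINT x|sphere_measure. g x) ` {g. M F g}"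
      then obtain g where g: "M F g" "a = (LINT x|sphere_measure. g x)" by auto
      have "M (of_real t \<odot>\<^bsub>V\<^esub> F) (\<lambda>x. t * g x)"
        unfolding M_def
      proof (intro conjI ballI)
        show "continuous_on UNIV (\<lambda>x. t * g x)" using g by (auto simp: M_def intro: continuous_intros)
        fix x assume x: "x \<in> S"
        obtain h where h: "h \<in> X" "vnorm Y (F x \<oplus> \<ominus> I h) + Re (h x) \<le> g x"
          using g x unfolding M_def by meson
        have cl: "F x \<in> carrier Y" "I h \<in> carrier Y" using F I_closed h by (auto simp: V_simps)
        have "of_real t \<odot> F x \<oplus> \<ominus> (of_real t \<odot> I h) = of_real t \<odot> (F x \<oplus> \<ominus> I h)"
          using cl by (simp add: Y.scale_add_right Y.scale_scale flip: Y.scale_minus_one)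
        then have "vnorm Y (of_real t \<odot> F x \<oplus> \<ominus> I (\<lambda>x\<in>S. of_real t * h x)) = t * vnorm Y (F x \<oplus> \<ominus> I h)"
          using t cl h by (simp add: I_smult vnorm_smult)
        moreover have "t * vnorm Y (F x \<oplus> \<ominus> I h) + t * Re (h x) \<le> t * g x"
          using mult_left_mono[OF h(2), of t] t by (simp add: distrib_left)
        ultimately show "\<exists>h\<in>X. vnorm Y ((of_real t \<odot>\<^bsub>V\<^esub> F) x \<oplus> \<ominus> I h) + Re (h x) \<le> t * g x"
          using h x by (intro bexI[OF _ X_smult[OF h(1), of "of_real t"]]) (simp add: V_simps)
      qed
      then show "\<exists>c\<in>(\<lambda>g. LINT x|sphere_measure. g x) ` {g. M (of_real t \<odot>\<^bsub>V\<^esub> F) g}. c \<le> t * a"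
        using g(2) by (intro bexI[of _ "t * a"] image_eqI[of _ _ "\<lambda>x. t * g x"]) auto
    qed (use F V_smult in \<open>auto simp: V_simps(4)\<close>)
  qed
  then obtain \<Phi> where \<Phi>: "\<And>F G. F \<in> carrier V \<Longrightarrow> G \<in> carrier V \<Longrightarrow> \<Phi> (F \<oplus>\<^bsub>V\<^esub> G) = \<Phi> F + \<Phi> G"
    "\<And>c F. F \<in> carrier V \<Longrightarrow> \<Phi> (c \<odot>\<^bsub>V\<^esub> F) = c * \<Phi> F" "\<And>F. F \<in> carrier V \<Longrightarrow> Re (\<Phi> F) \<le> p F"
    by (rule V.hahn_banach) blast
  have \<Phi>_le: "Re (\<Phi> F) \<le> (LINT x|sphere_measure. g x)" if "F \<in> carrier V" "M F g" for F g
    using \<Phi>(3)[OF that(1)] cInf_lower[OF _ p_bdd[OF that(1)], of "LINT x|sphere_measure. g x"] that(2)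
    by (auto simp: p_def)
  define \<Psi> where "\<Psi> b y = \<Phi> (\<lambda>x. b x \<odot> y)" for b y
  have bV: "(\<lambda>x. b x \<odot> y) \<in> carrier V" if b: "mpoly b" and y: "y \<in> carrier Y" for b y
  proof -
    obtain B where "\<And>x. x \<in> S \<Longrightarrow> cmod (b x) \<le> B"
      unfolding S_def using bounded_continuous_on_sphere[OF mpoly_continuous_on[OF b]] by metis
    then have "\<forall>x\<in>S. vnorm Y (b x \<odot> y) \<le> B * vnorm Y y"
      using y by (simp add: vnorm_smult vnorm_nonneg mult_right_mono)
    then show ?thesis using y unfolding V_simps by auto
  qed
  show thesis
  proof (rule that[of \<Psi>])
    show "\<Psi> (\<lambda>x. b x + b' x) y = \<Psi> b y + \<Psi> b' y" if "mpoly b" "mpoly b'" "y \<in> carrier Y" for b b' y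
      using \<Phi>(1)[OF bV bV, of b y b' y] that by (simp add: \<Psi>_def V_simps(2) Y.scale_add_left)
    show scale: "\<Psi> (\<lambda>x. c * b x) y = c * \<Psi> b y" if "mpoly b" "y \<in> carrier Y" for c b y
      using \<Phi>(2)[OF bV, of b y c] that by (simp add: \<Psi>_def V_simps(4) Y.scale_scale)
    show "\<Psi> b (y \<oplus> y') = \<Psi> b y + \<Psi> b y'" if "mpoly b" "y \<in> carrier Y" "y' \<in> carrier Y" for b y y'
      using \<Phi>(1)[OF bV bV, of b y b y'] that by (simp add: \<Psi>_def V_simps(2) Y.scale_add_right)
    show "\<Psi> b (c \<odot> y) = c * \<Psi> b y" if "mpoly b" "y \<in> carrier Y" for c b y
      using \<Phi>(2)[OF bV, of b y c] that by (simp add: \<Psi>_def V_simps(4) Y.scale_scale mult.commute)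
    show "cmod (\<Psi> b y) \<le> (LINT x|sphere_measure. cmod (b x)) * vnorm Y y" if b: "mpoly b" and y: "y \<in> carrier Y" for b y
    proof -
      \<comment> \<open>Multiplication by \<open>u\<close> makes the value real and nonnegative, so
        the bound on the real part applies, while the modulus of \<open>b\<close> is
        unchanged.\<close>
      obtain u where u: "cmod u = 1" "u * \<Psi> b y = of_real (cmod (\<Psi> b y))" by (rule unimodular_multiple)
      have ub: "mpoly (\<lambda>x. u * b x)" using b by auto
      have "cmod (\<Psi> b y) = Re (\<Phi> (\<lambda>x. (u * b x) \<odot> y))"
        using scale[OF b y, of u] u(2) by (simp add: \<Psi>_def)
      also have "\<dots> \<le> (LINT x|sphere_measure. cmod (b x) * vnorm Y y)"
      proof (rule \<Phi>_le[OF bV[OF ub y]], rule M_bound[OF bV[OF ub y]])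
        show "continuous_on UNIV (\<lambda>x. cmod (b x) * vnorm Y y)"
          by (intro continuous_intros mpoly_continuous_on b)
      qed (use y u in \<open>simp add: vnorm_smult norm_mult\<close>)
      finally show ?thesis by simp
    qed
    show "\<Psi> b (I (restrict h (sphere 0 1))) = (LINT x|sphere_measure. b x * h x)"
      if b: "mpoly b" and h: "homogeneous_polynomial d h" "\<And>x. laplacian h x = 0" for b h
    proof (rule complex_le_imp_eq)
      fix c :: complex
      have hX: "restrict h S \<in> X"
        unfolding X_def carrier_spherical_harmonics S_def using h by blast
      have cb: "mpoly (\<lambda>x. c * b x)" and mh: "mpoly h"
        using b mpoly_homogeneous_polynomial(1)[OF h(1)] by auto
      have "Re (c * \<Psi> b (I (restrict h S))) = Re (\<Phi> (\<lambda>x. (c * b x) \<odot> I (restrict h S)))"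
        using scale[OF b I_closed[OF hX]] by (simp add: \<Psi>_def)
      also have "\<dots> \<le> (LINT x|sphere_measure. Re (c * b x * h x))"
      proof (rule \<Phi>_le[OF bV[OF cb I_closed[OF hX]]])
        show "M (\<lambda>x. (c * b x) \<odot> I (restrict h S)) (\<lambda>x. Re (c * b x * h x))"
          unfolding M_def
        proof (intro conjI ballI)
          show "continuous_on UNIV (\<lambda>x. Re (c * b x * h x))"
            by (intro continuous_intros mpoly_continuous_on b mh)
          fix x assume x: "x \<in> S"
          \<comment> \<open>At the point \<open>x\<close> the witness is the multiple of
            \<open>h\<close> by the number \<open>c * b x\<close>: it makes the norm term vanish,
            and its value at \<open>x\<close> is the integrand.\<close>
          define k where "k = restrict h S"
          have k: "k \<in> X" "k x = h x" using hX x by (auto simp: k_def)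
          show "\<exists>h'\<in>X. vnorm Y ((c * b x) \<odot> I (restrict h S) \<oplus> \<ominus> I h') + Re (h' x) \<le> Re (c * b x * h x)"
            unfolding k_def[symmetric]
            by (rule bexI[OF _ X_smult[OF k(1), of "c * b x"]])
              (use x k I_closed[OF k(1)] in \<open>simp add: I_smult[OF k(1)] M.r_neg\<close>)
        qed
      qed
      also have "\<dots> = Re (LINT x|sphere_measure. c * (b x * h x))"
        using b mh by (subst integral_Re[symmetric]) (auto simp: mult.assoc intro!: integrable_sphere_mpoly)
      also have "\<dots> = Re (c * (LINT x|sphere_measure. b x * h x))" by simp
      finally show "Re (c * \<Psi> b (I (restrict h (sphere 0 1)))) \<le> Re (c * (LINT x|sphere_measure. b x * h x))"
        by (simp add: S_def)
    qed
  qed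
qed

theorem relative_projection_constant_le:
  fixes I :: "(real ^ 'n::{finite,wellorder} \<Rightarrow> complex) \<Rightarrow> 'b"
  assumes n: "CARD('n) \<ge> 3" and I: "isometric_embedding (spherical_harmonics d) Y I"
    and c: "\<And>z :: real ^ 'n::{finite,wellorder}. norm z = 1 \<Longrightarrow> (LINT x|sphere_measure. cmod (zonal_kernel d z x)) \<le> c"
  shows "relative_projection_constant (I ` carrier (spherical_harmonics d)) Y \<le> ereal c"
proof -
  define S where "S = sphere (0 :: real ^ 'n::{finite,wellorder}) 1"
  define X where "X = (spherical_harmonics d :: (real ^ 'n::{finite,wellorder} \<Rightarrow> complex) normed_structure)"
  obtain \<Psi> :: "(real ^ 'n::{finite,wellorder} \<Rightarrow> complex) \<Rightarrow> 'b \<Rightarrow> complex" where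
    \<Psi>_add: "\<And>b b' y. mpoly b \<Longrightarrow> mpoly b' \<Longrightarrow> y \<in> carrier Y \<Longrightarrow> \<Psi> (\<lambda>x. b x + b' x) y = \<Psi> b y + \<Psi> b' y"
    and \<Psi>_mult: "\<And>c b y. mpoly b \<Longrightarrow> y \<in> carrier Y \<Longrightarrow> \<Psi> (\<lambda>x. c * b x) y = c * \<Psi> b y"
    and \<Psi>_add_right: "\<And>b y y'. mpoly b \<Longrightarrow> y \<in> carrier Y \<Longrightarrow> y' \<in> carrier Y \<Longrightarrow> \<Psi> b (y \<oplus> y') = \<Psi> b y + \<Psi> b y'"
    and \<Psi>_mult_right: "\<And>c b y. mpoly b \<Longrightarrow> y \<in> carrier Y \<Longrightarrow> \<Psi> b (c \<odot> y) = c * \<Psi> b y"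
    and \<Psi>_norm: "\<And>b y. mpoly b \<Longrightarrow> y \<in> carrier Y \<Longrightarrow> cmod (\<Psi> b y) \<le> (LINT x|sphere_measure. cmod (b x)) * vnorm Y y"
    and \<Psi>_I: "\<And>b h. mpoly b \<Longrightarrow> homogeneous_polynomial d h \<Longrightarrow> (\<And>x. laplacian h x = 0) \<Longrightarrow>
      \<Psi> b (I (restrict h (sphere 0 1))) = (LINT x|sphere_measure. b x * h x)"
    by (rule sphere_functional[OF I]) blast
  note sep = separable_zonal_kernel[where 'n = 'n, of d]
  have mz: "mpoly (zonal_kernel d z)" for z :: "real ^ 'n::{finite,wellorder}"
    by (rule separable_mpoly_right[OF sep])
  \<comment> \<open>On a product a(z) b(x) the functional only sees b and returns a multiple of a.
    By linearity it preserves homogeneity in z and commutes with the Laplacian in z. The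
    polynomiality clause is needed to apply additivity in the sum case.\<close>
  have harm: "homogeneous_polynomial d (\<lambda>z. \<Psi> (F z) y) \<and> mpoly (\<lambda>x. laplacian (\<lambda>w. F w x) z)
      \<and> laplacian (\<lambda>z. \<Psi> (F z) y) z = \<Psi> (\<lambda>x. laplacian (\<lambda>w. F w x) z) y"
    if F: "separable (homogeneous_polynomial d) F" and y: "y \<in> carrier Y" for F y and z :: "real ^ 'n::{finite,wellorder}"
    using F
  proof induction
    case (separable_prod a b)
    have ma: "mpoly a" by (rule mpoly_homogeneous_polynomial(1)[OF separable_prod(1)])
    have l: "laplacian (\<lambda>w. a w * t) z = laplacian a z * t" for t
      using laplacian_cmult[OF ma, of t] by (simp add: mult.commute)
    have "homogeneous_polynomial d (\<lambda>z. a z * \<Psi> b y)"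
      using homogeneous_polynomial_cmult[OF separable_prod(1), of "\<Psi> b y"] by (simp add: mult.commute)
    then show ?case
      using separable_prod(2) by (simp add: \<Psi>_mult[OF separable_prod(2) y] l mpoly_cmult)
  next
    case (separable_add F G)
    have mr: "mpoly (F z)" "mpoly (G z)" for z
      using separable_mpoly_right[OF separable_add(1)] separable_mpoly_right[OF separable_add(2)] by auto
    have ml: "mpoly (\<lambda>w. F w x)" "mpoly (\<lambda>w. G w x)" for x
      using separable_mpoly_left[OF separable_add(1) mpoly_homogeneous_polynomial(1)]
        separable_mpoly_left[OF separable_add(2) mpoly_homogeneous_polynomial(1)] by auto
    have mh: "mpoly (\<lambda>z. \<Psi> (F z) y)" "mpoly (\<lambda>z. \<Psi> (G z) y)"
      using separable_add(3,4) mpoly_homogeneous_polynomial(1) by auto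
    show ?case
      using separable_add(3,4)
      by (auto simp: \<Psi>_add[OF mr y] laplacian_add[OF ml] laplacian_add[OF mh] \<Psi>_add[OF _ _ y]
          intro: homogeneous_polynomial_add)
  qed
  define T where "T y = restrict (\<lambda>z. \<Psi> (zonal_kernel d z) y) S" for y
  have T_closed: "T y \<in> carrier X" if y: "y \<in> carrier Y" for y
  proof -
    \<comment> \<open>Evaluates the functional at the zero function, which is what remains in
      \<open>harm\<close> because the kernel is harmonic.\<close>
    have "\<Psi> (\<lambda>x. 0 * 0) y = 0 * \<Psi> (\<lambda>x. 0) y"
      by (rule \<Psi>_mult[OF _ y]) auto
    then have "laplacian (\<lambda>z. \<Psi> (zonal_kernel d z) y) z = 0" for z
      using harm[OF sep y, of z] by (simp add: laplacian_zonal_kernel[OF n])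
    then show ?thesis
      unfolding X_def carrier_spherical_harmonics T_def S_def using harm[OF sep y] by blast
  qed
  have T_norm: "cmod (T y z) \<le> c * vnorm Y y" if y: "y \<in> carrier Y" and z: "z \<in> S" for y z
  proof -
    have "cmod (T y z) \<le> (LINT x|sphere_measure. cmod (zonal_kernel d z x)) * vnorm Y y"
      using \<Psi>_norm[OF mz y, of z] z by (simp add: T_def)
    also have "\<dots> \<le> c * vnorm Y y"
      using c[of z] z vnorm_nonneg[OF y] by (intro mult_right_mono) (auto simp: S_def)
    finally show ?thesis .
  qed
  define P where "P y = I (T y)" for y
  have I_closed: "I h \<in> carrier Y" if "h \<in> carrier X" for h
    using I that by (auto simp: isometric_embedding_def complex_linear_map_def X_def)
  have P_norm: "vnorm Y (P y) \<le> c * vnorm Y y" if y: "y \<in> carrier Y" for y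
  proof -
    have "vnorm Y (P y) = vnorm X (T y)"
      using I T_closed[OF y] by (simp add: P_def isometric_embedding_def X_def del: spherical_harmonics_simps)
    also have "\<dots> \<le> c * vnorm Y y"
      unfolding X_def spherical_harmonics_simps
      by (rule cSUP_least) (use T_norm[OF y] in \<open>auto simp: S_def\<close>)
    finally show ?thesis .
  qed
  have "P \<in> bounded_projections (I ` carrier X) Y"
    unfolding bounded_projections_def bounded_operator_def complex_linear_map_def
  proof (intro CollectI conjI ballI allI)
    show "P \<in> carrier Y \<rightarrow> carrier Y" using T_closed I_closed by (auto simp: P_def)
    show "P (x \<oplus> y) = P x \<oplus> P y" if "x \<in> carrier Y" "y \<in> carrier Y" for x y
    proof -
      have "T (x \<oplus> y) = T x \<oplus>\<^bsub>X\<^esub> T y"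
        using that by (auto simp: T_def X_def S_def \<Psi>_add_right[OF mz])
      then show ?thesis
        using I T_closed that by (simp add: P_def isometric_embedding_def complex_linear_map_def X_def del: spherical_harmonics_simps)
    qed
    show "P (a \<odot> x) = a \<odot> P x" if "x \<in> carrier Y" for a x
    proof -
      have "T (a \<odot> x) = a \<odot>\<^bsub>X\<^esub> T x"
        using that by (auto simp: T_def X_def S_def \<Psi>_mult_right[OF mz])
      then show ?thesis
        using I T_closed that by (simp add: P_def isometric_embedding_def complex_linear_map_def X_def del: spherical_harmonics_simps)
    qed
    show "\<exists>K. \<forall>x\<in>carrier Y. vnorm Y (P x) \<le> K * vnorm Y x" using P_norm by blast
    show "P ` carrier Y \<subseteq> I ` carrier X" using T_closed by (auto simp: P_def)
    fix v assume "v \<in> I ` carrier X"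
    then obtain h where h: "homogeneous_polynomial d h" "\<And>x. laplacian h x = 0" "v = I (restrict h S)"
      by (auto simp: X_def carrier_spherical_harmonics S_def)
    \<comment> \<open>On the range of \<open>I\<close> the functional is the integral against h, so
      this is the reproducing property.\<close>
    have "T (I (restrict h S)) = restrict h S"
      unfolding T_def S_def
      by (rule restrict_ext) (simp add: \<Psi>_I[OF mz h(1,2)] zonal_kernel_reproducing[OF n _ h(1,2)])
    then show "P v = v" by (simp add: P_def h(3))
  qed
  moreover have "operator_norm Y Y P \<le> c"
    unfolding operator_norm_def
  proof (rule cSUP_least)
    show "{x \<in> carrier Y. vnorm Y x \<le> 1} \<noteq> {}"
      using vnorm_zero M.zero_closed by (metis (mono_tags, lifting) empty_Collect_eq zero_le_one)
    fix x assume x: "x \<in> {x \<in> carrier Y. vnorm Y x \<le> 1}"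
    obtain e :: "real ^ 'n::{finite,wellorder}" where "e \<in> sphere 0 1" using sphere_nonempty by blast
    then have "0 \<le> (LINT x|sphere_measure. cmod (zonal_kernel d e x))" "norm e = 1"
      by (auto intro!: integral_nonneg_AE)
    \<comment> \<open>Monotonicity in the norm over the unit ball needs a nonnegative
      constant.\<close>
    then have "0 \<le> c" using c[of e] by linarith
    then have "c * vnorm Y x \<le> c * 1" using x by (intro mult_left_mono) auto
    then show "vnorm Y (P x) \<le> c" using P_norm[of x] x by simp
  qed
  ultimately show ?thesis
    unfolding relative_projection_constant_def X_def by (intro INF_lower2[of P]) auto
qed

end

section \<open>The lower bound\<close>

lemma separable_mult_separable:
  assumes "separable A F" "separable B G" "\<And>a b. A a \<Longrightarrow> B b \<Longrightarrow> C (\<lambda>x. a x * b x)"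
  shows "separable C (\<lambda>x y. F x y * G x y)"
  using assms(1)
proof induction
  case (separable_prod a b)
  show ?case by (rule separable_mult_prod[OF assms(2)]) (use assms(3) separable_prod in auto)
next
  case (separable_add F G')
  from separable.separable_add[OF this(3,4)] show ?case by (simp add: distrib_right)
qed

text \<open>For a single product both iterated integrals are the product of two integrals; sums
  follow by linearity. The polynomiality of the partial integrals carries the induction.\<close>

lemma separable_fubini:
  fixes F :: "real ^ 'n \<Rightarrow> real ^ 'n \<Rightarrow> complex"
  assumes "separable A F" "\<And>a. A a \<Longrightarrow> mpoly a"
  shows "(LINT y|sphere_measure. LINT x|sphere_measure. F x y) = (LINT x|sphere_measure. LINT y|sphere_measure. F x y)
    \<and> mpoly (\<lambda>x. LINT y|sphere_measure. F x y) \<and> mpoly (\<lambda>y. LINT x|sphere_measure. F x y)"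
  using assms(1)
proof induction
  case (separable_prod a b)
  then show ?case using assms(2) by (simp add: mpoly_cmult mpoly_mult mpoly_const)
next
  case (separable_add F G)
  have 1: "mpoly (F x)" "mpoly (G x)" for x
    using separable_mpoly_right[OF separable_add(1)] separable_mpoly_right[OF separable_add(2)] .
  have 2: "mpoly (\<lambda>x. F x y)" "mpoly (\<lambda>x. G x y)" for y
    using separable_mpoly_left[OF separable_add(1) assms(2)] separable_mpoly_left[OF separable_add(2) assms(2)] by auto
  show ?case
    using separable_add(3,4)
    by (simp add: Bochner_Integration.integral_add integrable_sphere_mpoly 1 2 mpoly_add)
qed

lemma separable_poly_inner: "separable mpoly (\<lambda>x y :: real ^ 'n. of_real (poly G (x \<bullet> y)))"
proof (induction G)
  case 0
  show ?case using separable_prod[of mpoly "\<lambda>_. 0" "\<lambda>_. 0"] by (simp add: mpoly_const)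
next
  case (pCons c G)
  have "separable mpoly (\<lambda>x y :: real ^ 'n. of_real (x \<bullet> y) * of_real (poly G (x \<bullet> y)))"
    by (rule separable_inner_mult[OF pCons(2)]) auto
  moreover have "separable mpoly (\<lambda>x y :: real ^ 'n. of_real c * 1)"
    by (rule separable_prod) auto
  ultimately have "separable mpoly (\<lambda>x y :: real ^ 'n. of_real c * 1 + of_real (x \<bullet> y) * of_real (poly G (x \<bullet> y)))"
    by (intro separable_add)
  then show ?case by simp
qed

text \<open>The space C(S). Extensionality makes equality on the sphere equality of functions, in
  line with the restrictions that carry the spherical harmonics.\<close>

abbreviation sphere_functions :: "(real ^ 'n \<Rightarrow> complex) set" where
  "sphere_functions \<equiv> {f \<in> extensional (sphere 0 1). continuous_on (sphere 0 1) f}"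

lemma restrict_sphere_functions: "continuous_on (sphere 0 1) f \<Longrightarrow> restrict f (sphere 0 1) \<in> sphere_functions"
  using continuous_on_cong[of "sphere 0 1" "sphere 0 1" "restrict f (sphere 0 1)" f] by auto

lemma mpoly_sphere_functions: "mpoly p \<Longrightarrow> restrict p (sphere 0 1) \<in> sphere_functions"
  by (intro restrict_sphere_functions mpoly_continuous_on)

lemma spherical_harmonics_subset: "carrier (spherical_harmonics d) \<subseteq> sphere_functions"
proof
  fix f :: "real ^ 'a \<Rightarrow> complex" assume f: "f \<in> carrier (spherical_harmonics d)"
  then have "f \<in> extensional (sphere 0 1)" unfolding carrier_spherical_harmonics by blast
  then show "f \<in> sphere_functions" using continuous_on_spherical_harmonics[OF f] by blast
qed

text \<open>By the reproducing property and Funk--Hecke, \<open>\<integral> (Q G(\<langle>\<cdot>, y\<rangle>)) (y) d\<sigma>(y)\<close> does not depend on the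
  projection \<open>Q\<close>; this replaces averaging \<open>Q\<close> over the orthogonal group.\<close>

lemma projection_lower_bound_poly:
  fixes Q :: "(real ^ 'n::{finite,wellorder} \<Rightarrow> complex) \<Rightarrow> real ^ 'n::{finite,wellorder} \<Rightarrow> complex"
    and e :: "real ^ 'n::{finite,wellorder}"
  assumes n: "CARD('n) \<ge> 3"
    and Q_add: "\<And>f g. f \<in> sphere_functions \<Longrightarrow> g \<in> sphere_functions \<Longrightarrow>
      Q (\<lambda>x\<in>sphere 0 1. f x + g x) = (\<lambda>x\<in>sphere 0 1. Q f x + Q g x)"
    and Q_mult: "\<And>c f. f \<in> sphere_functions \<Longrightarrow> Q (\<lambda>x\<in>sphere 0 1. c * f x) = (\<lambda>x\<in>sphere 0 1. c * Q f x)"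
    and Q_range: "\<And>f. f \<in> sphere_functions \<Longrightarrow> Q f \<in> carrier (spherical_harmonics d)"
    and Q_id: "\<And>h. h \<in> carrier (spherical_harmonics d) \<Longrightarrow> Q h = h"
    and Q_norm: "\<And>f M x. f \<in> sphere_functions \<Longrightarrow> M > 0 \<Longrightarrow> (\<And>x. x \<in> sphere 0 1 \<Longrightarrow> cmod (f x) \<le> M) \<Longrightarrow>
      x \<in> sphere 0 1 \<Longrightarrow> cmod (Q f x) \<le> N * M"
    and e: "norm e = 1" and M: "M > 0" "\<And>t. t \<in> {-1..1} \<Longrightarrow> \<bar>poly G t\<bar> \<le> M"
  shows "(LINT y|sphere_measure. poly (zonal_poly CARD('n) d) (e \<bullet> y) * poly G (e \<bullet> y)) \<le> N * M"
proof -
  let ?S = "sphere (0 :: real ^ 'n::{finite,wellorder}) 1"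
  let ?z = "zonal_poly CARD('n) d"
  define F :: "real ^ 'n::{finite,wellorder} \<Rightarrow> real ^ 'n::{finite,wellorder} \<Rightarrow> complex" where
    "F x y = of_real (poly G (x \<bullet> y))" for x y
  note hp_mpoly = mpoly_homogeneous_polynomial(1)
  \<comment> \<open>\<open>K\<close> is \<open>Q\<close> applied in the first variable, extended off
    the sphere to a harmonic polynomial in \<open>z\<close>. The last clause says that
    \<open>Q\<close> commutes with integration in \<open>y\<close> against a polynomial; for
    separable \<open>F\<close> this is linearity.\<close>
  define image where "image F K \<longleftrightarrow> separable (homogeneous_polynomial d) K \<and> (\<forall>y z. laplacian (\<lambda>z. K z y) z = 0) \<and>
      (\<forall>y. Q (restrict (\<lambda>x. F x y) ?S) = restrict (\<lambda>z. K z y) ?S) \<and>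
      (\<forall>b. mpoly b \<longrightarrow> Q (restrict (\<lambda>x. LINT y|sphere_measure. b y * F x y) ?S)
        = restrict (\<lambda>z. LINT y|sphere_measure. b y * K z y) ?S)" for F K
  have imageD: "separable (homogeneous_polynomial d) K" "laplacian (\<lambda>z. K z y) z = 0"
      "Q (restrict (\<lambda>x. F x y) ?S) = restrict (\<lambda>z. K z y) ?S"
      "mpoly b \<Longrightarrow> Q (restrict (\<lambda>x. LINT y|sphere_measure. b y * F x y) ?S)
        = restrict (\<lambda>z. LINT y|sphere_measure. b y * K z y) ?S" if "image F K" for F K b y z
    using that unfolding image_def by simp_all
  have "\<exists>K. image F K"
    if "separable mpoly F" for F :: "real ^ 'n::{finite,wellorder} \<Rightarrow> real ^ 'n::{finite,wellorder} \<Rightarrow> complex"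
    using that
  proof induction
    case (separable_prod a b)
    define a' where "a' = restrict a ?S"
    have a': "a' \<in> sphere_functions" unfolding a'_def using separable_prod(1) by (rule mpoly_sphere_functions)
    obtain p where p: "homogeneous_polynomial d p" "\<And>x. laplacian p x = 0" "Q a' = restrict p ?S"
      using Q_range[OF a'] unfolding carrier_spherical_harmonics by blast
    have mult: "Q (restrict (\<lambda>x. a x * c) ?S) = restrict (\<lambda>z. p z * c) ?S" for c
    proof -
      have "restrict (\<lambda>x. a x * c) ?S = (\<lambda>x\<in>?S. c * a' x)" by (rule restrict_ext) (simp add: a'_def)
      then have "Q (restrict (\<lambda>x. a x * c) ?S) = (\<lambda>x\<in>?S. c * Q a' x)" using Q_mult[OF a'] by simp
      also have "\<dots> = restrict (\<lambda>z. p z * c) ?S" by (rule restrict_ext) (simp add: p(3))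
      finally show ?thesis .
    qed
    have l: "laplacian (\<lambda>z. p z * c) z = 0" for c z
      using laplacian_cmult[OF hp_mpoly[OF p(1)], of c z] p(2) by (simp add: mult.commute)
    show ?case
      unfolding image_def
    proof (intro exI[of _ "\<lambda>z y. p z * b y"] conjI allI impI)
      show "separable (homogeneous_polynomial d) (\<lambda>z y. p z * b y)"
        using p(1) separable_prod(2) by (rule separable.separable_prod)
      show "laplacian (\<lambda>z. p z * b y) z = 0" for y z by (rule l)
      show "Q (\<lambda>x\<in>?S. a x * b y) = (\<lambda>z\<in>?S. p z * b y)" for y by (rule mult)
      fix b' :: "real ^ 'n::{finite,wellorder} \<Rightarrow> complex" assume "mpoly b'"
      define r where "r = (LINT y|sphere_measure. b' y * b y)"
      have i: "(LINT y|sphere_measure. b' y * (c * b y)) = c * r" for c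
        by (simp add: r_def mult.left_commute[of _ c])
      show "Q (\<lambda>x\<in>?S. LINT y|sphere_measure. b' y * (a x * b y)) = (\<lambda>z\<in>?S. LINT y|sphere_measure. b' y * (p z * b y))"
        unfolding i by (rule mult)
    qed
  next
    case (separable_add F G)
    obtain K L where "image F K" "image G L"
      using separable_add(3,4) by blast
    note K = imageD[OF \<open>image F K\<close>] and L = imageD[OF \<open>image G L\<close>]
    have add: "Q (restrict (\<lambda>x. f x + g x) ?S) = restrict (\<lambda>x. Q (restrict f ?S) x + Q (restrict g ?S) x) ?S"
      if "mpoly f" "mpoly g" for f g
    proof -
      have "restrict (\<lambda>x. f x + g x) ?S = (\<lambda>x\<in>?S. restrict f ?S x + restrict g ?S x)" by (rule restrict_ext) simp
      then show ?thesis using Q_add[OF mpoly_sphere_functions mpoly_sphere_functions] that by simp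
    qed
    have ml: "mpoly (\<lambda>x. F x y)" "mpoly (\<lambda>x. G x y)" for y
      using separable_mpoly_left[OF separable_add(1)] separable_mpoly_left[OF separable_add(2)] by auto
    have mr: "mpoly (F x)" "mpoly (G x)" "mpoly (K x)" "mpoly (L x)" for x
      using separable_mpoly_right separable_add(1,2) K(1) L(1) by blast+
    have mkl: "mpoly (\<lambda>x. K x y)" "mpoly (\<lambda>x. L x y)" for y
      using separable_mpoly_left[OF K(1) hp_mpoly] separable_mpoly_left[OF L(1) hp_mpoly] by auto
    have int: "mpoly (\<lambda>x. LINT y|sphere_measure. b y * H x y)" if "mpoly b" "separable mpoly H" for b H
    proof -
      have "separable mpoly (\<lambda>x y. 1 * b y * H x y)"
        by (rule separable_mult_prod[OF that(2)]) (use that in auto)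
      then show ?thesis using separable_fubini[of mpoly "\<lambda>x y. b y * H x y"] by simp
    qed
    show ?case
      unfolding image_def
    proof (intro exI[of _ "\<lambda>z y. K z y + L z y"] conjI allI impI)
      show "separable (homogeneous_polynomial d) (\<lambda>z y. K z y + L z y)"
        using K(1) L(1) by (rule separable.separable_add)
      show "laplacian (\<lambda>z. K z y + L z y) z = 0" for y z
        by (simp add: laplacian_add mkl K(2) L(2))
      show "Q (\<lambda>x\<in>?S. F x y + G x y) = (\<lambda>z\<in>?S. K z y + L z y)" for y
        unfolding add[OF ml] K(3) L(3) by (rule restrict_ext) simp
      fix b :: "real ^ 'n::{finite,wellorder} \<Rightarrow> complex" assume b: "mpoly b"
      have split: "(LINT y|sphere_measure. b y * (f y + g y))
          = (LINT y|sphere_measure. b y * f y) + (LINT y|sphere_measure. b y * g y)"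
        if "mpoly f" "mpoly g" for f g
        using b that by (simp add: distrib_left Bochner_Integration.integral_add integrable_sphere_mpoly mpoly_mult)
      show "Q (\<lambda>x\<in>?S. LINT y|sphere_measure. b y * (F x y + G x y)) = (\<lambda>z\<in>?S. LINT y|sphere_measure. b y * (K z y + L z y))"
        unfolding split[OF mr(1,2)] split[OF mr(3,4)] add[OF int[OF b separable_add(1)] int[OF b separable_add(2)]]
          K(4)[OF b] L(4)[OF b]
        by (rule restrict_ext) simp
    qed
  qed
  moreover have "separable mpoly F" unfolding F_def[abs_def] by (rule separable_poly_inner)
  ultimately obtain K where "image F K" by blast
  note K = imageD[OF this]
  have K_hp: "homogeneous_polynomial d (\<lambda>z. K z y)" for y
    using K(1)
  proof induction
    case (separable_prod a b)
    then show ?case using homogeneous_polynomial_cmult[of d a "b y"] by (simp add: mult.commute)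
  qed (rule homogeneous_polynomial_add)
  have mz: "mpoly (zonal_kernel d z)" for z :: "real ^ 'n::{finite,wellorder}"
    by (rule separable_mpoly_right[OF separable_zonal_kernel])
  define l where "l = fh_sum CARD('n) G d"
  have fh: "(LINT y|sphere_measure. zonal_kernel d w y * F x y) = of_real l * zonal_kernel d w x" if "x \<in> ?S" for w x
  proof -
    have "mpoly (zonal_kernel d w)" "scaling d (zonal_kernel d w)" "laplacian (zonal_kernel d w) y = 0" for y
      using mpoly_homogeneous_polynomial[OF homogeneous_polynomial_zonal_kernel[of d w]] laplacian_zonal_kernel[OF n, of d w y]
      unfolding zonal_kernel_commute[of d _ w] by auto
    then show ?thesis
      using funk_hecke_poly[of x "zonal_kernel d w" d G] n that by (simp add: F_def l_def mult.commute)
  qed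
  have diag: "zonal_kernel d w w = of_real (poly ?z 1)" if "w \<in> ?S" for w
    using zonal_kernel_sphere[OF n, of w w d] that by (simp add: norm_eq_1)
  interpret prob_space "sphere_measure :: (real ^ 'n::{finite,wellorder}) measure" by (rule prob_space_sphere_measure)
  have sep: "separable mpoly (\<lambda>w y. zonal_kernel d w y * K w y)"
    by (rule separable_mult_separable[OF separable_zonal_kernel K(1)]) (auto dest: hp_mpoly)
  have mK: "mpoly (\<lambda>y. K y y)"
    using K(1) by induction (auto dest: hp_mpoly)
  \<comment> \<open>For each y the function \<open>K z y\<close> of z lies in H, so the reproducing
    property recovers its value at z = y. This sets up an exchange of the integrals.\<close>
  have "(LINT y|sphere_measure. K y y) = (LINT y|sphere_measure. LINT w|sphere_measure. zonal_kernel d w y * K w y)"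
  proof (rule integral_cong_AE)
    show "AE y in sphere_measure. K y y = (LINT w|sphere_measure. zonal_kernel d w y * K w y)"
      using AE_sphere_measure
    proof eventually_elim
      case (elim y)
      then show ?case
        using zonal_kernel_reproducing[OF n _ K_hp K(2), of y y] by (simp add: zonal_kernel_commute[of d _ y])
    qed
    show "(\<lambda>y. K y y) \<in> borel_measurable sphere_measure"
      by (rule borel_measurable_integrable) (use mK in auto)
    show "(\<lambda>y. LINT w|sphere_measure. zonal_kernel d w y * K w y) \<in> borel_measurable sphere_measure"
      using separable_fubini[OF sep] by (intro borel_measurable_integrable) auto
  qed
  also have "\<dots> = (LINT w|sphere_measure. LINT y|sphere_measure. zonal_kernel d w y * K w y)"
    using separable_fubini[OF sep] by blast
  \<comment> \<open>After the exchange, the integral over y is \<open>Q\<close> applied to the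
    convolution of \<open>F\<close> with the kernel at w. By Funk-Hecke this convolution is
    \<open>l\<close> times the kernel, an element of H that \<open>Q\<close> fixes, and the kernel
    has the same value at every point of the diagonal.\<close>
  also have "\<dots> = (LINT w|(sphere_measure :: (real ^ 'n::{finite,wellorder}) measure). of_real (l * poly ?z 1))"
  proof (rule integral_cong_AE)
    show "(\<lambda>w. LINT y|sphere_measure. zonal_kernel d w y * K w y) \<in> borel_measurable sphere_measure"
      using separable_fubini[OF sep] by (intro borel_measurable_integrable) auto
    show "AE w in sphere_measure. (LINT y|sphere_measure. zonal_kernel d w y * K w y) = of_real (l * poly ?z 1)"
      using AE_sphere_measure
    proof eventually_elim
      case (elim w)
      define h where "h = restrict (\<lambda>x. zonal_kernel d x w) ?S"
      have h: "h \<in> carrier (spherical_harmonics d)"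
        unfolding carrier_spherical_harmonics h_def
        using homogeneous_polynomial_zonal_kernel laplacian_zonal_kernel[OF n] by blast
      have "restrict (\<lambda>x. LINT y|sphere_measure. zonal_kernel d w y * F x y) ?S = (\<lambda>x\<in>?S. of_real l * h x)"
        by (rule restrict_ext) (auto simp: fh h_def intro: zonal_kernel_commute)
      then have "(\<lambda>z\<in>?S. LINT y|sphere_measure. zonal_kernel d w y * K z y) = Q (\<lambda>x\<in>?S. of_real l * h x)"
        using K(4)[OF mz[of w]] by (simp only:)
      also have "\<dots> = (\<lambda>x\<in>?S. of_real l * Q h x)"
        by (rule Q_mult[OF subsetD[OF spherical_harmonics_subset h]])
      finally have "(\<lambda>z\<in>?S. LINT y|sphere_measure. zonal_kernel d w y * K z y) = (\<lambda>x\<in>?S. of_real l * Q h x)" .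
      from fun_cong[OF this, of w] show ?case
        using elim Q_id[OF h] diag[OF elim] by (simp add: h_def)
    qed
  qed simp
  also have "\<dots> = of_real (l * poly ?z 1)" using prob_space by simp
  finally have A: "(LINT y|sphere_measure. K y y) = of_real (l * poly ?z 1)" .
  have "cmod (LINT y|sphere_measure. K y y) \<le> (LINT y|sphere_measure. cmod (K y y))"
    by (rule integral_norm_bound)
  also have "\<dots> \<le> (LINT y|(sphere_measure :: (real ^ 'n::{finite,wellorder}) measure). N * M)"
  proof (rule integral_mono_AE)
    show "AE y in sphere_measure. cmod (K y y) \<le> N * M"
      using AE_sphere_measure
    proof eventually_elim
      case (elim y)
      have "cmod (Q (restrict (\<lambda>x. F x y) ?S) y) \<le> N * M"
      proof (rule Q_norm[OF _ M(1) _ elim])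
        show "restrict (\<lambda>x. F x y) ?S \<in> sphere_functions"
          unfolding F_def by (rule mpoly_sphere_functions) (auto simp: inner_commute[of _ y])
        fix x assume x: "x \<in> ?S"
        then have "x \<bullet> y \<in> {-1..1}"
          using Cauchy_Schwarz_ineq2[of x y] elim by (auto simp: abs_le_iff)
        then show "cmod (restrict (\<lambda>x. F x y) ?S x) \<le> M" using x M(2) by (simp add: F_def)
      qed
      then show ?case using elim unfolding K(3) by simp
    qed
    show "integrable sphere_measure (\<lambda>y. cmod (K y y))"
      by (intro integrable_norm integrable_sphere_mpoly mK)
  qed simp
  also have "\<dots> = N * M" using prob_space by simp
  finally have "l * poly ?z 1 \<le> N * M" unfolding A by (simp only: norm_of_real)
  \<comment> \<open>The same Funk-Hecke formula, now with both points equal to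
    \<open>e\<close>.\<close>
  moreover have "(LINT y|sphere_measure. poly ?z (e \<bullet> y) * poly G (e \<bullet> y)) = l * poly ?z 1"
  proof -
    have "of_real (LINT y|sphere_measure. poly ?z (e \<bullet> y) * poly G (e \<bullet> y))
        = (LINT y|sphere_measure. complex_of_real (poly ?z (e \<bullet> y) * poly G (e \<bullet> y)))"
      by (simp only: integral_complex_of_real)
    also have "\<dots> = (LINT y|sphere_measure. zonal_kernel d e y * F e y)"
    proof (rule integral_cong_AE)
      show "AE y in sphere_measure. complex_of_real (poly ?z (e \<bullet> y) * poly G (e \<bullet> y)) = zonal_kernel d e y * F e y"
        using AE_sphere_measure by eventually_elim (simp add: zonal_kernel_sphere[OF n e] F_def)
      show "(\<lambda>y. complex_of_real (poly ?z (e \<bullet> y) * poly G (e \<bullet> y))) \<in> borel_measurable sphere_measure"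
        unfolding of_real_mult by (rule borel_measurable_integrable) auto
      show "(\<lambda>y. zonal_kernel d e y * F e y) \<in> borel_measurable sphere_measure"
        unfolding F_def by (rule borel_measurable_integrable) (use mz in auto)
    qed
    also have "\<dots> = of_real (l * poly ?z 1)" using fh[of e e] diag[of e] e by simp
    finally show ?thesis by (simp only: of_real_eq_iff)
  qed
  ultimately show ?thesis by simp
qed

lemma projection_lower_bound:
  fixes Q :: "(real ^ 'n::{finite,wellorder} \<Rightarrow> complex) \<Rightarrow> real ^ 'n::{finite,wellorder} \<Rightarrow> complex"
    and e :: "real ^ 'n::{finite,wellorder}"
  assumes n: "CARD('n) \<ge> 3"
    and Q: "\<And>f g. f \<in> sphere_functions \<Longrightarrow> g \<in> sphere_functions \<Longrightarrow>
        Q (\<lambda>x\<in>sphere 0 1. f x + g x) = (\<lambda>x\<in>sphere 0 1. Q f x + Q g x)"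
      "\<And>c f. f \<in> sphere_functions \<Longrightarrow> Q (\<lambda>x\<in>sphere 0 1. c * f x) = (\<lambda>x\<in>sphere 0 1. c * Q f x)"
      "\<And>f. f \<in> sphere_functions \<Longrightarrow> Q f \<in> carrier (spherical_harmonics d)"
      "\<And>h. h \<in> carrier (spherical_harmonics d) \<Longrightarrow> Q h = h"
      "\<And>f M x. f \<in> sphere_functions \<Longrightarrow> M > 0 \<Longrightarrow> (\<And>x. x \<in> sphere 0 1 \<Longrightarrow> cmod (f x) \<le> M) \<Longrightarrow>
        x \<in> sphere 0 1 \<Longrightarrow> cmod (Q f x) \<le> N * M"
    and e: "norm e = 1"
  shows "(LINT y|sphere_measure. \<bar>poly (zonal_poly CARD('n) d) (e \<bullet> y)\<bar>) \<le> N"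
proof -
  interpret prob_space "sphere_measure :: (real ^ 'n::{finite,wellorder}) measure" by (rule prob_space_sphere_measure)
  define z where "z = poly (zonal_poly CARD('n) d)"
  define c where "c = (LINT y|sphere_measure. \<bar>z (e \<bullet> y)\<bar>)"
  have cont: "continuous_on UNIV (\<lambda>y. g (e \<bullet> y))" if "continuous_on UNIV g" for g :: "real \<Rightarrow> real"
    by (rule continuous_on_compose2[OF that]) (auto intro!: continuous_intros)
  have cz: "continuous_on UNIV z" unfolding z_def by (intro continuous_intros)
  have c0: "c \<ge> 0" unfolding c_def by (intro integral_nonneg_AE) auto
  have est: "c \<le> N + t * (1 + N + c)" if t: "t > 0" for t
  proof -
    \<comment> \<open>A continuous substitute for the sign of \<open>z\<close>: it is bounded by 1,
      and \<open>z u * f u\<close> differs from |z u| by at most \<open>t\<close>.\<close>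
    define f where "f u = z u / (\<bar>z u\<bar> + t)" for u
    have pos: "\<bar>z u\<bar> + t > 0" for u using t by (simp add: add_nonneg_pos)
    have cf: "continuous_on UNIV f"
      unfolding f_def using pos by (intro continuous_intros cz) (metis less_irrefl)
    have f1: "\<bar>f u\<bar> \<le> 1" for u using pos[of u] t by (simp add: f_def abs_divide)
    have zf: "\<bar>z u\<bar> - t \<le> z u * f u" for u
    proof -
      have "(\<bar>z u\<bar> - t) * (\<bar>z u\<bar> + t) \<le> z u * z u" using t by (simp add: algebra_simps)
      then show ?thesis using pos[of u] by (simp add: f_def pos_le_divide_eq)
    qed
    obtain G where G: "\<And>u. u \<in> {-1..1} \<Longrightarrow> \<bar>f u - poly G u\<bar> < t"
      using weierstrass_poly[OF continuous_on_subset[OF cf] t] by auto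
    have G1: "\<bar>poly G u\<bar> \<le> 1 + t" if "u \<in> {-1..1}" for u
      using G[OF that] f1[of u] by linarith
    have cG: "continuous_on UNIV (poly G)" by (intro continuous_intros)
    have "c - t - t * c = (LINT y|sphere_measure. \<bar>z (e \<bullet> y)\<bar> - t - t * \<bar>z (e \<bullet> y)\<bar>)"
    proof -
      have "integrable sphere_measure (\<lambda>y. \<bar>z (e \<bullet> y)\<bar>)" "integrable sphere_measure (\<lambda>y. t * \<bar>z (e \<bullet> y)\<bar>)"
        by (intro integrable_sphere_measure continuous_intros cont cz)+
      moreover have "integrable sphere_measure (\<lambda>y :: real ^ 'n::{finite,wellorder}. \<bar>z (e \<bullet> y)\<bar> - t)"
        by (intro integrable_sphere_measure continuous_intros cont cz)
      ultimately have "(LINT y|sphere_measure. \<bar>z (e \<bullet> y)\<bar> - t - t * \<bar>z (e \<bullet> y)\<bar>)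
          = (LINT y|sphere_measure. \<bar>z (e \<bullet> y)\<bar>) - (LINT y|(sphere_measure :: (real ^ 'n::{finite,wellorder}) measure). t)
            - (LINT y|sphere_measure. t * \<bar>z (e \<bullet> y)\<bar>)"
        by (subst Bochner_Integration.integral_diff, simp, simp, subst Bochner_Integration.integral_diff) simp_all
      then show ?thesis using prob_space by (simp add: c_def)
    qed
    also have "\<dots> \<le> (LINT y|sphere_measure. z (e \<bullet> y) * poly G (e \<bullet> y))"
    proof (rule integral_mono_AE)
      show "AE y in sphere_measure. \<bar>z (e \<bullet> y)\<bar> - t - t * \<bar>z (e \<bullet> y)\<bar> \<le> z (e \<bullet> y) * poly G (e \<bullet> y)"
        using AE_sphere_measure
      proof eventually_elim
        case (elim y)
        let ?u = "e \<bullet> y"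
        have u: "?u \<in> {-1..1}" using Cauchy_Schwarz_ineq2[of e y] e elim by (auto simp: abs_le_iff)
        have "\<bar>z ?u * (f ?u - poly G ?u)\<bar> \<le> \<bar>z ?u\<bar> * t"
          unfolding abs_mult using G[OF u] by (intro mult_left_mono) auto
        then show ?case using zf[of ?u] by (simp add: algebra_simps)
      qed
    qed (auto intro!: integrable_sphere_measure continuous_intros cont cz cG)
    \<comment> \<open>The approximating polynomial may exceed 1, but on [-1, 1] by at most
      \<open>t\<close>.\<close>
    also have "\<dots> \<le> N * (1 + t)"
      unfolding z_def by (rule projection_lower_bound_poly[OF n Q e _ G1]) (use t in auto)
    finally show ?thesis by (simp add: algebra_simps)
  qed
  have "c \<le> N"
  proof (rule ccontr)
    assume "\<not> c \<le> N"
    then have gap: "c - N > 0" by simp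
    show False
    \<comment> \<open>The sign of \<open>N\<close> is not known. If the coefficient of
      \<open>t\<close> in \<open>est\<close> is positive, a small \<open>t\<close> contradicts the
      gap; otherwise \<open>t = 1\<close> already does.\<close>
    proof (cases "1 + N + c > 0")
      case True
      have "a / (2 * b) * b = a / 2" if "b > 0" for a b :: real using that by simp
      from this[OF True, of "c - N"] show False using est[of "(c - N) / (2 * (1 + N + c))"] gap True by simp
    next
      case False
      then show False using est[of 1] gap c0 by simp
    qed
  qed
  then show ?thesis by (simp add: c_def z_def)
qed

text \<open>C(S) has at most the cardinality of the continuum: a continuous function is determined
  by its values on a countable dense set, and these by the rationals below their real and imaginary
  parts, which makes one set of natural numbers.\<close>

lemma inj_sphere_functions:
  assumes "\<exists>f :: real \<Rightarrow> 'b. inj f"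
  shows "\<exists>j :: (real ^ 'n \<Rightarrow> complex) \<Rightarrow> 'b. inj_on j sphere_functions"
proof -
  let ?S = "sphere (0 :: real ^ 'n) 1"
  obtain T where T: "countable T" "T \<subseteq> ?S" "?S \<subseteq> closure T" using separable by metis
  have "T \<noteq> {}" using T(3) sphere_nonempty by auto
  define e where "e = from_nat_into T"
  have e: "range e = T" unfolding e_def using \<open>T \<noteq> {}\<close> T(1) by (rule range_from_nat_into)
  define code :: "(real ^ 'n \<Rightarrow> complex) \<Rightarrow> nat set" where
    "code f = to_nat ` {(k, b, r). real_of_rat r < (if b then Re (f (e k)) else Im (f (e k)))}" for f
  have inj: "inj_on code sphere_functions"
  proof (rule inj_onI)
    fix f g :: "real ^ 'n \<Rightarrow> complex"
    assume fg: "f \<in> sphere_functions" "g \<in> sphere_functions" "code f = code g"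
    have sets: "{(k, b, r). real_of_rat r < (if b then Re (f (e k)) else Im (f (e k)))}
        = {(k, b, r). real_of_rat r < (if b then Re (g (e k)) else Im (g (e k)))}"
      using fg(3) unfolding code_def by (simp only: inj_image_eq_iff[OF inj_to_nat])
    have rat: "u = v" if "\<And>r. real_of_rat r < u \<longleftrightarrow> real_of_rat r < v" for u v :: real
    proof (rule ccontr)
      assume "u \<noteq> v"
      then consider "u < v" | "v < u" by linarith
      then show False by cases (use of_rat_dense that in \<open>metis less_asym less_trans\<close>)+
    qed
    have "f (e k) = g (e k)" for k
    proof (rule complex_eqI)
      show "Re (f (e k)) = Re (g (e k))"
        by (rule rat) (use sets in \<open>auto simp: set_eq_iff split: if_splits\<close>)
      show "Im (f (e k)) = Im (g (e k))"
        by (rule rat) (use sets in \<open>auto simp: set_eq_iff split: if_splits\<close>)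
    qed
    then have eqT: "f t = g t" if "t \<in> T" for t using that e by auto
    have eqS: "f x = g x" if x: "x \<in> ?S" for x
    proof -
      have "x \<in> closure T" using T(3) x by blast
      then obtain s where s: "\<forall>k :: nat. s k \<in> T" "s \<longlonglongrightarrow> x"
        unfolding closure_sequential by blast
      have sS: "s k \<in> ?S" for k using s(1) T(2) by blast
      have "(\<lambda>k. f (s k)) \<longlonglongrightarrow> f x" "(\<lambda>k. g (s k)) \<longlonglongrightarrow> g x"
        using fg(1,2) x s(2) sS unfolding continuous_on_sequentially by (auto simp: comp_def)
      moreover have "(\<lambda>k. f (s k)) = (\<lambda>k. g (s k))" using eqT s(1) by auto
      ultimately show ?thesis using LIMSEQ_unique by metis
    qed
    show "f = g"
    proof (rule extensionalityI[of _ ?S])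
      show "f \<in> extensional ?S" "g \<in> extensional ?S" using fg(1,2) by blast+
    qed (rule eqS)
  qed
  obtain h :: "nat set \<Rightarrow> real" where "inj h"
    using nat_sets_eqpoll_reals unfolding eqpoll_def bij_betw_def by blast
  moreover obtain i :: "real \<Rightarrow> 'b" where "inj i" using assms by blast
  ultimately have "inj (i \<circ> h)" by (rule inj_compose[rotated])
  then have "inj_on ((i \<circ> h) \<circ> code) sphere_functions"
    using inj by (meson comp_inj_on inj_on_subset subset_UNIV)
  then show ?thesis by blast
qed

section \<open>Embedding into the continuous functions\<close>

lemma sup_sphere_le:
  fixes f :: "real ^ 'n \<Rightarrow> complex"
  assumes "\<And>x. x \<in> sphere 0 1 \<Longrightarrow> cmod (f x) \<le> M"
  shows "(SUP x\<in>sphere 0 1. cmod (f x)) \<le> M"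
  by (rule cSUP_least) (use assms in simp_all)

lemma sup_sphere_nonneg:
  fixes f :: "real ^ 'n \<Rightarrow> complex"
  assumes "continuous_on (sphere 0 1) f"
  shows "0 \<le> (SUP x\<in>sphere 0 1. cmod (f x))"
proof -
  obtain x :: "real ^ 'n" where "x \<in> sphere 0 1" using sphere_nonempty by blast
  from cmod_le_sup_sphere[OF assms this] show ?thesis using norm_ge_zero order.trans by blast
qed

text \<open>Transports the Banach space C(S) along an injection into the type over which the
  projection constant takes its supremum.\<close>

locale encoded_sphere_functions =
  fixes j :: "(real ^ 'n \<Rightarrow> complex) \<Rightarrow> 'b"
  assumes inj_j: "inj_on j sphere_functions"
begin

abbreviation S :: "(real ^ 'n) set" where "S \<equiv> sphere 0 1"
abbreviation C :: "(real ^ 'n \<Rightarrow> complex) set" where "C \<equiv> sphere_functions"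

definition D :: "'b \<Rightarrow> real ^ 'n \<Rightarrow> complex" where "D = inv_into C j"

definition Y :: "'b normed_structure" where
  "Y = \<lparr>carrier = j ` C, monoid.mult = undefined, one = undefined, zero = j (\<lambda>x\<in>S. 0),
    add = (\<lambda>a b. j (\<lambda>x\<in>S. D a x + D b x)), smult = (\<lambda>c a. j (\<lambda>x\<in>S. c * D a x)),
    vnorm = (\<lambda>a. SUP x\<in>S. cmod (D a x))\<rparr>"

lemma D_j [simp]: "f \<in> C \<Longrightarrow> D (j f) = f"
  unfolding D_def by (rule inv_into_f_f[OF inj_j])

lemma Y_simps: "carrier Y = j ` C" "\<zero>\<^bsub>Y\<^esub> = j (\<lambda>x\<in>S. 0)" "a \<oplus>\<^bsub>Y\<^esub> b = j (\<lambda>x\<in>S. D a x + D b x)"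
  "c \<odot>\<^bsub>Y\<^esub> a = j (\<lambda>x\<in>S. c * D a x)" "vnorm Y a = (SUP x\<in>S. cmod (D a x))"
  by (simp_all add: Y_def)

lemma C_continuous: "f \<in> C \<Longrightarrow> continuous_on S f" by blast

lemma C_zero: "(\<lambda>x\<in>S. 0) \<in> C"
  by (intro restrict_sphere_functions continuous_intros)

lemma C_add: "f \<in> C \<Longrightarrow> g \<in> C \<Longrightarrow> (\<lambda>x\<in>S. f x + g x) \<in> C"
  by (intro restrict_sphere_functions continuous_intros C_continuous)

lemma C_smult: "f \<in> C \<Longrightarrow> (\<lambda>x\<in>S. c * f x) \<in> C"
  by (intro restrict_sphere_functions continuous_intros C_continuous)

lemma C_ext: "f \<in> C \<Longrightarrow> restrict f S = f"
  by (intro extensional_restrict) blast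

lemma j_eqI: "(\<And>x. x \<in> S \<Longrightarrow> f x = g x) \<Longrightarrow> j (restrict f S) = j (restrict g S)"
  by (rule arg_cong[of _ _ j]) (rule restrict_ext)

lemma j_add: "f \<in> C \<Longrightarrow> g \<in> C \<Longrightarrow> j f \<oplus>\<^bsub>Y\<^esub> j g = j (\<lambda>x\<in>S. f x + g x)"
  by (simp add: Y_simps)

lemma j_smult: "f \<in> C \<Longrightarrow> c \<odot>\<^bsub>Y\<^esub> j f = j (\<lambda>x\<in>S. c * f x)"
  by (simp add: Y_simps)

lemma j_norm: "f \<in> C \<Longrightarrow> vnorm Y (j f) = (SUP x\<in>S. cmod (f x))"
  by (simp add: Y_simps)

lemma j_restrict_eq: "f \<in> C \<Longrightarrow> (\<And>x. x \<in> S \<Longrightarrow> g x = f x) \<Longrightarrow> j (restrict g S) = j f"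
  using j_eqI[of g f] C_ext[of f] by simp

sublocale Y: complex_normed_space Y
  unfolding complex_normed_space_def complex_normed_space_axioms_def
proof (intro conjI allI impI)
  show "Module.module complex_field Y"
  proof (rule moduleI)
    show "abelian_group Y"
    proof (rule abelian_groupI)
      fix a assume "a \<in> carrier Y"
      then obtain f where f: "f \<in> C" "a = j f" unfolding Y_simps by blast
      have "j (\<lambda>x\<in>S. - 1 * f x) \<oplus>\<^bsub>Y\<^esub> a = \<zero>\<^bsub>Y\<^esub>"
        unfolding f(2) j_add[OF C_smult[OF f(1)] f(1)] Y_simps(2) by (rule j_eqI) simp
      moreover have "j (\<lambda>x\<in>S. - 1 * f x) \<in> carrier Y"
        unfolding Y_simps using C_smult[OF f(1)] by (rule imageI)
      ultimately show "\<exists>b\<in>carrier Y. b \<oplus>\<^bsub>Y\<^esub> a = \<zero>\<^bsub>Y\<^esub>" by blast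
    next
      fix a b assume "a \<in> carrier Y" "b \<in> carrier Y"
      then obtain f g where f: "f \<in> C" "a = j f" and g: "g \<in> C" "b = j g" unfolding Y_simps by blast
      show "a \<oplus>\<^bsub>Y\<^esub> b \<in> carrier Y"
        unfolding f(2) g(2) j_add[OF f(1) g(1)] unfolding Y_simps using C_add[OF f(1) g(1)] by (rule imageI)
      show "a \<oplus>\<^bsub>Y\<^esub> b = b \<oplus>\<^bsub>Y\<^esub> a"
        unfolding f(2) g(2) j_add[OF f(1) g(1)] j_add[OF g(1) f(1)] by (rule j_eqI) simp
      fix c assume "c \<in> carrier Y"
      then obtain h where h: "h \<in> C" "c = j h" unfolding Y_simps by blast
      show "a \<oplus>\<^bsub>Y\<^esub> b \<oplus>\<^bsub>Y\<^esub> c = a \<oplus>\<^bsub>Y\<^esub> (b \<oplus>\<^bsub>Y\<^esub> c)"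
        unfolding f(2) g(2) h(2) j_add[OF f(1) g(1)] j_add[OF g(1) h(1)] j_add[OF C_add[OF f(1) g(1)] h(1)]
          j_add[OF f(1) C_add[OF g(1) h(1)]]
        by (rule j_eqI) simp
    next
      show "\<zero>\<^bsub>Y\<^esub> \<in> carrier Y" unfolding Y_simps using C_zero by (rule imageI)
      fix a assume "a \<in> carrier Y"
      then obtain f where f: "f \<in> C" "a = j f" unfolding Y_simps by blast
      show "\<zero>\<^bsub>Y\<^esub> \<oplus>\<^bsub>Y\<^esub> a = a"
        unfolding f(2) Y_simps(2) j_add[OF C_zero f(1)] by (rule j_restrict_eq[OF f(1)]) simp
    qed
  next
    fix c a assume "a \<in> carrier Y"
    then obtain f where f: "f \<in> C" "a = j f" unfolding Y_simps by blast
    show "c \<odot>\<^bsub>Y\<^esub> a \<in> carrier Y"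
      unfolding f(2) j_smult[OF f(1)] unfolding Y_simps using C_smult[OF f(1)] by (rule imageI)
    show "(c \<oplus>\<^bsub>complex_field\<^esub> c') \<odot>\<^bsub>Y\<^esub> a = c \<odot>\<^bsub>Y\<^esub> a \<oplus>\<^bsub>Y\<^esub> c' \<odot>\<^bsub>Y\<^esub> a" for c'
      unfolding f(2) j_smult[OF f(1)] j_add[OF C_smult[OF f(1)] C_smult[OF f(1)]]
      by (rule j_eqI) (simp add: distrib_right)
    show "(c \<otimes>\<^bsub>complex_field\<^esub> c') \<odot>\<^bsub>Y\<^esub> a = c \<odot>\<^bsub>Y\<^esub> (c' \<odot>\<^bsub>Y\<^esub> a)" for c'
      unfolding f(2) j_smult[OF f(1)] j_smult[OF C_smult[OF f(1)]]
      by (rule j_eqI) simp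
    show "\<one>\<^bsub>complex_field\<^esub> \<odot>\<^bsub>Y\<^esub> a = a"
      unfolding f(2) j_smult[OF f(1)] by (rule j_restrict_eq[OF f(1)]) simp
    fix b assume "b \<in> carrier Y"
    then obtain g where g: "g \<in> C" "b = j g" unfolding Y_simps by blast
    show "c \<odot>\<^bsub>Y\<^esub> (a \<oplus>\<^bsub>Y\<^esub> b) = c \<odot>\<^bsub>Y\<^esub> a \<oplus>\<^bsub>Y\<^esub> c \<odot>\<^bsub>Y\<^esub> b"
      unfolding f(2) g(2) j_add[OF f(1) g(1)] j_smult[OF C_add[OF f(1) g(1)]] j_smult[OF f(1)] j_smult[OF g(1)]
        j_add[OF C_smult[OF f(1)] C_smult[OF g(1)]]
      by (rule j_eqI) (simp add: distrib_left)
  qed (rule cring_complex_field)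
next
  fix a assume "a \<in> carrier Y"
  then obtain f where f: "f \<in> C" "a = j f" unfolding Y_simps by blast
  note cf = C_continuous[OF f(1)]
  show "0 \<le> vnorm Y a" unfolding f(2) j_norm[OF f(1)] by (rule sup_sphere_nonneg[OF cf])
  show "(vnorm Y a = 0) = (a = \<zero>\<^bsub>Y\<^esub>)"
  proof
    assume "vnorm Y a = 0"
    then have "f x = 0" if "x \<in> S" for x
      using cmod_le_sup_sphere[OF cf that] unfolding f(2) j_norm[OF f(1)] by simp
    then show "a = \<zero>\<^bsub>Y\<^esub>" unfolding f(2) Y_simps(2) by (intro j_restrict_eq[symmetric] f(1)) simp
  next
    assume "a = \<zero>\<^bsub>Y\<^esub>"
    then have "f = (\<lambda>x\<in>S. 0)"
      using inj_onD[OF inj_j _ f(1) C_zero] unfolding f(2) Y_simps(2) by blast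
    moreover have "vnorm Y (j (\<lambda>x\<in>S. 0)) = 0"
      unfolding j_norm[OF C_zero]
      by (intro antisym sup_sphere_le sup_sphere_nonneg C_continuous[OF C_zero]) simp
    ultimately show "vnorm Y a = 0" by (simp only: f(2))
  qed
  show "vnorm Y (c \<odot>\<^bsub>Y\<^esub> a) = cmod c * vnorm Y a" for c
  proof (rule antisym)
    \<comment> \<open>One inequality suffices: applied to the inverse of a nonzero \<open>c\<close>
      it yields the other.\<close>
    have le: "vnorm Y (j (\<lambda>x\<in>S. c * g x)) \<le> cmod c * vnorm Y (j g)" if g: "g \<in> C" for c g
      unfolding j_norm[OF C_smult[OF g]] j_norm[OF g]
      using cmod_le_sup_sphere[OF C_continuous[OF g]]
      by (intro sup_sphere_le) (simp add: norm_mult mult_left_mono)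
    show "vnorm Y (c \<odot>\<^bsub>Y\<^esub> a) \<le> cmod c * vnorm Y a"
      unfolding f(2) j_smult[OF f(1)] by (rule le[OF f(1)])
    show "cmod c * vnorm Y a \<le> vnorm Y (c \<odot>\<^bsub>Y\<^esub> a)"
    proof (cases "c = 0")
      case True
      then show ?thesis
        unfolding f(2) j_smult[OF f(1)] j_norm[OF C_smult[OF f(1)]]
        using sup_sphere_nonneg[OF C_continuous[OF C_smult[OF f(1)]], of c] by simp
    next
      case False
      have eq: "j (\<lambda>x\<in>S. inverse c * (\<lambda>x\<in>S. c * f x) x) = j f"
        using False by (intro j_restrict_eq f(1)) simp
      have "vnorm Y (j f) \<le> cmod (inverse c) * vnorm Y (j (\<lambda>x\<in>S. c * f x))"
        using le[OF C_smult[OF f(1)], of "inverse c" c] unfolding eq .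
      then show ?thesis unfolding f(2) j_smult[OF f(1)] using False by (simp add: norm_inverse norm_divide field_simps)
    qed
  qed
  fix b assume "b \<in> carrier Y"
  then obtain g where g: "g \<in> C" "b = j g" unfolding Y_simps by blast
  show "vnorm Y (a \<oplus>\<^bsub>Y\<^esub> b) \<le> vnorm Y a + vnorm Y b"
    unfolding f(2) g(2) j_add[OF f(1) g(1)] j_norm[OF f(1)] j_norm[OF g(1)] j_norm[OF C_add[OF f(1) g(1)]]
  proof (rule sup_sphere_le)
    fix x assume x: "x \<in> S"
    have "cmod (f x + g x) \<le> cmod (f x) + cmod (g x)" by (rule norm_triangle_ineq)
    then show "cmod ((\<lambda>x\<in>S. f x + g x) x) \<le> (SUP x\<in>S. cmod (f x)) + (SUP x\<in>S. cmod (g x))"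
      using x cmod_le_sup_sphere[OF cf x] cmod_le_sup_sphere[OF C_continuous[OF g(1)] x] by simp
  qed
qed

lemma j_diff: "f \<in> C \<Longrightarrow> g \<in> C \<Longrightarrow> j f \<ominus>\<^bsub>Y\<^esub> j g = j (\<lambda>x\<in>S. f x - g x)"
proof -
  assume fg: "f \<in> C" "g \<in> C"
  have "j g \<in> carrier Y" using fg by (simp add: Y_simps)
  then have "j f \<ominus>\<^bsub>Y\<^esub> j g = j f \<oplus>\<^bsub>Y\<^esub> (- 1) \<odot>\<^bsub>Y\<^esub> j g"
    by (simp add: a_minus_def Y.Y.scale_minus_one)
  also have "\<dots> = j (\<lambda>x\<in>S. f x - g x)"
    unfolding j_smult[OF fg(2)] j_add[OF fg(1) C_smult[OF fg(2)]] by (rule j_eqI) simp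
  finally show ?thesis .
qed

lemma C_diff: "f \<in> C \<Longrightarrow> g \<in> C \<Longrightarrow> (\<lambda>x\<in>S. f x - g x) \<in> C"
  by (intro restrict_sphere_functions continuous_intros C_continuous)

text \<open>A Cauchy sequence in the supremum norm is uniformly Cauchy, and uniform limits preserve
  continuity. The limit is restricted to the sphere to be extensional again.\<close>

sublocale Y: complex_banach_space Y
proof
  fix s :: "nat \<Rightarrow> 'b"
  assume s: "\<And>k. s k \<in> carrier Y"
    and cauchy: "\<And>e. e > 0 \<Longrightarrow> \<exists>N. \<forall>i\<ge>N. \<forall>k\<ge>N. vnorm Y (s i \<ominus>\<^bsub>Y\<^esub> s k) < e"
  define f where "f k = D (s k)" for k
  have f: "f k \<in> C" "s k = j (f k)" for k
    using s[of k] unfolding Y_simps f_def by auto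
  have norm_diff: "vnorm Y (s i \<ominus>\<^bsub>Y\<^esub> s k) = (SUP x\<in>S. cmod ((\<lambda>x\<in>S. f i x - f k x) x))" for i k
    unfolding f(2) j_diff[OF f(1) f(1)] j_norm[OF C_diff[OF f(1) f(1)]] ..
  have "uniformly_Cauchy_on S f"
    unfolding uniformly_Cauchy_on_def
  proof (intro allI impI)
    fix e :: real assume "e > 0"
    from cauchy[OF this] obtain N where N: "\<And>i k. i \<ge> N \<Longrightarrow> k \<ge> N \<Longrightarrow> vnorm Y (s i \<ominus>\<^bsub>Y\<^esub> s k) < e" by blast
    have "dist (f i x) (f k x) < e" if "x \<in> S" "i \<ge> N" "k \<ge> N" for x i k
    proof -
      have "cmod ((\<lambda>x\<in>S. f i x - f k x) x) < e"
        using cmod_le_sup_sphere[OF C_continuous[OF C_diff[OF f(1) f(1)]] that(1), of i k] N[OF that(2,3)]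
        unfolding norm_diff by (rule le_less_trans)
      then show ?thesis using that(1) by (simp add: dist_norm)
    qed
    then show "\<exists>M. \<forall>x\<in>S. \<forall>m\<ge>M. \<forall>n\<ge>M. dist (f m x) (f n x) < e" by blast
  qed
  then obtain l where l: "uniform_limit S f l sequentially"
    using Cauchy_uniformly_convergent[of S f] unfolding uniformly_convergent_on_def by blast
  have "continuous_on S l"
  proof (rule uniform_limit_theorem[OF _ l])
    show "\<forall>\<^sub>F k in sequentially. continuous_on S (f k)"
      by (intro always_eventually allI C_continuous[OF f(1)])
  qed simp
  then have lC: "restrict l S \<in> C" by (rule restrict_sphere_functions)
  have "(\<lambda>k. vnorm Y (s k \<ominus>\<^bsub>Y\<^esub> j (restrict l S))) \<longlonglongrightarrow> 0"
  proof (rule tendstoI)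
    fix e :: real assume e: "e > 0"
    have "\<forall>\<^sub>F k in sequentially. \<forall>x\<in>S. dist (f k x) (l x) < e / 2"
      using l e unfolding uniform_limit_iff by (meson half_gt_zero)
    then show "\<forall>\<^sub>F k in sequentially. dist (vnorm Y (s k \<ominus>\<^bsub>Y\<^esub> j (restrict l S))) 0 < e"
    proof eventually_elim
      case (elim k)
      have "vnorm Y (s k \<ominus>\<^bsub>Y\<^esub> j (restrict l S)) \<le> e / 2"
        unfolding f(2) j_diff[OF f(1) lC] j_norm[OF C_diff[OF f(1) lC]]
        using elim by (intro sup_sphere_le) (simp add: dist_norm less_imp_le)
      moreover have "0 \<le> vnorm Y (s k \<ominus>\<^bsub>Y\<^esub> j (restrict l S))"
        unfolding f(2) j_diff[OF f(1) lC] j_norm[OF C_diff[OF f(1) lC]]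
        by (rule sup_sphere_nonneg[OF C_continuous[OF C_diff[OF f(1) lC]]])
      ultimately show ?case using e by simp
    qed
  qed
  then show "\<exists>x\<in>carrier Y. (\<lambda>k. vnorm Y (s k \<ominus>\<^bsub>Y\<^esub> x)) \<longlonglongrightarrow> 0"
    using lC unfolding Y_simps(1) by blast
qed

lemma isometric_embedding_j: "isometric_embedding (spherical_harmonics d) Y j"
proof -
  have XC: "f \<in> C" if "f \<in> carrier (spherical_harmonics d)" for f
    using that spherical_harmonics_subset by blast
  show ?thesis
    unfolding isometric_embedding_def complex_linear_map_def spherical_harmonics_simps
  proof (intro conjI ballI allI)
    show "j \<in> carrier (spherical_harmonics d) \<rightarrow> carrier Y" using XC by (auto simp: Y_simps)
  qed (simp_all only: XC j_add j_smult j_norm)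
qed

end

text \<open>Conjugating a projection \<open>P\<close> of the encoded space with the encoding gives a
  projection of C(S) itself, to which \<open>projection_lower_bound\<close> applies with the
  operator norm of \<open>P\<close>.\<close>

theorem relative_projection_constant_ge:
  fixes j :: "(real ^ 'n::{finite,wellorder} \<Rightarrow> complex) \<Rightarrow> 'b" and e :: "real ^ 'n::{finite,wellorder}"
  assumes n: "CARD('n) \<ge> 3" and inj: "inj_on j sphere_functions" and e: "norm e = 1"
  shows "ereal (LINT y|sphere_measure. \<bar>poly (zonal_poly CARD('n) d) (e \<bullet> y)\<bar>)
    \<le> relative_projection_constant (j ` carrier (spherical_harmonics d)) (encoded_sphere_functions.Y j)"
  unfolding relative_projection_constant_def
proof (rule INF_greatest)
  interpret encoded_sphere_functions j by standard (rule inj)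
  fix P assume "P \<in> bounded_projections (j ` carrier (spherical_harmonics d)) Y"
  then have lin: "complex_linear_map Y Y P" and bd: "\<exists>K. \<forall>x\<in>carrier Y. vnorm Y (P x) \<le> K * vnorm Y x"
    and range: "P ` carrier Y \<subseteq> j ` carrier (spherical_harmonics d)"
    and id: "\<And>h. h \<in> carrier (spherical_harmonics d) \<Longrightarrow> P (j h) = j h"
    by (auto simp: bounded_projections_def bounded_operator_def)
  define N where "N = operator_norm Y Y P"
  define Q where "Q f = D (P (j f))" for f
  have jC: "j f \<in> carrier Y" if "f \<in> C" for f using that by (simp add: Y_simps)
  have Q: "Q f \<in> carrier (spherical_harmonics d) \<and> P (j f) = j (Q f)" if f: "f \<in> C" for f
  proof -
    obtain h where h: "h \<in> carrier (spherical_harmonics d)" "P (j f) = j h" using range jC[OF f] by blast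
    then have "Q f = h" using D_j[OF subsetD[OF spherical_harmonics_subset h(1)]] by (simp add: Q_def)
    with h show ?thesis by simp
  qed
  have QC: "Q f \<in> C" if "f \<in> C" for f using Q[OF that] spherical_harmonics_subset by blast
  have "(LINT y|sphere_measure. \<bar>poly (zonal_poly CARD('n) d) (e \<bullet> y)\<bar>) \<le> N"
  proof (rule projection_lower_bound[OF n _ _ _ _ _ e])
    fix f g assume fg: "f \<in> C" "g \<in> C"
    have "P (j (\<lambda>x\<in>S. f x + g x)) = P (j f) \<oplus>\<^bsub>Y\<^esub> P (j g)"
      using lin jC fg unfolding complex_linear_map_def j_add[OF fg, symmetric] by blast
    also have "\<dots> = j (\<lambda>x\<in>S. Q f x + Q g x)"
      using Q[OF fg(1)] Q[OF fg(2)] j_add[OF QC[OF fg(1)] QC[OF fg(2)]] by simp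
    finally show "Q (\<lambda>x\<in>S. f x + g x) = (\<lambda>x\<in>S. Q f x + Q g x)"
      unfolding Q_def[of "\<lambda>x\<in>S. f x + g x"] using C_add[OF QC[OF fg(1)] QC[OF fg(2)]] by (simp only: D_j)
  next
    fix c f assume f: "f \<in> C"
    have "P (j (\<lambda>x\<in>S. c * f x)) = c \<odot>\<^bsub>Y\<^esub> P (j f)"
      using lin jC f unfolding complex_linear_map_def j_smult[OF f, symmetric] by blast
    also have "\<dots> = j (\<lambda>x\<in>S. c * Q f x)"
      using Q[OF f] j_smult[OF QC[OF f]] by simp
    finally show "Q (\<lambda>x\<in>S. c * f x) = (\<lambda>x\<in>S. c * Q f x)"
      unfolding Q_def[of "\<lambda>x\<in>S. c * f x"] using C_smult[OF QC[OF f]] by (simp only: D_j)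
  next
    show "Q f \<in> carrier (spherical_harmonics d)" if "f \<in> C" for f using Q[OF that] by blast
    show "Q h = h" if h: "h \<in> carrier (spherical_harmonics d)" for h
      using id[OF h] D_j[OF subsetD[OF spherical_harmonics_subset h]] by (simp add: Q_def)
  next
    fix f M x
    assume f: "f \<in> C" and M: "M > 0" and fM: "\<And>x. x \<in> S \<Longrightarrow> cmod (f x) \<le> M" and x: "x \<in> S"
    \<comment> \<open>The operator norm is a supremum over the unit ball, so the function is first
      scaled into it.\<close>
    let ?y = "of_real (1 / M) \<odot>\<^bsub>Y\<^esub> j f"
    have y: "?y \<in> carrier Y" using jC[OF f] by simp
    have "vnorm Y (j f) \<le> M" unfolding j_norm[OF f] by (rule sup_sphere_le[OF fM])
    then have y1: "vnorm Y ?y \<le> 1"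
      unfolding Y.vnorm_smult[OF jC[OF f]] using M by (simp add: norm_divide)
    obtain K where K: "\<And>x. x \<in> carrier Y \<Longrightarrow> vnorm Y (P x) \<le> K * vnorm Y x" using bd by blast
    have "vnorm Y (P ?y) \<le> N"
      unfolding N_def operator_norm_def
    proof (rule cSUP_upper)
      show "?y \<in> {x \<in> carrier Y. vnorm Y x \<le> 1}" using y y1 by blast
      \<comment> \<open>A real supremum bounds its members only if the set is bounded above. The
        constant \<open>K\<close> may be negative, hence the absolute value.\<close>
      have "vnorm Y (P x) \<le> \<bar>K\<bar>" if "x \<in> carrier Y" "vnorm Y x \<le> 1" for x
      proof -
        have "vnorm Y (P x) \<le> \<bar>K\<bar> * vnorm Y x"
          using K[OF that(1)] mult_right_mono[OF abs_ge_self[of K] Y.vnorm_nonneg[OF that(1)]] by linarith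
        also have "\<dots> \<le> \<bar>K\<bar> * 1" using that(2) by (intro mult_left_mono) auto
        finally show ?thesis by simp
      qed
      then show "bdd_above ((\<lambda>x. vnorm Y (P x)) ` {x \<in> carrier Y. vnorm Y x \<le> 1})"
        by (intro bdd_aboveI2) blast
    qed
    moreover have "P ?y = of_real (1 / M) \<odot>\<^bsub>Y\<^esub> j (Q f)"
      using lin jC[OF f] Q[OF f] unfolding complex_linear_map_def by simp
    ultimately have "vnorm Y (j (Q f)) \<le> N * M"
      using M by (simp add: Y.vnorm_smult[OF jC[OF QC[OF f]]] norm_divide field_simps)
    then show "cmod (Q f x) \<le> N * M"
      using cmod_le_sup_sphere[OF C_continuous[OF QC[OF f]] x] unfolding j_norm[OF QC[OF f]] by linarith
  qed
  then show "ereal (LINT y|sphere_measure. \<bar>poly (zonal_poly CARD('n) d) (e \<bullet> y)\<bar>) \<le> ereal (operator_norm Y Y P)"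
    by (simp add: N_def)
qed

theorem projection_constant_spherical_harmonics:
  fixes e :: "real ^ 'n::{finite,wellorder}"
  assumes n: "CARD('n) \<ge> 3" and e: "norm e = 1" and universe: "\<exists>f :: real \<Rightarrow> 'b. inj f"
  shows "projection_constant TYPE('b) (spherical_harmonics d :: (real ^ 'n::{finite,wellorder} \<Rightarrow> complex) normed_structure)
    = ereal (LINT y|sphere_measure. \<bar>poly (zonal_poly CARD('n) d) (e \<bullet> y)\<bar>)"
proof (rule antisym)
  let ?c = "LINT y|sphere_measure. \<bar>poly (zonal_poly CARD('n) d) (e \<bullet> y)\<bar>"
  define \<alpha> where "\<alpha> = (real CARD('n) - 3) / 2"
  have \<alpha>: "\<alpha> \<ge> 0" using n by (simp add: \<alpha>_def)
  have m: "measure (jacobi_measure \<alpha>) UNIV > 0"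
    unfolding measure_jacobi_measure[OF \<alpha>] Beta_def using \<alpha> by (simp add: Gamma_real_pos)
  \<comment> \<open>The integral does not depend on the point \<open>z\<close>, since each such
    integral reduces to the same integral in one variable. So the bound for arbitrary Y and the
    bound from C(S) meet in one constant.\<close>
  have c: "(LINT x|sphere_measure. cmod (zonal_kernel d z x)) = ?c" if z: "norm z = 1" for z :: "real ^ 'n::{finite,wellorder}"
  proof -
    let ?f = "\<lambda>t. \<bar>poly (zonal_poly CARD('n) d) t\<bar>"
    have cf: "continuous_on UNIV ?f" by (intro continuous_intros)
    have cont: "continuous_on UNIV (\<lambda>y. ?f (z \<bullet> y))"
      by (rule continuous_on_compose2[OF cf]) (auto intro!: continuous_intros)
    have "(LINT x|sphere_measure. cmod (zonal_kernel d z x)) = (LINT x|sphere_measure. ?f (z \<bullet> x))"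
    proof (rule integral_cong_AE)
      show "AE x in sphere_measure. cmod (zonal_kernel d z x) = ?f (z \<bullet> x)"
        using AE_sphere_measure by eventually_elim (simp add: zonal_kernel_sphere[OF n z])
      show "(\<lambda>x. cmod (zonal_kernel d z x)) \<in> borel_measurable sphere_measure"
        by (intro borel_measurable_integrable integrable_norm integrable_sphere_mpoly
            separable_mpoly_right[OF separable_zonal_kernel])
      show "(\<lambda>x. ?f (z \<bullet> x)) \<in> borel_measurable sphere_measure"
        by (rule borel_measurable_integrable[OF integrable_sphere_measure[OF cont]])
    qed
    also have "\<dots> = ?c"
    proof -
      have "measure (jacobi_measure \<alpha>) UNIV * (LINT x|sphere_measure. ?f (z \<bullet> x)) = measure (jacobi_measure \<alpha>) UNIV * ?c"
        unfolding sphere_integral_zonal[OF n \<alpha>_def z cf] sphere_integral_zonal[OF n \<alpha>_def e cf] ..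
      then show ?thesis using m by simp
    qed
    finally show ?thesis .
  qed
  show "projection_constant TYPE('b) (spherical_harmonics d :: (real ^ 'n::{finite,wellorder} \<Rightarrow> complex) normed_structure) \<le> ereal ?c"
    unfolding projection_constant_def
  proof (rule SUP_least, clarify)
    fix Y :: "'b normed_structure" and I :: "(real ^ 'n::{finite,wellorder} \<Rightarrow> complex) \<Rightarrow> 'b"
    assume "complex_banach_space Y" and I: "isometric_embedding (spherical_harmonics d) Y I"
    then interpret complex_banach_space Y by simp
    show "relative_projection_constant (I ` carrier (spherical_harmonics d)) Y \<le> ereal ?c"
      by (rule relative_projection_constant_le[OF n I]) (simp add: c)
  qed
  obtain j :: "(real ^ 'n::{finite,wellorder} \<Rightarrow> complex) \<Rightarrow> 'b" where j: "inj_on j sphere_functions"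
    using inj_sphere_functions[OF universe] by blast
  interpret encoded_sphere_functions j by standard (rule j)
  have "ereal ?c \<le> relative_projection_constant (j ` carrier (spherical_harmonics d)) Y"
    by (rule relative_projection_constant_ge[OF n j e])
  also have "\<dots> \<le> projection_constant TYPE('b) (spherical_harmonics d :: (real ^ 'n::{finite,wellorder} \<Rightarrow> complex) normed_structure)"
    unfolding projection_constant_def
    by (rule SUP_upper2[of "(Y, j)"])
      (use Y.complex_banach_space_axioms isometric_embedding_j in auto)
  finally show "ereal ?c \<le> projection_constant TYPE('b) (spherical_harmonics d :: (real ^ 'n::{finite,wellorder} \<Rightarrow> complex) normed_structure)" .
qed

section \<open>Evaluation of the constant\<close>

text \<open>The mass contains the Beta function at ((n - 1) / 2, (n - 1) / 2), whose denominator is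
  Gamma(n - 1) = (n - 2) Gamma(n - 2); this cancels the denominators n - 2 and Gamma(n - 2) of
  \<open>zonal_factor\<close>.\<close>

lemma zonal_factor_div_measure:
  assumes n: "n \<ge> 3" and \<alpha>: "\<alpha> = (real n - 3) / 2"
  shows "zonal_factor n d / measure (jacobi_measure \<alpha>) UNIV
    = (2 * real d + real n - 2) / 2 ^ (n - 2)
      * (Gamma (real d + real n - 2) / (Gamma ((real n - 1) / 2) * Gamma (real d + (real n - 1) / 2)))"
proof -
  have a: "\<alpha> \<ge> 0" using n \<alpha> by simp
  define g g1 g2 g3 where "g = Gamma ((real n - 1) / 2)" and "g1 = Gamma (real n - 2)"
    and "g2 = Gamma (real d + real n - 2)" and "g3 = Gamma (real d + (real n - 1) / 2)"
  have pos: "g > 0" "g1 > 0" "g2 > 0" "g3 > 0"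
    using n by (auto simp: g_def g1_def g2_def g3_def intro!: Gamma_real_pos add_nonneg_pos)
  have e: "\<alpha> + 1 = (real n - 1) / 2" "2 * \<alpha> + 1 = real (n - 2)" "(real n - 1) / 2 + (real n - 1) / 2 = real n - 2 + 1"
    "real n - 2 + real d = real d + real n - 2" "(real n - 1) / 2 + real d = real d + (real n - 1) / 2"
    using n by (simp_all add: \<alpha> field_simps of_nat_diff)
  have "Gamma (real n - 2 + 1) = (real n - 2) * g1"
    unfolding g1_def by (rule Gamma_plus1) (use n in \<open>auto elim!: nonpos_Ints_cases\<close>)
  then have "measure (jacobi_measure \<alpha>) UNIV = 2 ^ (n - 2) * (g * g / ((real n - 2) * g1))"
    unfolding measure_jacobi_measure[OF a] Beta_def e(1,2,3) by (simp add: g_def powr_realpow)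
  moreover have "zonal_factor n d = (2 * real d + real n - 2) / (real n - 2) * (g2 * g / (g1 * g3))"
    unfolding zonal_factor_def e(4,5) g_def g1_def g2_def g3_def ..
  moreover have "c / N * (g2 * g / (g1 * g3)) / (t * (g * g / (N * g1))) = c / t * (g2 / (g * g3))"
    if "N > 0" "t > 0" for c N t :: real
    using pos that by (simp add: field_simps)
  from this[of "real n - 2" "2 ^ (n - 2)" "2 * real d + real n - 2"] have
    "(2 * real d + real n - 2) / (real n - 2) * (g2 * g / (g1 * g3)) / (2 ^ (n - 2) * (g * g / ((real n - 2) * g1)))
      = (2 * real d + real n - 2) / 2 ^ (n - 2) * (g2 / (g * g3))"
    using n by simp
  ultimately show ?thesis by (simp only: g_def g2_def g3_def)
qed

lemma sphere_integral_zonal_poly_jacobi: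
  fixes e :: "real ^ 'n::{finite,wellorder}"
  assumes n: "CARD('n) \<ge> 3" and \<alpha>: "\<alpha> = (real CARD('n) - 3) / 2" and e: "norm e = 1"
  shows "(LINT y|sphere_measure. \<bar>poly (zonal_poly CARD('n) d) (e \<bullet> y)\<bar>)
    = (2 * real d + real CARD('n) - 2) / 2 ^ (CARD('n) - 2)
        * (Gamma (real d + real CARD('n) - 2) / (Gamma ((real CARD('n) - 1) / 2) * Gamma (real d + (real CARD('n) - 1) / 2)))
        * (LBINT t:{-1..1}. \<bar>poly (jacobi_poly \<alpha> \<alpha> d) t\<bar> * (1 - t\<^sup>2) powr \<alpha>)"
proof -
  let ?p = "\<lambda>t. \<bar>poly (jacobi_poly \<alpha> \<alpha> d) t\<bar>" and ?m = "measure (jacobi_measure \<alpha>) UNIV"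
  have a: "\<alpha> \<ge> 0" using n \<alpha> by simp
  have cp: "continuous_on UNIV ?p" by (intro continuous_intros)
  have m: "?m > 0"
    unfolding measure_jacobi_measure[OF a] Beta_def using a by (simp add: Gamma_real_pos)
  have "zonal_factor CARD('n) d \<ge> 0"
    unfolding zonal_factor_def using n by (intro mult_nonneg_nonneg divide_nonneg_nonneg less_imp_le[OF Gamma_real_pos])
      (auto intro!: add_pos_nonneg)
  then have "(LINT y|sphere_measure. \<bar>poly (zonal_poly CARD('n) d) (e \<bullet> y)\<bar>)
      = (LINT y|sphere_measure. zonal_factor CARD('n) d * ?p (e \<bullet> y))"
    by (simp add: zonal_poly_jacobi \<alpha> abs_mult)
  also have "\<dots> = zonal_factor CARD('n) d * (LINT y|sphere_measure. ?p (e \<bullet> y))" by simp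
  also have "\<dots> = zonal_factor CARD('n) d / ?m * (?m * (LINT y|sphere_measure. ?p (e \<bullet> y)))" using m by simp
  also have "?m * (LINT y|sphere_measure. ?p (e \<bullet> y)) = (LBINT t:{-1..1}. ?p t * (1 - t\<^sup>2) powr \<alpha>)"
    unfolding sphere_integral_zonal[OF n \<alpha> e cp] by (rule integral_jacobi_measure[OF cp])
  finally show ?thesis unfolding zonal_factor_div_measure[OF n \<alpha>] .
qed

lemma sphere_integral_zonal_poly_gegenbauer:
  fixes i :: "'n::{finite,wellorder}"
  assumes n: "CARD('n) \<ge> 3"
  shows "(LINT y|sphere_measure. \<bar>poly (zonal_poly CARD('n) d) (axis i 1 \<bullet> y)\<bar>)
    = (2 * real d + real CARD('n) - 2) / (real CARD('n) - 2)
      * (LINT \<eta>:sphere 0 1|sphere_measure. \<bar>poly (gegenbauer_poly ((real CARD('n) - 2) / 2) d) ((\<eta> :: real ^ 'n::{finite,wellorder}) $ i)\<bar>)"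
proof -
  let ?g = "\<lambda>\<eta> :: real ^ 'n::{finite,wellorder}. \<bar>poly (gegenbauer_poly ((real CARD('n) - 2) / 2) d) (\<eta> $ i)\<bar>"
  have "(LINT y|sphere_measure. \<bar>poly (zonal_poly CARD('n) d) (axis i 1 \<bullet> y)\<bar>)
      = (LINT \<eta>|sphere_measure. (2 * real d + real CARD('n) - 2) / (real CARD('n) - 2) * ?g \<eta>)"
    using n by (simp add: zonal_poly_def inner_axis' abs_mult)
  also have "\<dots> = (2 * real d + real CARD('n) - 2) / (real CARD('n) - 2) * (LINT \<eta>|sphere_measure. ?g \<eta>)" by simp
  also have "(LINT \<eta>|sphere_measure. ?g \<eta>) = (LINT \<eta>:sphere 0 1|sphere_measure. ?g \<eta>)"
    unfolding set_lebesgue_integral_def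
  proof (rule integral_cong_AE)
    have g: "?g \<in> borel_measurable sphere_measure"
      by (intro borel_measurable_integrable integrable_sphere_measure continuous_intros)
    then show "?g \<in> borel_measurable sphere_measure" .
    show "(\<lambda>\<eta>. indicat_real (sphere 0 1) \<eta> *\<^sub>R ?g \<eta>) \<in> borel_measurable sphere_measure"
      using g by (intro borel_measurable_scaleR borel_measurable_indicator) simp_all
    show "AE \<eta> in sphere_measure. ?g \<eta> = indicat_real (sphere 0 1) \<eta> *\<^sub>R ?g \<eta>"
      using AE_sphere_measure by eventually_elim simp
  qed
  finally show ?thesis .
qed

theorem theorem4p3:
  fixes d n :: nat and \<alpha> :: real
  assumes "n = CARD('n::{finite,wellorder})" and "n \<ge> 3" and "d \<ge> 1" and "\<alpha> = (real n - 3) / 2"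
    and universe: "\<exists>f :: real \<Rightarrow> 'b. inj f"
  shows "projection_constant TYPE('b) (spherical_harmonics d :: (real ^ 'n::{finite,wellorder} \<Rightarrow> complex) normed_structure)
      = ereal ((2 * real d + real n - 2) / 2 ^ (n - 2)
          * (Gamma (real d + real n - 2) / (Gamma ((real n - 1) / 2) * Gamma (real d + (real n - 1) / 2)))
          * (LBINT t:{-1..1}. \<bar>poly (jacobi_poly \<alpha> \<alpha> d) t\<bar> * (1 - t\<^sup>2) powr \<alpha>))
    \<and> projection_constant TYPE('b) (spherical_harmonics d :: (real ^ 'n::{finite,wellorder} \<Rightarrow> complex) normed_structure)
      = ereal ((2 * real d + real n - 2) / (real n - 2)
          * (LINT \<eta>:sphere 0 1|sphere_measure. \<bar>poly (gegenbauer_poly ((real n - 2) / 2) d) ((\<eta> :: real ^ 'n::{finite,wellorder}) $ (LEAST i. True))\<bar>))"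
proof -
  \<comment> \<open>The least index stands for the first coordinate, so the inner product with
    \<open>e\<close> is the coordinate \<eta>_1 of the Gegenbauer formula.\<close>
  define e where "e = (axis (LEAST i. True) 1 :: real ^ 'n::{finite,wellorder})"
  have e: "norm e = 1" by (simp add: e_def)
  have n: "CARD('n::{finite,wellorder}) \<ge> 3" and \<alpha>: "\<alpha> = (real CARD('n::{finite,wellorder}) - 3) / 2"
    using assms by simp_all
  have pc: "projection_constant TYPE('b) (spherical_harmonics d :: (real ^ 'n::{finite,wellorder} \<Rightarrow> complex) normed_structure)
      = ereal (LINT y|sphere_measure. \<bar>poly (zonal_poly CARD('n::{finite,wellorder}) d) (e \<bullet> y)\<bar>)"
    by (rule projection_constant_spherical_harmonics[OF n e universe])
  show ?thesis
  proof
    show "projection_constant TYPE('b) (spherical_harmonics d :: (real ^ 'n::{finite,wellorder} \<Rightarrow> complex) normed_structure)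
      = ereal ((2 * real d + real n - 2) / 2 ^ (n - 2)
          * (Gamma (real d + real n - 2) / (Gamma ((real n - 1) / 2) * Gamma (real d + (real n - 1) / 2)))
          * (LBINT t:{-1..1}. \<bar>poly (jacobi_poly \<alpha> \<alpha> d) t\<bar> * (1 - t\<^sup>2) powr \<alpha>))"
      unfolding pc sphere_integral_zonal_poly_jacobi[OF n \<alpha> e] assms(1) ..
    show "projection_constant TYPE('b) (spherical_harmonics d :: (real ^ 'n::{finite,wellorder} \<Rightarrow> complex) normed_structure)
      = ereal ((2 * real d + real n - 2) / (real n - 2)
          * (LINT \<eta>:sphere 0 1|sphere_measure. \<bar>poly (gegenbauer_poly ((real n - 2) / 2) d) ((\<eta> :: real ^ 'n::{finite,wellorder}) $ (LEAST i. True))\<bar>))"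
      unfolding pc e_def sphere_integral_zonal_poly_gegenbauer[OF n] assms(1) ..
  qed
qed

end
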